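(* Let $G\subset \mathrm{GL}(V)$ be a finite group, $V$ a finite-dimensional complex vector space, $B=S(V)$, $\mathcal D=\mathcal D_B^G$ and $\mathcal R=\mathcal D^0/(\mathcal D^0\cap \mathcal D\mathcal D^-)$. Then: (1) $B^{ann}$ is a finite-dimensional semisimple $\mathcal R$-module. (2) There is an isomorphism of categories between the category of $\mathcal D$-submodules of $B$ and the category of $\mathcal R$-submodules of $B^{ann}$. The isomorphism is $N\mapsto N^{ann}$, for $N$ a $\mathcal D$-submodule of $B$, and its inverse is $W\mapsto \mathcal D W$, for $W$ an $\mathcal R$-submodule of $B^{ann}$. (3) Under this isomorphism simple $\mathcal D$-submodules of $B$ correspond to simple $\mathcal R$-submodules of $B^{ann}$. (4) Each simple $\mathcal R$-submodule of $B^{ann}$ is concentrated in a single degree.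
   Context: $B=S(V)=\mathbb C[x_1,\dots,x_n]$ where $x_1,\dots,x_n$ is a basis of $V$ placed in degree $1$, and $\mathcal D_B=\mathbb C\langle x_i,\partial_i\rangle$ is the Weyl algebra of differential operators on $B$. It is graded by $\deg x_i=1$, $\deg\partial_i=-1$, equivalently by the adjoint action of $\nabla=\sum_i x_i\partial_i$. $G$ acts on $B$ by graded algebra automorphisms and on $\mathcal D_B$ by $(g\cdot P)(b)=g(P(g^{-1}b))$; $\mathcal D=\mathcal D_B^G$ is the graded ring of invariant differential operators, $\mathcal D^0$ its degree $0$ part and $\mathcal D^-$ the sum of its parts of strictly negative degree. For a $\mathcal D$-submodule $N\subset B$, $N^{ann}=\{n\in N:\mathcal D^-n=0\}$, a module over $\mathcal R$. In both categories the objects are all submodules and the morphisms are all module homomorphisms between them. *)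

theory Defs
  imports "Jordan_Normal_Form.Matrix" "HOL-Library.Poly_Mapping" "HOL-Algebra.QuotRing"
    "HOL-Algebra.Generated_Rings" "HOL-Algebra.Generated_Groups" "HOL-Algebra.Module"
begin

text \<open>The locale \<open>module\<close> of the library requires a commutative ring of scalars. The
  library record is kept; its fields \<open>mult\<close> and \<open>one\<close> play no role for a
  module. The library locale \<open>submodule\<close> needs no commutativity.\<close>

locale left_module = R?: ring R + M?: abelian_group M
  for R :: "('r, 'k) ring_scheme" and M :: "('r, 'm, 'l) module_scheme" (structure) +
  assumes smult_closed: "\<lbrakk>a \<in> carrier R; x \<in> carrier M\<rbrakk> \<Longrightarrow> a \<odot>\<^bsub>M\<^esub> x \<in> carrier M"
    and smult_l_distr: "\<lbrakk>a \<in> carrier R; b \<in> carrier R; x \<in> carrier M\<rbrakk>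
      \<Longrightarrow> (a \<oplus>\<^bsub>R\<^esub> b) \<odot>\<^bsub>M\<^esub> x = (a \<odot>\<^bsub>M\<^esub> x) \<oplus>\<^bsub>M\<^esub> (b \<odot>\<^bsub>M\<^esub> x)"
    and smult_r_distr: "\<lbrakk>a \<in> carrier R; x \<in> carrier M; y \<in> carrier M\<rbrakk>
      \<Longrightarrow> a \<odot>\<^bsub>M\<^esub> (x \<oplus>\<^bsub>M\<^esub> y) = (a \<odot>\<^bsub>M\<^esub> x) \<oplus>\<^bsub>M\<^esub> (a \<odot>\<^bsub>M\<^esub> y)"
    and smult_assoc: "\<lbrakk>a \<in> carrier R; b \<in> carrier R; x \<in> carrier M\<rbrakk>
      \<Longrightarrow> (a \<otimes>\<^bsub>R\<^esub> b) \<odot>\<^bsub>M\<^esub> x = a \<odot>\<^bsub>M\<^esub> (b \<odot>\<^bsub>M\<^esub> x)"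
    and smult_one: "x \<in> carrier M \<Longrightarrow> \<one>\<^bsub>R\<^esub> \<odot>\<^bsub>M\<^esub> x = x"

definition module_hom ::
  "('r, 'k) ring_scheme \<Rightarrow> ('r, 'm, 'l) module_scheme \<Rightarrow> ('r, 'm, 'l) module_scheme \<Rightarrow> ('m \<Rightarrow> 'm) set"
  where "module_hom R M N = {f \<in> carrier M \<rightarrow>\<^sub>E carrier N.
    (\<forall>x\<in>carrier M. \<forall>y\<in>carrier M. f (x \<oplus>\<^bsub>M\<^esub> y) = f x \<oplus>\<^bsub>N\<^esub> f y) \<and>
    (\<forall>a\<in>carrier R. \<forall>x\<in>carrier M. f (a \<odot>\<^bsub>M\<^esub> x) = a \<odot>\<^bsub>N\<^esub> f x)}"

definition simple_module :: "('r, 'k) ring_scheme \<Rightarrow> ('r, 'm, 'l) module_scheme \<Rightarrow> bool"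
  where "simple_module R M \<longleftrightarrow> left_module R M \<and> carrier M \<noteq> {\<zero>\<^bsub>M\<^esub>} \<and>
    (\<forall>N. submodule N R M \<longrightarrow> N = {\<zero>\<^bsub>M\<^esub>} \<or> N = carrier M)"

definition simple_submodule :: "'m set \<Rightarrow> ('r, 'k) ring_scheme \<Rightarrow> ('r, 'm, 'l) module_scheme \<Rightarrow> bool"
  where "simple_submodule N R M \<longleftrightarrow> submodule N R M \<and> simple_module R (M\<lparr>carrier := N\<rparr>)"

text \<open>Internal direct sum of simple submodules. The sum of a family of submodules is the
  additive subgroup generated by their union.\<close>

definition semisimple_module :: "('r, 'k) ring_scheme \<Rightarrow> ('r, 'm, 'l) module_scheme \<Rightarrow> bool"
  where "semisimple_module R M \<longleftrightarrow> left_module R M \<and>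
    (\<exists>S. (\<forall>N\<in>S. simple_submodule N R M) \<and>
         generate (add_monoid M) (\<Union>S) = carrier M \<and>
         (\<forall>N\<in>S. N \<inter> generate (add_monoid M) (\<Union>(S - {N})) = {\<zero>\<^bsub>M\<^esub>}))"

text \<open>\<open>Cmp X Y Z g f\<close> is the composite of \<open>f : X \<rightarrow> Y\<close> and \<open>g : Y \<rightarrow> Z\<close>.\<close>

record ('o, 'a) cat =
  Obj :: "'o set"
  Hom :: "'o \<Rightarrow> 'o \<Rightarrow> 'a set"
  Idt :: "'o \<Rightarrow> 'a"
  Cmp :: "'o \<Rightarrow> 'o \<Rightarrow> 'o \<Rightarrow> 'a \<Rightarrow> 'a \<Rightarrow> 'a"

definition is_cat :: "('o, 'a) cat \<Rightarrow> bool"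
  where "is_cat C \<longleftrightarrow>
    (\<forall>X\<in>Obj C. Idt C X \<in> Hom C X X) \<and>
    (\<forall>X\<in>Obj C. \<forall>Y\<in>Obj C. \<forall>Z\<in>Obj C. \<forall>f\<in>Hom C X Y. \<forall>g\<in>Hom C Y Z.
       Cmp C X Y Z g f \<in> Hom C X Z) \<and>
    (\<forall>X\<in>Obj C. \<forall>Y\<in>Obj C. \<forall>f\<in>Hom C X Y.
       Cmp C X X Y f (Idt C X) = f \<and> Cmp C X Y Y (Idt C Y) f = f) \<and>
    (\<forall>W\<in>Obj C. \<forall>X\<in>Obj C. \<forall>Y\<in>Obj C. \<forall>Z\<in>Obj C.
       \<forall>f\<in>Hom C W X. \<forall>g\<in>Hom C X Y. \<forall>h\<in>Hom C Y Z.
         Cmp C W Y Z h (Cmp C W X Y g f) = Cmp C W X Z (Cmp C X Y Z h g) f)"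

definition is_functor ::
  "('o, 'a) cat \<Rightarrow> ('p, 'b) cat \<Rightarrow> ('o \<Rightarrow> 'p) \<Rightarrow> ('o \<Rightarrow> 'o \<Rightarrow> 'a \<Rightarrow> 'b) \<Rightarrow> bool"
  where "is_functor C D Fo Fa \<longleftrightarrow>
    (\<forall>X\<in>Obj C. Fo X \<in> Obj D) \<and>
    (\<forall>X\<in>Obj C. \<forall>Y\<in>Obj C. \<forall>f\<in>Hom C X Y. Fa X Y f \<in> Hom D (Fo X) (Fo Y)) \<and>
    (\<forall>X\<in>Obj C. Fa X X (Idt C X) = Idt D (Fo X)) \<and>
    (\<forall>X\<in>Obj C. \<forall>Y\<in>Obj C. \<forall>Z\<in>Obj C. \<forall>f\<in>Hom C X Y. \<forall>g\<in>Hom C Y Z.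
       Fa X Z (Cmp C X Y Z g f) = Cmp D (Fo X) (Fo Y) (Fo Z) (Fa Y Z g) (Fa X Y f))"

text \<open>The functors \<open>F = (Fo, Fa)\<close> and \<open>G = (Go, Ga)\<close> are mutually inverse,
  strictly and not only up to natural isomorphism.\<close>

definition inverse_functors ::
  "('o, 'a) cat \<Rightarrow> ('p, 'b) cat \<Rightarrow> ('o \<Rightarrow> 'p) \<Rightarrow> ('o \<Rightarrow> 'o \<Rightarrow> 'a \<Rightarrow> 'b)
    \<Rightarrow> ('p \<Rightarrow> 'o) \<Rightarrow> ('p \<Rightarrow> 'p \<Rightarrow> 'b \<Rightarrow> 'a) \<Rightarrow> bool"
  where "inverse_functors C D Fo Fa Go Ga \<longleftrightarrow>
    is_cat C \<and> is_cat D \<and> is_functor C D Fo Fa \<and> is_functor D C Go Ga \<and>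
    (\<forall>X\<in>Obj C. Go (Fo X) = X) \<and>
    (\<forall>X\<in>Obj C. \<forall>Y\<in>Obj C. \<forall>f\<in>Hom C X Y. Ga (Fo X) (Fo Y) (Fa X Y f) = f) \<and>
    (\<forall>X\<in>Obj D. Fo (Go X) = X) \<and>
    (\<forall>X\<in>Obj D. \<forall>Y\<in>Obj D. \<forall>f\<in>Hom D X Y. Fa (Go X) (Go Y) (Ga X Y f) = f)"

definition submodule_cat ::
  "('r, 'k) ring_scheme \<Rightarrow> ('r, 'm, 'l) module_scheme \<Rightarrow> ('m set, 'm \<Rightarrow> 'm) cat"
  where "submodule_cat R M = \<lparr>
    Obj = {N. submodule N R M},
    Hom = (\<lambda>N N'. module_hom R (M\<lparr>carrier := N\<rparr>) (M\<lparr>carrier := N'\<rparr>)),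
    Idt = (\<lambda>N. \<lambda>x\<in>N. x),
    Cmp = (\<lambda>N N' N'' g f. compose N g f)\<rparr>"

text \<open>The \<open>n\<close> variables are \<open>var 0, \<dots>, var (n - 1)\<close>; the value \<open>n = 0\<close> is allowed.
  \<open>polys n\<close> is the ring \<open>B\<close>, and \<open>homog n 1\<close> is the space \<open>V\<close>.\<close>

type_synonym mpoly = "(nat \<Rightarrow>\<^sub>0 nat) \<Rightarrow>\<^sub>0 complex"

definition const :: "complex \<Rightarrow> mpoly"
  where "const c = Poly_Mapping.single 0 c"

definition var :: "nat \<Rightarrow> mpoly"
  where "var i = Poly_Mapping.single (Poly_Mapping.single i 1) 1"

definition polys :: "nat \<Rightarrow> mpoly set"
  where "polys n = {p. \<forall>m\<in>Poly_Mapping.keys p. Poly_Mapping.keys m \<subseteq> {..<n}}"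

definition homog :: "nat \<Rightarrow> nat \<Rightarrow> mpoly set"
  where "homog n d = {p \<in> polys n. \<forall>m\<in>Poly_Mapping.keys p. (\<Sum>i\<in>Poly_Mapping.keys m. Poly_Mapping.lookup m i) = d}"

definition finite_dim :: "mpoly set \<Rightarrow> bool"
  where "finite_dim W \<longleftrightarrow> (\<exists>S. finite S \<and> W = Modules.module.span (\<lambda>c p. const c * p) S)"

text \<open>The subtraction in the exponent may be truncated, but then the coefficient vanishes.\<close>

definition partial :: "nat \<Rightarrow> mpoly \<Rightarrow> mpoly"
  where "partial i p = (\<Sum>m\<in>Poly_Mapping.keys p. Poly_Mapping.single (m - Poly_Mapping.single i 1)
    (of_nat (Poly_Mapping.lookup m i) * Poly_Mapping.lookup p m))"

definition euler :: "nat \<Rightarrow> mpoly \<Rightarrow> mpoly"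
  where "euler n p = (\<Sum>i<n. var i * partial i p)"

text \<open>Operators on \<open>polys n\<close> are extensional functions, so that equality of operators
  is equality of functions.\<close>

definition End_ring :: "nat \<Rightarrow> (mpoly \<Rightarrow> mpoly) ring"
  where "End_ring n = \<lparr>
    carrier = {P \<in> polys n \<rightarrow>\<^sub>E polys n.
      (\<forall>p\<in>polys n. \<forall>q\<in>polys n. P (p + q) = P p + P q) \<and>
      (\<forall>c. \<forall>p\<in>polys n. P (const c * p) = const c * P p)},
    mult = compose (polys n),
    one = (\<lambda>p\<in>polys n. p),
    zero = (\<lambda>p\<in>polys n. 0),
    add = (\<lambda>P Q. \<lambda>p\<in>polys n. P p + Q p)\<rparr>"

definition weyl :: "nat \<Rightarrow> (mpoly \<Rightarrow> mpoly) set"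
  where "weyl n = generate_ring (End_ring n)
    ({\<lambda>p\<in>polys n. const c * p | c. True} \<union>
     {\<lambda>p\<in>polys n. var i * p | i. i < n} \<union>
     {\<lambda>p\<in>polys n. partial i p | i. i < n})"

definition GL :: "nat \<Rightarrow> complex mat monoid"
  where "GL n = units_of (ring_mat TYPE(complex) n ())"

text \<open>The algebra automorphism of \<open>polys n\<close> extending the linear map
  \<open>x\<^sub>j \<mapsto> \<Sum>\<^sub>i g\<^sub>i\<^sub>j x\<^sub>i\<close> of \<open>V\<close>.\<close>

definition act :: "nat \<Rightarrow> complex mat \<Rightarrow> mpoly \<Rightarrow> mpoly"
  where "act n g p = (\<Sum>m\<in>Poly_Mapping.keys p. const (Poly_Mapping.lookup p m) *
    (\<Prod>j\<in>Poly_Mapping.keys m. (\<Sum>i<n. const (g $$ (i, j)) * var i) ^ Poly_Mapping.lookup m j))"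

definition conj_act :: "nat \<Rightarrow> complex mat \<Rightarrow> (mpoly \<Rightarrow> mpoly) \<Rightarrow> mpoly \<Rightarrow> mpoly"
  where "conj_act n g P = (\<lambda>p\<in>polys n. act n g (P (act n (inv\<^bsub>GL n\<^esub> g) p)))"

definition inv_ops :: "nat \<Rightarrow> complex mat set \<Rightarrow> (mpoly \<Rightarrow> mpoly) ring"
  where "inv_ops n G = (End_ring n)\<lparr>carrier := {P \<in> weyl n. \<forall>g\<in>G. conj_act n g P = P}\<rparr>"

text \<open>The grading of operators is the eigenspace decomposition for the adjoint action of the
  Euler operator.\<close>

definition inv_ops_deg :: "nat \<Rightarrow> complex mat set \<Rightarrow> int \<Rightarrow> (mpoly \<Rightarrow> mpoly) set"
  where "inv_ops_deg n G k = {P \<in> carrier (inv_ops n G).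
    \<forall>p\<in>polys n. euler n (P p) - P (euler n p) = of_int k * P p}"

definition inv_ops_neg :: "nat \<Rightarrow> complex mat set \<Rightarrow> (mpoly \<Rightarrow> mpoly) set"
  where "inv_ops_neg n G = generate (add_monoid (inv_ops n G)) (\<Union>k\<in>{..<0}. inv_ops_deg n G k)"

definition inv_ops_left_ideal :: "nat \<Rightarrow> complex mat set \<Rightarrow> (mpoly \<Rightarrow> mpoly) set"
  where "inv_ops_left_ideal n G = generate (add_monoid (inv_ops n G))
    {P \<otimes>\<^bsub>inv_ops n G\<^esub> Q | P Q. P \<in> carrier (inv_ops n G) \<and> Q \<in> inv_ops_neg n G}"

text \<open>\<open>\<R> = \<D>\<^sup>0 / (\<D>\<^sup>0 \<inter> \<D>\<D>\<^sup>-)\<close>; its elements are cosets.\<close>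

definition R_ring :: "nat \<Rightarrow> complex mat set \<Rightarrow> (mpoly \<Rightarrow> mpoly) set ring"
  where "R_ring n G = (inv_ops n G)\<lparr>carrier := inv_ops_deg n G 0\<rparr>
    Quot (inv_ops_deg n G 0 \<inter> inv_ops_left_ideal n G)"

definition B_module :: "nat \<Rightarrow> (mpoly \<Rightarrow> mpoly, mpoly) module"
  where "B_module n = \<lparr>carrier = polys n, mult = (*), one = 1, zero = 0, add = (+),
    smult = (\<lambda>P p. P p)\<rparr>"

definition ann :: "nat \<Rightarrow> complex mat set \<Rightarrow> mpoly set \<Rightarrow> mpoly set"
  where "ann n G N = {p \<in> N. \<forall>P\<in>inv_ops_neg n G. P p = 0}"

text \<open>A coset acts by the common value of its representatives.\<close>

definition Bann_module :: "nat \<Rightarrow> complex mat set \<Rightarrow> ((mpoly \<Rightarrow> mpoly) set, mpoly) module"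
  where "Bann_module n G = \<lparr>carrier = ann n G (polys n), mult = (*), one = 1, zero = 0, add = (+),
    smult = (\<lambda>C p. the_elem ((\<lambda>P. P p) ` C))\<rparr>"

definition D_span :: "nat \<Rightarrow> complex mat set \<Rightarrow> mpoly set \<Rightarrow> mpoly set"
  where "D_span n G W =
    generate (add_monoid (B_module n)) {P w | P w. P \<in> carrier (inv_ops n G) \<and> w \<in> W}"

end

theory Submission
  imports Defs "Jordan_Normal_Form.Determinant"
begin

text \<open>
  The proof rests on one Hermitian form. The Fischer form makes distinct monomials orthogonal and
  multiplication by \<open>x\<^sub>i\<close> adjoint to \<open>\<partial>\<^sub>i\<close>. To make it invariant, it is twisted by the substitution
  of the positive definite matrix \<open>H = \<Sum>g\<in>G. g\<^sup>* g\<close> (\<open>ip\<close>, \<open>ip_act\<close>). The twisted form is still positive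
  definite (\<open>ip_definite\<close>), and adjunction still preserves the Weyl algebra (\<open>weyl_adjoint\<close>). Hence
  it preserves the ring \<open>\<D>\<close> of invariant operators and exchanges the operators of degrees \<open>k\<close> and
  \<open>-k\<close> (\<open>D_adjoint\<close>). In other words \<open>B\<close> is a unitary module with finite-dimensional degrees, and
  the annihilator of \<open>\<D>\<^sup>-\<close> is orthogonal to everything that \<open>\<D>\<^sup>+\<close> produces. All four claims follow
  from this.

  The inverse bijections come from \<open>ann_generates\<close>, which says that a submodule \<open>N\<close> is generated by
  \<open>N\<^sup>a\<^sup>n\<^sup>n\<close>, and from \<open>D_degree_zero_part\<close>: between two elements of \<open>B\<^sup>a\<^sup>n\<^sup>n\<close> the form sees only the degree
  \<open>0\<close> component of an operator. The latter gives \<open>(\<D> W)\<^sup>a\<^sup>n\<^sup>n = W\<close> (\<open>ann_D_span\<close>). It also shows that a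
  relation \<open>\<Sum> P\<^sub>i w\<^sub>i = 0\<close> is preserved when the \<open>w\<^sub>i \<in> W\<close> are replaced by their images under an
  \<open>\<R>\<close>-homomorphism, so that the homomorphism extends to \<open>\<D> W\<close> (\<open>hom_extension\<close>).

  \<open>B\<^sup>a\<^sup>n\<^sup>n\<close> is finite-dimensional because it is orthogonal to the ideal generated by the invariants of
  positive degree, and every \<open>x\<^sub>i\<^bsup>card G\<^esup>\<close> lies in that ideal (\<open>orbit_relation\<close>). It is semisimple because
  orthogonal complements of \<open>\<R>\<close>-submodules are \<open>\<R>\<close>-submodules. A simple \<open>\<R>\<close>-submodule lives in one
  degree because the Euler operator has degree \<open>0\<close> and is invariant, so that submodules are graded.
\<close>

section \<open>Coefficients of polynomials, derivatives and substitutions\<close>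

abbreviation "lookup \<equiv> Poly_Mapping.lookup"
abbreviation "keys \<equiv> Poly_Mapping.keys"
abbreviation "single \<equiv> Poly_Mapping.single"

lemma sum_singles: "(\<Sum>m\<in>keys p. single m (lookup p m)) = p"
  by (rule poly_mapping_eqI) (simp add: lookup_sum lookup_single when_def in_keys_iff)

lemma additive_mpoly_induct [case_names single add]:
  assumes s: "\<And>m c. P (single m c)" and a: "\<And>p q. P p \<Longrightarrow> P q \<Longrightarrow> P (p + q)"
  shows "P (p :: mpoly)"
proof -
  have "P (\<Sum>m\<in>A. single m (lookup p m))" if "finite A" for A
    using that by (induction A) (use s[of 0 0] s a in auto)
  from this[of "keys p"] show ?thesis by (simp add: sum_singles)
qed

lemma lookup_const_mult [simp]: "lookup (const c * p) m = c * lookup p m"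
proof (induction p rule: additive_mpoly_induct)
  case (single k d)
  then show ?case by (simp add: const_def mult_single lookup_single when_def)
qed (simp add: distrib_left lookup_add)

lemma const_0 [simp]: "const 0 = 0" by (simp add: const_def)
lemma const_1 [simp]: "const 1 = 1" by (simp add: const_def)
lemma const_add: "const (a + b) = const a + const b" by (simp add: const_def single_add)
lemma const_mult: "const (a * b) = const a * const b" by (simp add: const_def mult_single)
lemma const_minus: "const (- a) = - const a" by (simp add: const_def single_uminus)
lemma const_of_int: "const (of_int a) = of_int a" by (simp add: const_def)
lemma const_of_nat: "const (of_nat a) = of_nat a" by (simp add: const_def)
lemma const_sum: "const (sum f A) = (\<Sum>x\<in>A. const (f x))"
  by (induction A rule: infinite_finite_induct) (auto simp: const_add)

lemma lookup_of_int_mult [simp]: "lookup (of_int k * p) m = of_int k * lookup (p :: mpoly) m"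
  by (metis const_of_int lookup_const_mult)

lemma single_conv_const: "single m c = const c * single m 1"
  by (simp add: const_def mult_single)

lemma lookup_var_mult_single [simp]: "lookup (var i * p) (single i 1 + m) = lookup p m"
proof (induction p rule: additive_mpoly_induct)
  case (single k d)
  then show ?case by (simp add: var_def mult_single lookup_single when_def)
qed (simp add: distrib_left lookup_add)

lemma lookup_var_mult_0:
  assumes "lookup m i = 0"
  shows "lookup (var i * p) m = 0"
proof (induction p rule: additive_mpoly_induct)
  case (single k d)
  have "single i 1 + k \<noteq> m" using assms by (auto simp: lookup_add)
  then show ?case by (simp add: var_def mult_single lookup_single when_def)
qed (simp add: distrib_left lookup_add)

lemma single_split:
  assumes "lookup m i \<noteq> (0::nat)"
  shows "m = single i 1 + (m - single i 1)"
  by (rule poly_mapping_eqI) (use assms in \<open>auto simp: lookup_add lookup_minus lookup_single when_def\<close>)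

lemma lookup_partial: "lookup (partial i p) m = of_nat (lookup m i + 1) * lookup p (m + single i 1)"
proof -
  have "lookup (partial i p) m =
      (\<Sum>k\<in>keys p. if k = m + single i 1 then of_nat (lookup m i + 1) * lookup p (m + single i 1) else 0)"
    unfolding partial_def lookup_sum
  proof (rule sum.cong)
    fix k assume "k \<in> keys p"
    show "lookup (single (k - single i 1) (of_nat (lookup k i) * lookup p k)) m =
      (if k = m + single i 1 then of_nat (lookup m i + 1) * lookup p (m + single i 1) else 0)"
    proof (cases "lookup k i = 0")
      case True
      then have "k \<noteq> m + single i 1" by (auto simp: lookup_add)
      with True show ?thesis by simp
    next
      case False
      from single_split[OF False] have "k - single i 1 = m \<longleftrightarrow> k = m + single i 1"
        by (metis add.commute add_diff_cancel_right')
      moreover have "lookup k i = lookup m i + 1" if "k = m + single i 1" using that by (simp add: lookup_add)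
      ultimately show ?thesis by (auto simp: lookup_single when_def)
    qed
  qed simp
  also have "\<dots> = of_nat (lookup m i + 1) * lookup p (m + single i 1)"
    by (simp add: in_keys_iff)
  finally show ?thesis .
qed

lemma partial_0 [simp]: "partial i 0 = 0"
  by (simp add: partial_def)

lemma partial_add: "partial i (p + q) = partial i p + partial i q"
  by (rule poly_mapping_eqI) (simp add: lookup_partial lookup_add distrib_left)

lemma partial_const_mult: "partial i (const c * p) = const c * partial i p"
  by (rule poly_mapping_eqI) (simp add: lookup_partial)

lemma partial_sum: "partial i (sum f A) = (\<Sum>a\<in>A. partial i (f a))"
  by (induction A rule: infinite_finite_induct) (auto simp: partial_add)

lemma partial_const [simp]: "partial i (const c) = 0"
proof (rule poly_mapping_eqI)
  fix m :: "nat \<Rightarrow>\<^sub>0 nat"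
  have "lookup (m + single i 1) i \<noteq> 0" by (simp add: lookup_add)
  then have "0 \<noteq> m + single i 1" by (metis lookup_zero)
  then show "lookup (partial i (const c)) m = lookup 0 m"
    by (simp add: lookup_partial const_def lookup_single when_def)
qed

lemma partial_var_mult: "partial i (var j * p) = (if i = j then p else 0) + var j * partial i p"
proof (rule poly_mapping_eqI)
  fix m
  show "lookup (partial i (var j * p)) m = lookup ((if i = j then p else 0) + var j * partial i p) m"
  proof (cases "lookup m j = 0")
    case True
    show ?thesis
    proof (cases "i = j")
      case True
      with \<open>lookup m j = 0\<close> show ?thesis
        using lookup_var_mult_single[of j p m]
        by (simp add: lookup_partial lookup_add lookup_var_mult_0 add.commute)
    next
      case False
      with \<open>lookup m j = 0\<close> have "lookup (m + single i 1) j = 0"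
        by (simp add: lookup_add lookup_single when_def)
      with False \<open>lookup m j = 0\<close> show ?thesis
        by (simp add: lookup_partial lookup_add lookup_var_mult_0)
    qed
  next
    case False
    define k where "k = m - single j 1"
    have m: "m = single j 1 + k" using single_split[OF False] by (simp add: k_def)
    have 1: "lookup (var j * p) (m + single i 1) = lookup p (k + single i 1)"
      unfolding m by (metis add.assoc lookup_var_mult_single)
    have 2: "lookup (var j * partial i p) m = lookup (partial i p) k"
      unfolding m by (rule lookup_var_mult_single)
    show ?thesis
      unfolding lookup_add 2 lookup_partial 1
      by (auto simp: m lookup_add lookup_single when_def algebra_simps)
  qed
qed

subsection \<open>The ring \<open>polys n\<close> and its grading\<close>

lemma polys_0 [simp]: "0 \<in> polys n"
  and polys_add [simp]: "p \<in> polys n \<Longrightarrow> q \<in> polys n \<Longrightarrow> p + q \<in> polys n"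
  and polys_minus [simp]: "p \<in> polys n \<Longrightarrow> - p \<in> polys n"
  and polys_const [simp]: "const c \<in> polys n"
  and polys_var [simp]: "i < n \<Longrightarrow> var i \<in> polys n"
  using keys_add[of p q] by (auto simp: polys_def const_def var_def in_keys_iff)

lemma polys_diff [simp]: "p \<in> polys n \<Longrightarrow> q \<in> polys n \<Longrightarrow> p - q \<in> polys n"
  using polys_add[of p n "- q"] polys_minus[of q n] by simp

lemma polys_1 [simp]: "1 \<in> polys n" using polys_const[of 1 n] by simp

lemma keys_add_nat: "keys (a + b :: nat \<Rightarrow>\<^sub>0 nat) = keys a \<union> keys b"
  by (auto simp: in_keys_iff lookup_add)

lemma polys_mult [simp]: "p \<in> polys n \<Longrightarrow> q \<in> polys n \<Longrightarrow> p * q \<in> polys n"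
  using keys_mult[of p q] by (fastforce simp: polys_def keys_add_nat)

lemma polys_sum [simp]: "(\<And>a. a \<in> A \<Longrightarrow> f a \<in> polys n) \<Longrightarrow> sum f A \<in> polys n"
  by (induction A rule: infinite_finite_induct) auto

lemma polys_prod [simp]: "(\<And>a. a \<in> A \<Longrightarrow> f a \<in> polys n) \<Longrightarrow> prod f A \<in> polys n"
  by (induction A rule: infinite_finite_induct) auto

lemma polys_power [simp]: "p \<in> polys n \<Longrightarrow> p ^ k \<in> polys n"
  by (induction k) auto

lemma polys_of_int_mult [simp]: "p \<in> polys n \<Longrightarrow> of_int k * p \<in> polys n"
  by (metis const_of_int polys_const polys_mult)

lemma polys_partial [simp]:
  assumes "p \<in> polys n"
  shows "partial i p \<in> polys n"
  unfolding polys_def mem_Collect_eq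
proof
  fix m assume "m \<in> keys (partial i p)"
  then have "m + single i 1 \<in> keys p" by (auto simp: in_keys_iff lookup_partial)
  with assms have "keys (m + single i 1) \<subseteq> {..<n}" by (auto simp: polys_def)
  then show "keys m \<subseteq> {..<n}" by (auto simp: keys_add_nat)
qed

lemma polys_single: "keys m \<subseteq> {..<n} \<Longrightarrow> single m c \<in> polys n"
  by (simp add: polys_def)

text \<open>Summing over all \<open>n\<close> variables instead of the support makes the degree additive.\<close>

definition tdeg :: "nat \<Rightarrow> (nat \<Rightarrow>\<^sub>0 nat) \<Rightarrow> nat"
  where "tdeg n m = (\<Sum>i<n. lookup m i)"

lemma tdeg_add: "tdeg n (a + b) = tdeg n a + tdeg n b"
  by (simp add: tdeg_def lookup_add sum.distrib)

lemma tdeg_single: "i < n \<Longrightarrow> tdeg n (single i k) = k"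
  by (simp add: tdeg_def lookup_single when_def)

lemma tdeg_0 [simp]: "tdeg n 0 = 0" by (simp add: tdeg_def)

lemma tdeg_eq: "keys m \<subseteq> {..<n} \<Longrightarrow> (\<Sum>i\<in>keys m. lookup m i) = tdeg n m"
  unfolding tdeg_def by (rule sum.mono_neutral_left) (auto simp: in_keys_iff)

lemma homog_alt: "homog n d = {p \<in> polys n. \<forall>m\<in>keys p. tdeg n m = d}"
  unfolding homog_def by (intro Collect_cong conj_cong refl ball_cong) (auto simp: polys_def tdeg_eq)

lemma homog_polys: "p \<in> homog n d \<Longrightarrow> p \<in> polys n" by (simp add: homog_def)

lemma polys_monomial_induct [consumes 1, case_names single add]:
  assumes "p \<in> polys n" and s: "\<And>m c. keys m \<subseteq> {..<n} \<Longrightarrow> P (single m c)"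
    and a: "\<And>p q. p \<in> polys n \<Longrightarrow> q \<in> polys n \<Longrightarrow> P p \<Longrightarrow> P q \<Longrightarrow> P (p + q)"
  shows "P p"
proof -
  have "P (\<Sum>m\<in>A. single m (lookup p m))" if "finite A" "A \<subseteq> keys p" for A
    using that
  proof (induction A)
    case empty
    then show ?case using s[of 0 0] by simp
  next
    case (insert m A)
    have k: "keys k \<subseteq> {..<n}" if "k \<in> keys p" for k using assms(1) that by (auto simp: polys_def)
    have "(\<Sum>m\<in>A. single m (lookup p m)) \<in> polys n"
      by (rule polys_sum) (use insert.prems k in \<open>auto intro!: polys_single\<close>)
    with insert k show ?case by (auto intro!: a s polys_single)
  qed
  from this[of "keys p"] show ?thesis by (simp add: sum_singles)
qed

text \<open>A polynomial is built from constants by additions and multiplications by variables. Facts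
  about operators are proved along this construction, since every operator below satisfies a
  product rule for a variable.\<close>

lemma polys_induct [consumes 1, case_names const var add]:
  assumes "p \<in> polys n" and c: "\<And>c. P (const c)"
    and v: "\<And>i p. i < n \<Longrightarrow> p \<in> polys n \<Longrightarrow> P p \<Longrightarrow> P (var i * p)"
    and a: "\<And>p q. p \<in> polys n \<Longrightarrow> q \<in> polys n \<Longrightarrow> P p \<Longrightarrow> P q \<Longrightarrow> P (p + q)"
  shows "P p"
  using assms(1)
proof (induction p rule: polys_monomial_induct)
  case (single m c)
  then show ?case
  proof (induction "tdeg n m" arbitrary: m)
    case 0
    then have "lookup m i = 0" for i
      by (cases "i < n") (auto simp: tdeg_def not_in_keys_iff_lookup_eq_zero[symmetric])
    then have "m = 0" by (intro poly_mapping_eqI) simp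
    then show ?case using c[of c] by (simp add: const_def)
  next
    case (Suc d)
    then obtain i where i: "i < n" "lookup m i \<noteq> 0" 
      by (metis Zero_not_Suc lessThan_iff sum.neutral tdeg_def)
    define k where "k = m - single i 1"
    have m: "m = single i 1 + k" using single_split[OF i(2)] by (simp add: k_def)
    have "tdeg n k = d" using Suc.hyps(2) i(1) unfolding m by (simp add: tdeg_add tdeg_single)
    moreover have k: "keys k \<subseteq> {..<n}" using Suc.prems unfolding m by (simp add: keys_add_nat)
    ultimately have "P (single k c)" using Suc.hyps(1) by blast
    then have "P (var i * single k c)" using v i(1) k by (simp add: polys_single)
    then show ?case by (simp add: var_def mult_single m)
  qed
qed (use a in blast)

lemma homog_0 [simp]: "0 \<in> homog n d" by (simp add: homog_alt)

lemma homog_add: "p \<in> homog n d \<Longrightarrow> q \<in> homog n d \<Longrightarrow> p + q \<in> homog n d"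
  using keys_add[of p q] by (auto simp: homog_alt)

lemma homog_sum: "(\<And>a. a \<in> A \<Longrightarrow> f a \<in> homog n d) \<Longrightarrow> sum f A \<in> homog n d"
  by (induction A rule: infinite_finite_induct) (auto simp: homog_add)

lemma homog_const: "const c \<in> homog n 0"
  by (auto simp: homog_alt) (auto simp: const_def split: if_splits)

lemma homog_mult: "p \<in> homog n d \<Longrightarrow> q \<in> homog n e \<Longrightarrow> p * q \<in> homog n (d + e)"
  using keys_mult[of p q] by (fastforce simp: homog_alt tdeg_add)

lemma homog_const_mult: "p \<in> homog n d \<Longrightarrow> const c * p \<in> homog n d"
  using homog_mult[OF homog_const, of p n d c] by simp

lemma homog_minus: "p \<in> homog n d \<Longrightarrow> - p \<in> homog n d"
  by (simp add: homog_alt in_keys_iff)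

lemma homog_diff: "p \<in> homog n d \<Longrightarrow> q \<in> homog n d \<Longrightarrow> p - q \<in> homog n d"
  using homog_add[of p n d "- q"] homog_minus[of q n d] by simp

lemma homog_var: "i < n \<Longrightarrow> var i \<in> homog n 1"
  using polys_var[of i n] by (simp add: homog_alt tdeg_single) (simp add: var_def tdeg_single)

lemma homog_1: "1 \<in> homog n 0" using homog_const[of 1 n] by simp

lemma homog_power: "p \<in> homog n d \<Longrightarrow> p ^ k \<in> homog n (k * d)"
  by (induction k) (auto simp: homog_1 intro: homog_mult)

lemma homog_prod:
  assumes "finite A" "\<And>a. a \<in> A \<Longrightarrow> f a \<in> homog n (h a)"
  shows "prod f A \<in> homog n (sum h A)"
  using assms by (induction A) (auto simp: homog_1 intro!: homog_mult)

lemma homog_single: "keys m \<subseteq> {..<n} \<Longrightarrow> single m c \<in> homog n (tdeg n m)"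
  by (simp add: homog_alt polys_single)

lemma homog_partial: "p \<in> homog n (Suc d) \<Longrightarrow> i < n \<Longrightarrow> partial i p \<in> homog n d"
  unfolding homog_alt mem_Collect_eq
proof (intro conjI ballI)
  fix m assume *: "p \<in> polys n \<and> (\<forall>m\<in>keys p. tdeg n m = Suc d)" "i < n" "m \<in> keys (partial i p)"
  then have "m + single i 1 \<in> keys p" by (auto simp: in_keys_iff lookup_partial)
  with * have "tdeg n (m + single i 1) = Suc d" by blast
  then show "tdeg n m = d" using \<open>i < n\<close> by (simp only: tdeg_add tdeg_single)
qed simp

definition hpart :: "nat \<Rightarrow> nat \<Rightarrow> mpoly \<Rightarrow> mpoly"
  where "hpart n d p = (\<Sum>m\<in>{m \<in> keys p. tdeg n m = d}. single m (lookup p m))"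

lemma lookup_hpart: "lookup (hpart n d p) m = (if tdeg n m = d then lookup p m else 0)"
  by (simp add: hpart_def lookup_sum lookup_single when_def in_keys_iff)

lemma hpart_homog: "p \<in> polys n \<Longrightarrow> hpart n d p \<in> homog n d"
  by (auto simp: homog_alt polys_def in_keys_iff lookup_hpart split: if_splits)

lemma hpart_sum:
  obtains N where "p = (\<Sum>d<N. hpart n d p)" and "\<And>d. d \<ge> N \<Longrightarrow> hpart n d p = 0"
proof -
  define N where "N = Suc (Max (insert 0 (tdeg n ` keys p)))"
  have N: "tdeg n m < N" if "m \<in> keys p" for m
    using that by (simp add: N_def less_Suc_eq_le)
  have "p = (\<Sum>d<N. hpart n d p)"
    by (rule poly_mapping_eqI) (use N in \<open>auto simp: lookup_sum lookup_hpart in_keys_iff\<close>)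
  moreover have "hpart n d p = 0" if "d \<ge> N" for d
    by (rule poly_mapping_eqI) (use N that in \<open>fastforce simp: lookup_hpart in_keys_iff\<close>)
  ultimately show ?thesis using that by blast
qed

subsection \<open>The Euler operator\<close>

lemma lookup_euler: "lookup (euler n p) m = of_nat (tdeg n m) * lookup p m"
proof -
  have "lookup (var i * partial i p) m = of_nat (lookup m i) * lookup p m" for i
  proof (cases "lookup m i = 0")
    case False
    define k where "k = m - single i 1"
    have m: "m = single i 1 + k" using single_split[OF False] by (simp add: k_def)
    show ?thesis unfolding m lookup_var_mult_single by (simp add: lookup_partial lookup_add add.commute)
  qed (simp add: lookup_var_mult_0)
  then show ?thesis by (simp add: euler_def lookup_sum tdeg_def sum_distrib_right)
qed

lemma polys_euler [simp]: "p \<in> polys n \<Longrightarrow> euler n p \<in> polys n"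
  unfolding euler_def by (intro polys_sum) auto

lemma euler_add: "euler n (p + q) = euler n p + euler n q"
  by (rule poly_mapping_eqI) (simp add: lookup_euler lookup_add distrib_left)

lemma euler_homog: "p \<in> homog n d \<Longrightarrow> euler n p = of_nat d * p"
  by (rule poly_mapping_eqI) (auto simp: lookup_euler const_of_nat[symmetric] homog_alt in_keys_iff)

text \<open>The Euler operator multiplies the coefficient of a monomial by its degree. So its eigenvalues on
  polynomials are natural numbers, and its eigenspaces are the homogeneous parts.\<close>

lemma euler_eigen:
  assumes "p \<in> polys n" "euler n p = of_int k * p"
  shows "k \<ge> 0 \<Longrightarrow> p \<in> homog n (nat k)" and "k < 0 \<Longrightarrow> p = 0"
proof -
  have *: "int (tdeg n m) = k" if "m \<in> keys p" for m
  proof -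
    have "lookup (euler n p) m = of_int k * lookup p m" using assms by simp
    then have "(of_int (int (tdeg n m)) :: complex) = of_int k" using that by (simp add: lookup_euler in_keys_iff)
    then show ?thesis using of_int_eq_iff by blast
  qed
  show "p \<in> homog n (nat k)" if "k \<ge> 0" using assms(1) * by (force simp: homog_alt)
  show "p = 0" if "k < 0" using * that
    by (intro poly_mapping_eqI) (metis in_keys_iff lookup_zero not_less of_nat_0_le_iff)
qed

subsection \<open>Linear substitutions\<close>

definition linform :: "nat \<Rightarrow> complex mat \<Rightarrow> nat \<Rightarrow> mpoly"
  where "linform n A k = (\<Sum>i<n. const (A $$ (i, k)) * var i)"

lemma linform_polys [simp]: "linform n A k \<in> polys n"
  unfolding linform_def by (intro polys_sum) auto

lemma linform_homog: "linform n A k \<in> homog n 1"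
  unfolding linform_def using homog_mult[OF homog_const homog_var] by (intro homog_sum) auto

lemma act_linform: "act n A p = (\<Sum>m\<in>keys p. const (lookup p m) * (\<Prod>j\<in>keys m. linform n A j ^ lookup m j))"
  by (simp add: act_def linform_def)

lemma act_add: "act n A (p + q) = act n A p + act n A q"
  unfolding act_def
  by (rule setsum_keys_plus_distrib) (simp_all add: const_add distrib_right)

lemma act_0 [simp]: "act n A 0 = 0" by (simp add: act_def)

lemma act_const [simp]: "act n A (const c) = const c"
  by (cases "c = 0") (simp_all add: act_def, simp add: const_def)

lemma act_1 [simp]: "act n A 1 = 1" using act_const[of n A 1] by simp

lemma act_const_mult: "act n A (const c * p) = const c * act n A p"
proof (induction p rule: additive_mpoly_induct)
  case (single m d)
  show ?case by (cases "c = 0"; cases "d = 0")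
    (auto simp: act_def const_def mult_single const_mult mult.assoc[symmetric])
qed (simp add: act_add distrib_left)

lemma act_var_mult: "act n A (var k * p) = linform n A k * act n A p"
proof (induction p rule: additive_mpoly_induct)
  case (single m d)
  have *: "(\<Prod>j\<in>keys (single k 1 + m). linform n A j ^ lookup (single k 1 + m) j) =
      linform n A k * (\<Prod>j\<in>keys m. linform n A j ^ lookup m j)" (is "?L = _ * ?R")
  proof -
    let ?S = "insert k (keys m)"
    have "?L = (\<Prod>j\<in>?S. linform n A j ^ lookup (single k 1 + m) j)"
      by (rule prod.mono_neutral_left) (auto simp: keys_add_nat in_keys_iff)
    also have "\<dots> = (\<Prod>j\<in>?S. (if j = k then linform n A k else 1) * linform n A j ^ lookup m j)"
      by (rule prod.cong) (auto simp: lookup_add lookup_single when_def)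
    also have "\<dots> = linform n A k * (\<Prod>j\<in>?S. linform n A j ^ lookup m j)"
      by (subst prod.distrib) (simp add: prod.delta)
    also have "(\<Prod>j\<in>?S. linform n A j ^ lookup m j) = ?R"
      by (rule prod.mono_neutral_right) (auto simp: in_keys_iff)
    finally show ?thesis .
  qed
  show ?case
    by (cases "d = 0") (simp_all add: act_linform var_def mult_single flip: *)
qed (simp add: act_add distrib_left)

lemma act_sum: "act n A (sum f S) = (\<Sum>a\<in>S. act n A (f a))"
  by (induction S rule: infinite_finite_induct) (auto simp: act_add)

lemma act_polys [simp]: "p \<in> polys n \<Longrightarrow> act n A p \<in> polys n"
  by (induction p rule: polys_induct) (auto simp: act_var_mult act_add)

lemma act_mult: "p \<in> polys n \<Longrightarrow> act n A (p * q) = act n A p * act n A q"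
proof (induction p rule: polys_induct)
  case (var i p)
  then show ?case by (simp add: act_var_mult mult.assoc)
qed (auto simp: act_const_mult act_add distrib_right)

lemma act_prod: "(\<And>a. a \<in> S \<Longrightarrow> f a \<in> polys n) \<Longrightarrow> act n A (prod f S) = (\<Prod>a\<in>S. act n A (f a))"
  by (induction S rule: infinite_finite_induct) (auto simp: act_mult)

lemma act_minus: "act n A (- p) = - act n A p"
  using act_const_mult[of n A "-1" p] by (simp add: const_minus)

lemma act_var: "act n A (var k) = linform n A k"
  using act_var_mult[of n A k 1] by simp

lemma act_homog:
  assumes "p \<in> homog n d"
  shows "act n A p \<in> homog n d"
proof -
  have "act n A (single m c) \<in> homog n (tdeg n m)" if "keys m \<subseteq> {..<n}" for m c
  proof -
    have "const c * (\<Prod>j\<in>keys m. linform n A j ^ lookup m j) \<in> homog n (\<Sum>j\<in>keys m. lookup m j * 1)"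
      by (intro homog_const_mult homog_prod homog_power linform_homog) auto
    then show ?thesis by (cases "c = 0") (simp_all add: act_linform tdeg_eq[OF that])
  qed
  moreover have "keys m \<subseteq> {..<n} \<and> tdeg n m = d" if "m \<in> keys p" for m
    using assms that by (auto simp: homog_alt polys_def)
  ultimately have "(\<Sum>m\<in>keys p. act n A (single m (lookup p m))) \<in> homog n d"
    by (intro homog_sum) blast
  then show ?thesis by (simp flip: act_sum add: sum_singles)
qed

lemma act_times:
  assumes "A \<in> carrier_mat n n" "B \<in> carrier_mat n n" "p \<in> polys n"
  shows "act n A (act n B p) = act n (A * B) p"
  using assms(3)
proof (induction p rule: polys_induct)
  case (var k p)
  have "act n A (linform n B k) = (\<Sum>l<n. \<Sum>i<n. const (A $$ (i, l) * B $$ (l, k)) * var i)"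
    unfolding linform_def act_sum
    by (intro sum.cong refl)
      (simp add: act_const_mult act_var linform_def sum_distrib_left const_mult mult.assoc mult.left_commute)
  also have "\<dots> = (\<Sum>i<n. \<Sum>l<n. const (A $$ (i, l) * B $$ (l, k)) * var i)" by (rule sum.swap)
  also have "\<dots> = linform n (A * B) k"
    unfolding linform_def
    by (intro sum.cong) (use assms(1,2) var.hyps(1) in
      \<open>simp_all add: scalar_prod_def sum_distrib_right const_sum atLeast0LessThan\<close>)
  finally show ?case using var by (simp add: act_var_mult act_mult)
qed (auto simp: act_add)

lemma act_one: "p \<in> polys n \<Longrightarrow> act n (1\<^sub>m n) p = p"
proof (induction p rule: polys_induct)
  case (var k p)
  have "linform n (1\<^sub>m n) k = (\<Sum>i<n. if i = k then var i else 0)"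
    unfolding linform_def by (intro sum.cong) (use var in auto)
  also have "\<dots> = var k" using var by simp
  finally show ?case using var by (simp add: act_var_mult)
qed (auto simp: act_add)

lemma partial_linform: "i < n \<Longrightarrow> partial i (linform n A k * p) = const (A $$ (i, k)) * p + linform n A k * partial i p"
  by (simp add: linform_def sum_distrib_right partial_sum mult.assoc partial_const_mult partial_var_mult
      distrib_left sum.distrib if_distrib[of "\<lambda>x. const _ * x"] cong: if_cong)

text \<open>The chain rule for a linear substitution.\<close>

lemma partial_act:
  assumes "i < n" "p \<in> polys n"
  shows "partial i (act n A p) = (\<Sum>j<n. const (A $$ (i, j)) * act n A (partial j p))"
  using assms(2)
proof (induction p rule: polys_induct)
  case (var k p)
  have "(\<Sum>j<n. const (A $$ (i, j)) * act n A (partial j (var k * p))) =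
    (\<Sum>j<n. (if j = k then const (A $$ (i, k)) * act n A p else 0) +
       linform n A k * (const (A $$ (i, j)) * act n A (partial j p)))"
    by (intro sum.cong) (auto simp: partial_var_mult act_add act_var_mult distrib_left mult.left_commute)
  also have "\<dots> = const (A $$ (i, k)) * act n A p + linform n A k * partial i (act n A p)"
    using var by (simp add: sum.distrib sum_distrib_left)
  finally show ?case using assms(1) by (simp add: act_var_mult partial_linform)
qed (auto simp: act_add partial_add distrib_left sum.distrib)

section \<open>The Fischer form\<close>

definition mfact :: "(nat \<Rightarrow>\<^sub>0 nat) \<Rightarrow> complex"
  where "mfact m = (\<Prod>j\<in>keys m. fact (lookup m j))"

definition fischer :: "mpoly \<Rightarrow> mpoly \<Rightarrow> complex"
  where "fischer p q = (\<Sum>m\<in>keys p. cnj (lookup p m) * lookup q m * mfact m)"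

lemma mfact_single_add: "mfact (single i 1 + m) = of_nat (lookup m i + 1) * mfact m"
proof -
  let ?S = "insert i (keys m)"
  have "mfact (single i 1 + m) = (\<Prod>j\<in>?S. fact (lookup (single i 1 + m) j))"
    unfolding mfact_def by (rule prod.mono_neutral_left) (auto simp: keys_add_nat in_keys_iff)
  also have "\<dots> = (\<Prod>j\<in>?S. (if j = i then of_nat (lookup m i + 1) else 1) * fact (lookup m j))"
    by (rule prod.cong) (auto simp: lookup_add lookup_single when_def)
  also have "\<dots> = of_nat (lookup m i + 1) * (\<Prod>j\<in>?S. fact (lookup m j))"
    by (subst prod.distrib) (simp add: prod.delta)
  also have "(\<Prod>j\<in>?S. fact (lookup m j)) = mfact m"
    unfolding mfact_def by (rule prod.mono_neutral_right) (auto simp: in_keys_iff)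
  finally show ?thesis .
qed

lemma fischer_add_left: "fischer (p + q) r = fischer p r + fischer q r"
  unfolding fischer_def by (rule setsum_keys_plus_distrib) (simp_all add: distrib_right)

lemma fischer_add_right: "fischer r (p + q) = fischer r p + fischer r q"
  by (simp add: fischer_def lookup_add distrib_left distrib_right sum.distrib)

lemma fischer_const_right: "fischer r (const c * p) = c * fischer r p"
  by (simp add: fischer_def sum_distrib_left mult.assoc mult.left_commute)

lemma fischer_sym: "fischer q p = cnj (fischer p q)"
proof -
  have *: "fischer p q = (\<Sum>m\<in>keys p \<union> keys q. cnj (lookup p m) * lookup q m * mfact m)" for p q
    unfolding fischer_def by (rule sum.mono_neutral_left) (auto simp: in_keys_iff)
  have "cnj (mfact m) = mfact m" for m by (simp add: mfact_def)
  then show ?thesis by (simp add: *[of p] *[of q] Un_commute cnj_sum ac_simps)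
qed

lemma fischer_const_left: "fischer (const c * p) r = cnj c * fischer p r"
  by (subst fischer_sym) (simp add: fischer_const_right fischer_sym[of p r])

lemma fischer_sum_right: "fischer r (sum f A) = (\<Sum>a\<in>A. fischer r (f a))"
  by (induction A rule: infinite_finite_induct) (auto simp: fischer_add_right, simp_all add: fischer_def)

lemma fischer_var_left: "fischer (var i * p) q = fischer p (partial i q)"
proof (induction p rule: additive_mpoly_induct)
  case (single m c)
  then show ?case
    by (cases "c = 0")
      (simp_all add: fischer_def var_def mult_single lookup_partial mfact_single_add[simplified] add.commute[of m])
qed (simp add: distrib_left fischer_add_left)

lemma fischer_var_right: "fischer p (var i * q) = fischer (partial i p) q"
  by (metis fischer_sym fischer_var_left)

lemma fischer_homog: "p \<in> homog n d \<Longrightarrow> q \<in> homog n e \<Longrightarrow> d \<noteq> e \<Longrightarrow> fischer p q = 0"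
  unfolding fischer_def homog_alt by (intro sum.neutral) (auto simp: in_keys_iff)

definition adj :: "nat \<Rightarrow> complex mat \<Rightarrow> complex mat"
  where "adj n A = mat n n (\<lambda>(i, j). cnj (A $$ (j, i)))"

lemma adj_carrier [simp]: "adj n A \<in> carrier_mat n n" by (simp add: adj_def)

lemma fischer_const_act: "fischer (const c) (act n A q) = fischer (const c) q" if "q \<in> polys n"
  using that
proof (induction q rule: polys_induct)
  case (var i p)
  have "fischer (const c) (var l * r) = 0" for l r by (subst fischer_sym) (simp add: fischer_var_left, simp add: fischer_def)
  then show ?case
    by (simp add: act_var_mult linform_def sum_distrib_right fischer_sum_right mult.assoc fischer_const_right)
qed (auto simp: act_add fischer_add_right)

text \<open>Substituting \<open>A\<close> is adjoint to substituting the conjugate transpose of \<open>A\<close>: for the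
  generators this is the chain rule, because a variable is adjoint to its derivative.\<close>

lemma fischer_act:
  assumes "p \<in> polys n" "q \<in> polys n"
  shows "fischer p (act n A q) = fischer (act n (adj n A) p) q"
  using assms
proof (induction p arbitrary: q rule: polys_induct)
  case (const c)
  then show ?case by (simp add: fischer_const_act)
next
  case (var i p)
  have "fischer (var i * p) (act n A q) = (\<Sum>j<n. A $$ (i, j) * fischer p (act n A (partial j q)))"
    using var by (simp add: fischer_var_left partial_act fischer_sum_right fischer_const_right)
  also have "\<dots> = (\<Sum>j<n. A $$ (i, j) * fischer (act n (adj n A) p) (partial j q))"
    using var by simp
  also have "\<dots> = fischer (linform n (adj n A) i * act n (adj n A) p) q"
    by (subst (2) fischer_sym)
      (use var in \<open>simp add: linform_def sum_distrib_right mult.assoc fischer_sum_right fischer_const_right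
        fischer_var_right adj_def fischer_sym[of _ "partial _ q"]\<close>)
  finally show ?case by (simp add: act_var_mult)
qed (simp add: act_add fischer_add_left)

section \<open>An invariant Hermitian form\<close>

lemma GL_simps: "mult (GL n) = (*)" "one (GL n) = 1\<^sub>m n"
  by (simp_all add: GL_def units_of_def ring_mat_def)

lemma GL_group: "group (GL n)"
  unfolding GL_def using semiring.axioms(1)[OF semiring_mat]
  by (metis monoid.units_group ring.is_monoid ring_mat)

lemma GL_carrier: "g \<in> carrier (GL n) \<Longrightarrow> g \<in> carrier_mat n n"
  by (auto simp: GL_def units_of_def Units_def ring_mat_def)

lemma sum_rotate: "(\<Sum>a\<in>A. \<Sum>b\<in>B. \<Sum>c\<in>C. f a b c) = (\<Sum>c\<in>C. \<Sum>a\<in>A. \<Sum>b\<in>B. f a b c)"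
proof -
  have "(\<Sum>a\<in>A. \<Sum>b\<in>B. \<Sum>c\<in>C. f a b c) = (\<Sum>a\<in>A. \<Sum>c\<in>C. \<Sum>b\<in>B. f a b c)"
    by (rule sum.cong[OF refl]) (rule sum.swap)
  also have "\<dots> = (\<Sum>c\<in>C. \<Sum>a\<in>A. \<Sum>b\<in>B. f a b c)" by (rule sum.swap)
  finally show ?thesis .
qed

lemma single_1_eq: "single i (Suc 0) = single j (Suc 0) \<longleftrightarrow> i = j"
  by (metis lookup_single_eq lookup_single_not_eq nat.distinct(1))

locale finite_linear_group =
  fixes n :: nat and G :: "complex mat set"
  assumes subgroup: "subgroup G (GL n)" and finite_G: "finite G"
begin

lemma G_mat [simp]: "g \<in> G \<Longrightarrow> g \<in> carrier_mat n n"
  using subgroup.subset[OF subgroup] GL_carrier by blast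

lemma G_one: "1\<^sub>m n \<in> G"
  using subgroup.one_closed[OF subgroup] by (simp add: GL_simps)

lemma G_mult: "g \<in> G \<Longrightarrow> h \<in> G \<Longrightarrow> g * h \<in> G"
  using subgroup.m_closed[OF subgroup] by (simp add: GL_simps)

abbreviation "ginv g \<equiv> inv\<^bsub>GL n\<^esub> g"

lemma G_inv: "g \<in> G \<Longrightarrow> ginv g \<in> G"
  using subgroup.m_inv_closed[OF subgroup] .

lemma ginv: "g \<in> G \<Longrightarrow> ginv g * g = 1\<^sub>m n" "g \<in> G \<Longrightarrow> g * ginv g = 1\<^sub>m n"
  using group.l_inv[OF GL_group, of g n] group.r_inv[OF GL_group, of g n] subgroup.subset[OF subgroup]
  by (auto simp: GL_simps)

lemma act_ginv:
  assumes "g \<in> G" "p \<in> polys n"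
  shows "act n (ginv g) (act n g p) = p" "act n g (act n (ginv g) p) = p"
  using assms by (simp_all add: act_times ginv act_one G_inv)

lemma bij_G_mult: "g \<in> G \<Longrightarrow> bij_betw (\<lambda>h. h * g) G G"
proof (rule bij_betw_byWitness[where f' = "\<lambda>h. h * ginv g"])
  assume g: "g \<in> G"
  show "\<forall>h\<in>G. h * g * ginv g = h" "\<forall>h\<in>G. h * ginv g * g = h"
    using g by (simp_all add: assoc_mult_mat[of _ n n _ n _ n] ginv G_inv right_mult_one_mat[of _ n n])
qed (auto simp: G_mult G_inv)

lemma bij_G_mult_left: "g \<in> G \<Longrightarrow> bij_betw (\<lambda>h. g * h) G G"
proof (rule bij_betw_byWitness[where f' = "\<lambda>h. ginv g * h"])
  assume g: "g \<in> G"
  show "\<forall>h\<in>G. ginv g * (g * h) = h" "\<forall>h\<in>G. g * (ginv g * h) = h"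
    using g by (simp_all add: assoc_mult_mat[of _ n n _ n _ n, symmetric] ginv G_inv left_mult_one_mat[of _ n n])
qed (auto simp: G_mult G_inv)

text \<open>This is \<open>\<Sum>g\<in>G. g\<^sup>* g\<close>, the sum of the translates of the standard inner product. The summand for \<open>g = 1\<close> makes it positive
  definite.\<close>

definition H :: "complex mat"
  where "H = mat n n (\<lambda>(i, j). \<Sum>g\<in>G. \<Sum>l<n. cnj (g $$ (l, i)) * g $$ (l, j))"

lemma H_carrier [simp]: "H \<in> carrier_mat n n" by (simp add: H_def)

lemma H_adj: "adj n H = H"
  by (rule eq_matI) (auto simp: H_def adj_def cnj_sum ac_simps)

lemma H_index: "i < n \<Longrightarrow> j < n \<Longrightarrow> H $$ (i, j) = (\<Sum>g\<in>G. \<Sum>l<n. cnj (g $$ (l, i)) * g $$ (l, j))"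
  by (simp add: H_def)

text \<open>Conjugating replaces each summand \<open>k\<^sup>* k\<close> by \<open>(k g)\<^sup>* (k g)\<close>, which permutes the summands.\<close>

lemma H_invariant:
  assumes "g \<in> G"
  shows "adj n g * H * g = H"
proof (rule eq_matI)
  fix i j assume "i < dim_row H" "j < dim_col H"
  then have ij: "i < n" "j < n" by (auto simp: H_def)
  have g: "g \<in> carrier_mat n n" using assms by simp
  have "(adj n g * H * g) $$ (i, j) =
      (\<Sum>b<n. (\<Sum>a<n. cnj (g $$ (a, i)) * (\<Sum>k\<in>G. \<Sum>l<n. cnj (k $$ (l, a)) * k $$ (l, b))) * g $$ (b, j))"
    using ij g by (simp add: scalar_prod_def adj_def H_def atLeast0LessThan)
  also have "\<dots> = (\<Sum>b<n. \<Sum>a<n. \<Sum>k\<in>G. \<Sum>l<n. cnj (k $$ (l, a) * g $$ (a, i)) * (k $$ (l, b) * g $$ (b, j)))"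
    by (simp add: sum_distrib_left sum_distrib_right ac_simps)
  also have "\<dots> = (\<Sum>k\<in>G. \<Sum>b<n. \<Sum>a<n. \<Sum>l<n. cnj (k $$ (l, a) * g $$ (a, i)) * (k $$ (l, b) * g $$ (b, j)))"
    by (rule sum_rotate)
  also have "\<dots> = (\<Sum>k\<in>G. \<Sum>l<n. \<Sum>b<n. \<Sum>a<n. cnj (k $$ (l, a) * g $$ (a, i)) * (k $$ (l, b) * g $$ (b, j)))"
    by (rule sum.cong[OF refl]) (rule sum_rotate)
  also have "\<dots> = (\<Sum>k\<in>G. \<Sum>l<n. cnj (\<Sum>a<n. k $$ (l, a) * g $$ (a, i)) * (\<Sum>b<n. k $$ (l, b) * g $$ (b, j)))"
    by (simp add: cnj_sum sum_distrib_left sum_distrib_right)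
  also have "\<dots> = (\<Sum>k\<in>G. \<Sum>l<n. cnj ((k * g) $$ (l, i)) * (k * g) $$ (l, j))"
    by (intro sum.cong refl) (use ij g carrier_matD[OF G_mat] in \<open>simp add: scalar_prod_def atLeast0LessThan\<close>)
  also have "\<dots> = H $$ (i, j)"
    unfolding H_index[OF ij]
    by (rule sum.reindex_bij_betw[OF bij_G_mult[OF assms], of "\<lambda>k. \<Sum>l<n. cnj (k $$ (l, i)) * k $$ (l, j)"])
  finally show "(adj n g * H * g) $$ (i, j) = H $$ (i, j)" .
qed (use carrier_matD[OF G_mat[OF assms]] in \<open>auto simp: H_def adj_def\<close>)

definition ip :: "mpoly \<Rightarrow> mpoly \<Rightarrow> complex"
  where "ip p q = fischer p (act n H q)"

lemma ip_add_left: "ip (p + q) r = ip p r + ip q r"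
  and ip_add_right: "ip r (p + q) = ip r p + ip r q"
  and ip_const_left: "ip (const c * p) r = cnj c * ip p r"
  and ip_const_right: "ip r (const c * p) = c * ip r p"
  by (simp_all add: ip_def fischer_add_left fischer_add_right act_add fischer_const_left
      fischer_const_right act_const_mult)

lemma ip_0 [simp]: "ip 0 p = 0" "ip p 0 = 0" by (simp_all add: ip_def fischer_def)

lemma ip_minus_left: "ip (- p) r = - ip p r" and ip_minus_right: "ip r (- p) = - ip r p"
  using ip_const_left[of "-1" p r] ip_const_right[of r "-1" p] by (simp_all add: const_minus)

lemma ip_diff_left: "ip (p - q) r = ip p r - ip q r" and ip_diff_right: "ip r (p - q) = ip r p - ip r q"
  using ip_add_left[of p "- q" r] ip_add_right[of r p "- q"] by (simp_all add: ip_minus_left ip_minus_right)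

lemma ip_sum_left: "ip (sum f A) r = (\<Sum>a\<in>A. ip (f a) r)"
  by (induction A rule: infinite_finite_induct) (auto simp: ip_add_left)

lemma ip_sum_right: "ip r (sum f A) = (\<Sum>a\<in>A. ip r (f a))"
  by (induction A rule: infinite_finite_induct) (auto simp: ip_add_right)

lemma ip_sym:
  assumes "p \<in> polys n" "q \<in> polys n"
  shows "ip q p = cnj (ip p q)"
  using assms by (simp add: ip_def fischer_act H_adj fischer_sym[of "act n H q"])

lemma ip_act:
  assumes "g \<in> G" "p \<in> polys n" "q \<in> polys n"
  shows "ip (act n g p) (act n g q) = ip p q"
proof -
  have a: "adj n (adj n g) = g"
    using carrier_matD[OF G_mat[OF assms(1)]] by (intro eq_matI) (auto simp: adj_def)
  have "ip p q = fischer p (act n (adj n g * H * g) q)"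
    using assms by (simp add: ip_def H_invariant)
  also have "\<dots> = fischer p (act n (adj n g) (act n H (act n g q)))"
    using assms by (simp add: act_times mult_carrier_mat[of _ n n] assoc_mult_mat[of _ n n _ n _ n])
  also have "\<dots> = ip (act n g p) (act n g q)"
    using assms by (simp add: ip_def fischer_act[of _ _ _ "adj n g"] a)
  finally show ?thesis by simp
qed

lemma ip_var_left:
  assumes "i < n" "q \<in> polys n"
  shows "ip (var i * p) q = (\<Sum>j<n. H $$ (i, j) * ip p (partial j q))"
  using assms by (simp add: ip_def fischer_var_left partial_act fischer_sum_right fischer_const_right)

lemma ip_homog: "p \<in> homog n d \<Longrightarrow> q \<in> homog n e \<Longrightarrow> d \<noteq> e \<Longrightarrow> ip p q = 0"
  unfolding ip_def by (metis act_homog fischer_homog)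

lemma ip_euler_right:
  assumes "p \<in> polys n" "q \<in> polys n"
  shows "ip p (euler n q) = ip (euler n p) q"
proof -
  obtain N where N: "p = (\<Sum>d<N. hpart n d p)" by (rule hpart_sum)
  obtain M where M: "q = (\<Sum>d<M. hpart n d q)" by (rule hpart_sum)
  have e: "euler n (sum f A) = (\<Sum>a\<in>A. euler n (f a))" for f and A :: "nat set"
    by (induction A rule: infinite_finite_induct) (auto simp: euler_add, simp_all add: euler_def)
  have "ip (hpart n d p) (euler n (hpart n e q)) = ip (euler n (hpart n d p)) (hpart n e q)" for d e
    using ip_homog[OF hpart_homog[OF assms(1)] hpart_homog[OF assms(2)], of d e]
      euler_homog[OF hpart_homog[OF assms(1)], of d] euler_homog[OF hpart_homog[OF assms(2)], of e]
    by (cases "d = e") (simp_all add: const_of_nat[symmetric] ip_const_left ip_const_right)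
  then show ?thesis
    by (subst (1 2) N, subst (1 2) M) (simp add: e ip_sum_left ip_sum_right)
qed

text \<open>Moving the variables \<open>x\<^sub>i\<close> of the Euler operator \<open>\<Sum> x\<^sub>i \<partial>\<^sub>i\<close> to the other side produces the matrix \<open>H\<close>,
  which is a sum of matrices \<open>g\<^sup>* g\<close>; each of these contributes a sum of squares.\<close>

lemma euler_ip_expand:
  assumes "p \<in> polys n"
  shows "ip (euler n p) p = (\<Sum>g\<in>G. \<Sum>l<n. ip (\<Sum>i<n. const (g $$ (l, i)) * partial i p)
                                                    (\<Sum>i<n. const (g $$ (l, i)) * partial i p))"
proof -
  have "ip (euler n p) p = (\<Sum>i<n. \<Sum>j<n. \<Sum>g\<in>G. \<Sum>l<n. cnj (g $$ (l, i)) * g $$ (l, j) * ip (partial i p) (partial j p))"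
    using assms by (simp add: euler_def ip_sum_left ip_var_left H_index sum_distrib_right)
  also have "\<dots> = (\<Sum>g\<in>G. \<Sum>i<n. \<Sum>j<n. \<Sum>l<n. cnj (g $$ (l, i)) * g $$ (l, j) * ip (partial i p) (partial j p))"
    by (rule sum_rotate)
  also have "\<dots> = (\<Sum>g\<in>G. \<Sum>l<n. \<Sum>i<n. \<Sum>j<n. cnj (g $$ (l, i)) * g $$ (l, j) * ip (partial i p) (partial j p))"
    by (rule sum.cong[OF refl]) (rule sum_rotate)
  also have "\<dots> = (\<Sum>g\<in>G. \<Sum>l<n. ip (\<Sum>i<n. const (g $$ (l, i)) * partial i p)
                                                    (\<Sum>i<n. const (g $$ (l, i)) * partial i p))"
    by (rule sum.cong[OF refl], rule sum.cong[OF refl], subst sum.swap)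
      (simp add: ip_sum_left ip_sum_right ip_const_left ip_const_right sum_distrib_left mult.assoc mult.left_commute)
  finally show ?thesis .
qed

text \<open>Positivity goes by induction on the degree \<open>d\<close>: by \<open>euler_ip_expand\<close>, \<open>d\<close> times the norm
  of \<open>p\<close> is a sum of norms of polynomials of degree \<open>d - 1\<close>, among which (for \<open>g = 1\<close>) are all
  first derivatives of \<open>p\<close>.\<close>

lemma ip_pos_homog:
  assumes "p \<in> homog n d"
  shows "Re (ip p p) \<ge> 0 \<and> (Re (ip p p) = 0 \<longrightarrow> p = 0)"
  using assms
proof (induction d arbitrary: p)
  case 0
  then have "keys p \<subseteq> {0}"
    unfolding homog_alt by (auto simp: tdeg_def polys_def intro!: poly_mapping_eqI)
      (metis in_keys_iff lessThan_iff subset_iff zero_less_iff_neq_zero not_gr0)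
  then have p: "p = const (lookup p 0)"
    unfolding const_def by (intro poly_mapping_eqI) (auto simp: lookup_single when_def in_keys_iff)
  have "ip p p = cnj (lookup p 0) * lookup p 0"
    by (subst (1 2) p) (cases "lookup p 0 = 0", simp_all add: ip_def fischer_def, simp add: const_def mfact_def)
  then have "Re (ip p p) = (cmod (lookup p 0))\<^sup>2"
    by (metis Re_complex_of_real complex_norm_square mult.commute)
  then show ?case by simp (metis const_0 p)
next
  case (Suc d)
  let ?q = "\<lambda>g l. \<Sum>i<n. const (g $$ (l, i)) * partial i p"
  have q: "?q g l \<in> homog n d" for g l
    using Suc.prems by (intro homog_sum homog_const_mult homog_partial) auto
  have pos: "Re (ip (?q g l) (?q g l)) \<ge> 0" for g l using Suc.IH[OF q] by blast
  have p: "p \<in> polys n" using Suc.prems homog_polys by blast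
  have "ip (euler n p) p = of_nat (Suc d) * ip p p"
    by (simp only: euler_homog[OF Suc.prems] const_of_nat[symmetric] ip_const_left complex_cnj_of_nat)
  then have e: "real (Suc d) * Re (ip p p) = (\<Sum>g\<in>G. \<Sum>l<n. Re (ip (?q g l) (?q g l)))"
    unfolding euler_ip_expand[OF p] by (metis (no_types, lifting) Re_sum sum.cong Re_complex_of_real
        Re_divide_of_nat mult.commute mult_of_nat_commute of_real_of_nat_eq times_complex.simps(1)
        Im_complex_of_real mult_zero_left diff_zero)
  have "Re (ip p p) \<ge> 0"
  proof -
    have "real (Suc d) * Re (ip p p) \<ge> 0" unfolding e by (intro sum_nonneg) (use pos in blast)
    then show ?thesis by (simp add: zero_le_mult_iff)
  qed
  moreover have "p = 0" if z: "Re (ip p p) = 0"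
  proof -
    have "(\<Sum>g\<in>G. \<Sum>l<n. Re (ip (?q g l) (?q g l))) = 0" using e z by simp
    then have "Re (ip (?q g l) (?q g l)) = 0" if "g \<in> G" "l < n" for g l
      using that pos finite_G by (simp add: sum_nonneg_eq_0_iff sum_nonneg)
    then have "?q (1\<^sub>m n) l = 0" if "l < n" for l using Suc.IH[OF q] G_one that by blast
    moreover have "?q (1\<^sub>m n) l = partial l p" if "l < n" for l
    proof -
      have "?q (1\<^sub>m n) l = (\<Sum>i<n. if i = l then partial i p else 0)"
        by (intro sum.cong) (use that in auto)
      then show ?thesis using that by simp
    qed
    ultimately have "euler n p = 0" unfolding euler_def by (intro sum.neutral) simp
    then have "lookup p m = 0" for m
      using lookup_euler[of n p m] Suc.prems by (cases "m \<in> keys p") (auto simp: homog_alt in_keys_iff)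
    then show ?thesis by (intro poly_mapping_eqI) simp
  qed
  ultimately show ?case by blast
qed

lemma ip_definite:
  assumes "p \<in> polys n" "ip p p = 0"
  shows "p = 0"
proof -
  obtain N where N: "p = (\<Sum>d<N. hpart n d p)" by (rule hpart_sum)
  have h: "hpart n d p \<in> homog n d" for d using assms hpart_homog by blast
  have "ip p p = (\<Sum>d<N. \<Sum>e<N. ip (hpart n d p) (hpart n e p))"
    by (subst (1 2) N) (simp only: ip_sum_left ip_sum_right, rule sum.swap)
  also have "\<dots> = (\<Sum>d<N. \<Sum>e<N. if e = d then ip (hpart n d p) (hpart n d p) else 0)"
    by (intro sum.cong refl) (use ip_homog[OF h h] in auto)
  finally have "(\<Sum>d<N. Re (ip (hpart n d p) (hpart n d p))) = 0"
    using assms(2) by (simp flip: Re_sum)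
  then have "hpart n d p = 0" if "d < N" for d
    using ip_pos_homog[OF h] that by (simp add: sum_nonneg_eq_0_iff)
  then show ?thesis by (subst N) simp
qed

lemma ip_separates: "p \<in> polys n \<Longrightarrow> q \<in> polys n \<Longrightarrow> (\<And>r. r \<in> polys n \<Longrightarrow> ip r p = ip r q) \<Longrightarrow> p = q"
  using ip_definite[of "p - q"] by (simp add: ip_diff_right)

text \<open>Since the form is nondegenerate on linear forms, every derivative is a combination of the
  adjoints of the variables.\<close>

lemma H_invertible:
  obtains K where "K \<in> carrier_mat n n" "K * H = 1\<^sub>m n"
proof -
  have "v = 0\<^sub>v n" if v: "v \<in> carrier_vec n" "H *\<^sub>v v = 0\<^sub>v n" for v
  proof -
    define p where "p = (\<Sum>j<n. const (v $ j) * var j)"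
    have p: "p \<in> polys n" unfolding p_def by (intro polys_sum) auto
    have "ip (var i * 1) p = 0" if "i < n" for i
    proof -
      have "(\<Sum>j<n. H $$ (i, j) * v $ j) = (H *\<^sub>v v) $ i"
        using v(1) that carrier_matD[OF H_carrier] by (auto simp: scalar_prod_def atLeast0LessThan)
      then have z: "(\<Sum>j<n. H $$ (i, j) * v $ j) = 0" using v(2) that by simp
      have "partial j p = const (v $ j)" if "j < n" for j
      proof -
        have "partial j p = (\<Sum>k<n. if k = j then const (v $ k) else 0)"
          unfolding p_def partial_sum partial_const_mult
          using partial_var_mult[of _ _ 1] partial_const[of _ 1] by (intro sum.cong) simp_all
        then show ?thesis using that by simp
      qed
      then have "ip (var i * 1) p = (\<Sum>j<n. H $$ (i, j) * v $ j) * ip 1 1"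
        using that p ip_const_right[of 1 _ 1] by (simp only: ip_var_left) (simp add: sum_distrib_right mult.assoc)
      with z show ?thesis by simp
    qed
    then have "ip p p = 0"
      by (subst (1) p_def) (simp add: ip_sum_left ip_const_left)
    then have "p = 0" using ip_definite p by blast
    then have "lookup p (single j 1) = 0" for j by simp
    moreover have "lookup p (single j 1) = v $ j" if "j < n" for j
    proof -
      have "lookup p (single j 1) = (\<Sum>k<n. if k = j then v $ k else 0)"
        unfolding p_def lookup_sum
        by (intro sum.cong refl) (auto simp: var_def lookup_single when_def single_1_eq)
      then show ?thesis using that by simp
    qed
    ultimately show ?thesis using v(1) by (intro eq_vecI) auto
  qed
  then have "det H \<noteq> 0" using det_0_iff_vec_prod_zero_field[OF H_carrier] by blast
  then have "H \<in> Units (ring_mat TYPE(complex) n ())" by (rule det_non_zero_imp_unit[OF H_carrier])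
  then show ?thesis using that by (auto simp: Units_def ring_mat_def)
qed

end

section \<open>Linear operators and the Weyl algebra\<close>

lemma End_iff: "P \<in> carrier (End_ring n) \<longleftrightarrow>
    P \<in> extensional (polys n) \<and> (\<forall>p\<in>polys n. P p \<in> polys n) \<and>
    (\<forall>p\<in>polys n. \<forall>q\<in>polys n. P (p + q) = P p + P q) \<and>
    (\<forall>c. \<forall>p\<in>polys n. P (const c * p) = const c * P p)"
  by (auto simp: End_ring_def PiE_def)

lemma End_ops [simp]:
  "P \<otimes>\<^bsub>End_ring n\<^esub> Q = compose (polys n) P Q"
  "P \<oplus>\<^bsub>End_ring n\<^esub> Q = (\<lambda>p\<in>polys n. P p + Q p)"
  "\<one>\<^bsub>End_ring n\<^esub> = (\<lambda>p\<in>polys n. p)"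
  "\<zero>\<^bsub>End_ring n\<^esub> = (\<lambda>p\<in>polys n. 0)"
  by (simp_all add: End_ring_def)

lemma End_polys [simp]: "P \<in> carrier (End_ring n) \<Longrightarrow> p \<in> polys n \<Longrightarrow> P p \<in> polys n"
  and End_add: "P \<in> carrier (End_ring n) \<Longrightarrow> p \<in> polys n \<Longrightarrow> q \<in> polys n \<Longrightarrow> P (p + q) = P p + P q"
  and End_const: "P \<in> carrier (End_ring n) \<Longrightarrow> p \<in> polys n \<Longrightarrow> P (const c * p) = const c * P p"
  by (auto simp: End_iff)

lemma End_eqI:
  assumes "P \<in> carrier (End_ring n)" "Q \<in> carrier (End_ring n)" "\<And>p. p \<in> polys n \<Longrightarrow> P p = Q p"
  shows "P = Q"
  using assms by (intro extensionalityI[of P "polys n" Q]) (auto simp: End_iff)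

lemma End_0: "P \<in> carrier (End_ring n) \<Longrightarrow> P 0 = 0"
  using End_const[of P n 0 0] by simp

lemma End_minus: "P \<in> carrier (End_ring n) \<Longrightarrow> p \<in> polys n \<Longrightarrow> P (- p) = - P p"
  using End_const[of P n p "-1"] by (simp add: const_minus)

lemma End_restrictI:
  assumes "\<And>p. p \<in> polys n \<Longrightarrow> f p \<in> polys n"
    and "\<And>p q. p \<in> polys n \<Longrightarrow> q \<in> polys n \<Longrightarrow> f (p + q) = f p + f q"
    and "\<And>c p. p \<in> polys n \<Longrightarrow> f (const c * p) = const c * f p"
  shows "restrict f (polys n) \<in> carrier (End_ring n)"
  using assms by (simp add: End_iff)

lemma End_compose: "P \<in> carrier (End_ring n) \<Longrightarrow> Q \<in> carrier (End_ring n) \<Longrightarrow> compose (polys n) P Q \<in> carrier (End_ring n)"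
  unfolding compose_def by (rule End_restrictI) (auto simp: End_add End_const)

lemma End_plus: "P \<in> carrier (End_ring n) \<Longrightarrow> Q \<in> carrier (End_ring n) \<Longrightarrow> (\<lambda>p\<in>polys n. P p + Q p) \<in> carrier (End_ring n)"
  by (rule End_restrictI) (auto simp: End_add End_const distrib_left)

lemma ring_End: "ring (End_ring n)"
proof (intro ringI abelian_groupI monoidI)
  let ?E = "carrier (End_ring n)"
  fix P Q R assume *: "P \<in> ?E" "Q \<in> ?E" "R \<in> ?E"
  show "(P \<otimes>\<^bsub>End_ring n\<^esub> Q) \<otimes>\<^bsub>End_ring n\<^esub> R = P \<otimes>\<^bsub>End_ring n\<^esub> (Q \<otimes>\<^bsub>End_ring n\<^esub> R)"
    using * by (auto simp: compose_def restrict_def fun_eq_iff)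
  show "(P \<oplus>\<^bsub>End_ring n\<^esub> Q) \<oplus>\<^bsub>End_ring n\<^esub> R = P \<oplus>\<^bsub>End_ring n\<^esub> (Q \<oplus>\<^bsub>End_ring n\<^esub> R)"
    by (auto simp: restrict_def fun_eq_iff add.assoc)
  show "(P \<oplus>\<^bsub>End_ring n\<^esub> Q) \<otimes>\<^bsub>End_ring n\<^esub> R = P \<otimes>\<^bsub>End_ring n\<^esub> R \<oplus>\<^bsub>End_ring n\<^esub> Q \<otimes>\<^bsub>End_ring n\<^esub> R"
    using * by (auto simp: compose_def restrict_def fun_eq_iff)
  show "R \<otimes>\<^bsub>End_ring n\<^esub> (P \<oplus>\<^bsub>End_ring n\<^esub> Q) = R \<otimes>\<^bsub>End_ring n\<^esub> P \<oplus>\<^bsub>End_ring n\<^esub> R \<otimes>\<^bsub>End_ring n\<^esub> Q"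
    using * by (auto simp: compose_def restrict_def fun_eq_iff End_add)
next
  let ?E = "carrier (End_ring n)"
  fix P Q assume *: "P \<in> ?E" "Q \<in> ?E"
  show "P \<oplus>\<^bsub>End_ring n\<^esub> Q = Q \<oplus>\<^bsub>End_ring n\<^esub> P" by (auto simp: restrict_def fun_eq_iff add.commute)
  show "P \<oplus>\<^bsub>End_ring n\<^esub> Q \<in> ?E" using * by (simp add: End_plus)
  show "P \<otimes>\<^bsub>End_ring n\<^esub> Q \<in> ?E" using * by (simp add: End_compose)
next
  let ?E = "carrier (End_ring n)"
  show "\<one>\<^bsub>End_ring n\<^esub> \<in> ?E" "\<zero>\<^bsub>End_ring n\<^esub> \<in> ?E" by (auto intro!: End_restrictI)
  fix P assume *: "P \<in> ?E"
  then have e: "P = (\<lambda>p\<in>polys n. P p)" by (simp add: End_iff extensional_restrict)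
  show "\<one>\<^bsub>End_ring n\<^esub> \<otimes>\<^bsub>End_ring n\<^esub> P = P" "P \<otimes>\<^bsub>End_ring n\<^esub> \<one>\<^bsub>End_ring n\<^esub> = P" "\<zero>\<^bsub>End_ring n\<^esub> \<oplus>\<^bsub>End_ring n\<^esub> P = P"
    using * by (subst (2) e, auto simp: compose_def intro!: restrict_ext)+
  have "(\<lambda>p\<in>polys n. - P p) \<in> ?E" using * by (intro End_restrictI) (auto simp: End_add End_const)
  moreover have "(\<lambda>p\<in>polys n. - P p) \<oplus>\<^bsub>End_ring n\<^esub> P = \<zero>\<^bsub>End_ring n\<^esub>" by (auto intro!: restrict_ext)
  ultimately show "\<exists>Q\<in>?E. Q \<oplus>\<^bsub>End_ring n\<^esub> P = \<zero>\<^bsub>End_ring n\<^esub>" by blast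
qed

definition mulop :: "nat \<Rightarrow> mpoly \<Rightarrow> mpoly \<Rightarrow> mpoly"
  where "mulop n f = (\<lambda>p\<in>polys n. f * p)"

lemma mulop_End: "f \<in> polys n \<Longrightarrow> mulop n f \<in> carrier (End_ring n)"
  unfolding mulop_def by (rule End_restrictI) (auto simp: distrib_left mult.left_commute)

lemma weyl_generators: "{\<lambda>p\<in>polys n. const c * p | c. True} \<union> {\<lambda>p\<in>polys n. var i * p | i. i < n} \<union>
     {\<lambda>p\<in>polys n. partial i p | i. i < n} \<subseteq> carrier (End_ring n)"
  by (auto intro!: End_restrictI simp: distrib_left partial_add partial_const_mult mult.left_commute)

lemma weyl_subring: "subring (weyl n) (End_ring n)"
  unfolding weyl_def by (rule ring.generate_ring_is_subring[OF ring_End weyl_generators])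

lemma weyl_End: "P \<in> weyl n \<Longrightarrow> P \<in> carrier (End_ring n)"
  using subringE(1)[OF weyl_subring] by blast

lemma weyl_compose: "P \<in> weyl n \<Longrightarrow> Q \<in> weyl n \<Longrightarrow> compose (polys n) P Q \<in> weyl n"
  using subringE(6)[OF weyl_subring] by simp

lemma weyl_plus: "P \<in> weyl n \<Longrightarrow> Q \<in> weyl n \<Longrightarrow> (\<lambda>p\<in>polys n. P p + Q p) \<in> weyl n"
  using subringE(7)[OF weyl_subring] by simp

lemma weyl_zero: "(\<lambda>p\<in>polys n. 0) \<in> weyl n"
  using subringE(2)[OF weyl_subring] by simp

lemma weyl_const: "mulop n (const c) \<in> weyl n"
  and weyl_var: "i < n \<Longrightarrow> mulop n (var i) \<in> weyl n"
  and weyl_partial: "i < n \<Longrightarrow> (\<lambda>p\<in>polys n. partial i p) \<in> weyl n"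
  unfolding weyl_def mulop_def by (rule generate_ring.incl, blast)+

lemma weyl_sum:
  assumes "\<And>a. a \<in> A \<Longrightarrow> F a \<in> weyl n"
  shows "(\<lambda>p\<in>polys n. \<Sum>a\<in>A. F a p) \<in> weyl n"
  using assms
proof (induction A rule: infinite_finite_induct)
  case (insert x A)
  have "(\<lambda>p\<in>polys n. \<Sum>a\<in>insert x A. F a p) = (\<lambda>p\<in>polys n. F x p + (\<lambda>p\<in>polys n. \<Sum>a\<in>A. F a p) p)"
    by (rule restrict_ext) (use insert in simp)
  moreover have "\<dots> \<in> weyl n" using insert by (intro weyl_plus) blast+
  ultimately show ?case by (simp only:)
qed (simp_all add: weyl_zero)

lemma weyl_mulop: "f \<in> polys n \<Longrightarrow> mulop n f \<in> weyl n"
proof (induction f rule: polys_induct)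
  case (var i p)
  have "mulop n (var i * p) = compose (polys n) (mulop n (var i)) (mulop n p)"
    by (auto simp: compose_def mulop_def mult.assoc var intro!: restrict_ext)
  with var show ?case by (simp add: weyl_compose weyl_var)
next
  case (add p q)
  have "mulop n (p + q) = (\<lambda>r\<in>polys n. mulop n p r + mulop n q r)"
    by (auto simp: mulop_def distrib_right intro!: restrict_ext)
  with add show ?case by (simp only: weyl_plus)
qed (rule weyl_const)

lemma weyl_induct [consumes 1, case_names const var partial add compose]:
  assumes "P \<in> weyl n"
    and c: "\<And>c. X (mulop n (const c))"
    and v: "\<And>i. i < n \<Longrightarrow> X (mulop n (var i))"
    and d: "\<And>i. i < n \<Longrightarrow> X (\<lambda>p\<in>polys n. partial i p)"
    and a: "\<And>P Q. P \<in> weyl n \<Longrightarrow> Q \<in> weyl n \<Longrightarrow> X P \<Longrightarrow> X Q \<Longrightarrow> X (\<lambda>p\<in>polys n. P p + Q p)"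
    and m: "\<And>P Q. P \<in> weyl n \<Longrightarrow> Q \<in> weyl n \<Longrightarrow> X P \<Longrightarrow> X Q \<Longrightarrow> X (compose (polys n) P Q)"
  shows "X P"
proof -
  have "P \<in> weyl n \<and> X P" using assms(1)[unfolded weyl_def]
  proof (induction rule: generate_ring.induct)
    case one
    then show ?case using c[of 1] weyl_const[of n 1] by (simp only: mulop_def const_1 mult_1 End_ops)
  next
    case (incl h)
    then show ?case using c v d weyl_const weyl_var weyl_partial unfolding mulop_def by blast
  next
    case (a_inv h)
    then have E: "h \<in> carrier (End_ring n)" using weyl_End by blast
    interpret ring "End_ring n" by (rule ring_End)
    have "compose (polys n) (mulop n (const (- 1))) h = \<ominus>\<^bsub>End_ring n\<^esub> h"
    proof (rule sym, rule minus_equality)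
      show "compose (polys n) (mulop n (const (- 1))) h \<oplus>\<^bsub>End_ring n\<^esub> h = \<zero>\<^bsub>End_ring n\<^esub>"
        by (auto simp: compose_def mulop_def const_minus E intro!: restrict_ext)
    qed (use E in \<open>auto intro!: End_compose mulop_End\<close>)
    with a_inv m[OF weyl_const _ c] show ?case by (metis weyl_compose weyl_const)
  next
    case (eng_add P Q)
    then show ?case unfolding End_ops by (intro conjI a weyl_plus) blast+
  next
    case (eng_mult P Q)
    then show ?case unfolding End_ops by (intro conjI m weyl_compose) blast+
  qed
  then show ?thesis ..
qed

subsection \<open>Degrees of operators\<close>

definition weyl_deg :: "nat \<Rightarrow> int \<Rightarrow> (mpoly \<Rightarrow> mpoly) set"
  where "weyl_deg n k = {P \<in> weyl n. \<forall>p\<in>polys n. euler n (P p) - P (euler n p) = of_int k * P p}"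

lemma weyl_deg_homog:
  assumes "P \<in> weyl_deg n k" "p \<in> homog n d"
  shows "0 \<le> int d + k \<Longrightarrow> P p \<in> homog n (nat (int d + k))" and "int d + k < 0 \<Longrightarrow> P p = 0"
    and "euler n (P p) = of_int (int d + k) * P p"
proof -
  have p: "p \<in> polys n" using assms(2) homog_polys by blast
  have P: "P \<in> carrier (End_ring n)" using assms(1) weyl_End by (auto simp: weyl_deg_def)
  have "euler n (P p) = P (euler n p) + of_int k * P p"
    using assms(1) p by (simp add: weyl_deg_def diff_eq_eq add.commute)
  also have "P (euler n p) = of_int (int d) * P p"
    using End_const[OF P p, of "of_nat d"] by (simp add: euler_homog[OF assms(2)] const_of_nat)
  finally show e: "euler n (P p) = of_int (int d + k) * P p" by (simp add: distrib_right)
  show "0 \<le> int d + k \<Longrightarrow> P p \<in> homog n (nat (int d + k))" "int d + k < 0 \<Longrightarrow> P p = 0"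
    using euler_eigen[OF _ e] P p by auto
qed

lemma weyl_degI:
  assumes "P \<in> weyl n" "\<And>d p. p \<in> homog n d \<Longrightarrow> euler n (P p) = of_int (int d + k) * P p"
  shows "P \<in> weyl_deg n k"
  unfolding weyl_deg_def
proof (intro CollectI conjI ballI)
  fix p assume "p \<in> polys n"
  have P: "P \<in> carrier (End_ring n)" using assms(1) weyl_End by blast
  show "euler n (P p) - P (euler n p) = of_int k * P p" using \<open>p \<in> polys n\<close>
  proof (induction p rule: polys_monomial_induct)
    case (single m c)
    from homog_single[OF this, of c] have h: "single m c \<in> homog n (tdeg n m)" .
    show ?case
      unfolding assms(2)[OF h] euler_homog[OF h]
      using End_const[OF P homog_polys[OF h], of "of_nat (tdeg n m)"]
      by (simp add: const_of_nat distrib_right)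
  next
    case (add p q)
    then have "(euler n (P p) - P (euler n p)) + (euler n (P q) - P (euler n q)) = of_int k * (P p + P q)"
      by (simp add: distrib_left)
    then show ?case using add.hyps by (simp add: End_add[OF P] euler_add algebra_simps)
  qed
qed fact

lemma weyl_deg_plus: "P \<in> weyl_deg n k \<Longrightarrow> Q \<in> weyl_deg n k \<Longrightarrow> (\<lambda>p\<in>polys n. P p + Q p) \<in> weyl_deg n k"
  by (auto simp: weyl_deg_def weyl_plus euler_add algebra_simps)

lemma weyl_deg_compose:
  assumes "P \<in> weyl_deg n k" "Q \<in> weyl_deg n l"
  shows "compose (polys n) P Q \<in> weyl_deg n (k + l)"
proof (rule weyl_degI)
  show "compose (polys n) P Q \<in> weyl n" using assms weyl_compose by (simp add: weyl_deg_def)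
  fix d p assume p: "p \<in> homog n d"
  have P0: "P 0 = 0" using assms(1) weyl_End End_0 by (auto simp: weyl_deg_def)
  have "p \<in> polys n" using p homog_polys by blast
  have "euler n (P (Q p)) = of_int (int d + (k + l)) * P (Q p)"
  proof (cases "0 \<le> int d + l")
    case True
    from weyl_deg_homog(3)[OF assms(1) weyl_deg_homog(1)[OF assms(2) p True]] True
    show ?thesis by (simp add: algebra_simps)
  next
    case False
    then have "Q p = 0" using weyl_deg_homog(2)[OF assms(2) p] by simp
    then show ?thesis using P0 by (simp add: euler_def)
  qed
  then show "euler n (compose (polys n) P Q p) = of_int (int d + (k + l)) * compose (polys n) P Q p"
    using \<open>p \<in> polys n\<close> by (simp add: compose_def)
qed

lemma weyl_deg_zero: "(\<lambda>p\<in>polys n. 0) \<in> weyl_deg n k"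
  by (simp add: weyl_deg_def weyl_zero) (simp add: euler_def)

lemma weyl_deg_mulop:
  assumes "f \<in> homog n d"
  shows "mulop n f \<in> weyl_deg n (int d)"
proof (rule weyl_degI)
  show "mulop n f \<in> weyl n" using assms homog_polys weyl_mulop by blast
  fix e p assume p: "p \<in> homog n e"
  have "mulop n f p = f * p" using homog_polys[OF p] by (simp add: mulop_def)
  then show "euler n (mulop n f p) = of_int (int e + int d) * mulop n f p"
    using euler_homog[OF homog_mult[OF assms p]] by (simp add: add.commute)
qed

lemma weyl_deg_partial:
  assumes "i < n"
  shows "(\<lambda>p\<in>polys n. partial i p) \<in> weyl_deg n (- 1)"
proof (rule weyl_degI)
  show "(\<lambda>p\<in>polys n. partial i p) \<in> weyl n" using assms weyl_partial by blast
  fix d p assume p: "p \<in> homog n d"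
  have "euler n (partial i p) = of_int (int d + - 1) * partial i p"
  proof (cases d)
    case 0
    have "lookup p (m + single i 1) = 0" for m
      using p 0 tdeg_add[of n m "single i 1"] tdeg_single[OF assms, of 1]
      by (cases "m + single i 1 \<in> keys p") (auto simp: homog_alt in_keys_iff)
    then have "partial i p = 0" by (intro poly_mapping_eqI) (simp add: lookup_partial)
    then show ?thesis by (simp add: euler_def)
  next
    case (Suc e)
    then show ?thesis using euler_homog[OF homog_partial[of p n e i]] p assms by simp
  qed
  then show "euler n ((\<lambda>p\<in>polys n. partial i p) p) = of_int (int d + - 1) * (\<lambda>p\<in>polys n. partial i p) p"
    using homog_polys[OF p] by simp
qed

text \<open>An element of the Weyl algebra is first written as a sum of homogeneous summands in any
  order and with repeated degrees, since this form is visibly stable under products; the summands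
  of equal degree are collected afterwards.\<close>

inductive_set homog_sums :: "nat \<Rightarrow> (mpoly \<Rightarrow> mpoly) set" for n
  where homog: "P \<in> weyl_deg n k \<Longrightarrow> P \<in> homog_sums n"
  | plus: "P \<in> homog_sums n \<Longrightarrow> Q \<in> homog_sums n \<Longrightarrow> (\<lambda>p\<in>polys n. P p + Q p) \<in> homog_sums n"

lemma homog_sums_weyl: "P \<in> homog_sums n \<Longrightarrow> P \<in> weyl n"
  by (induction rule: homog_sums.induct) (simp add: weyl_deg_def, simp only: weyl_plus)

lemma homog_sums_compose:
  assumes "P \<in> homog_sums n" "Q \<in> homog_sums n"
  shows "compose (polys n) P Q \<in> homog_sums n"
  using assms(1)
proof (induction rule: homog_sums.induct)
  case (homog P k)
  then have P: "P \<in> carrier (End_ring n)" using weyl_End by (auto simp: weyl_deg_def)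
  show ?case using assms(2)
  proof (induction rule: homog_sums.induct)
    case (homog Q l)
    then show ?case using \<open>P \<in> weyl_deg n k\<close> homog_sums.homog weyl_deg_compose by blast
  next
    case (plus Q R)
    then have "compose (polys n) P (\<lambda>p\<in>polys n. Q p + R p) = (\<lambda>p\<in>polys n. compose (polys n) P Q p + compose (polys n) P R p)"
      by (auto simp: compose_def End_add[OF P] weyl_End homog_sums_weyl intro!: restrict_ext)
    then show ?case using plus homog_sums.plus by (simp only:)
  qed
next
  case (plus P R)
  have "Q p \<in> polys n" if "p \<in> polys n" for p using that assms(2) homog_sums_weyl weyl_End by auto
  then have "compose (polys n) (\<lambda>p\<in>polys n. P p + R p) Q = (\<lambda>p\<in>polys n. compose (polys n) P Q p + compose (polys n) R Q p)"
    by (auto simp: compose_def intro!: restrict_ext)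
  then show ?case using plus homog_sums.plus by (simp only:)
qed

lemma weyl_homog_sums: "P \<in> weyl n \<Longrightarrow> P \<in> homog_sums n"
proof (induction rule: weyl_induct)
  case (const c)
  then show ?case using weyl_deg_mulop homog_const homog_sums.homog by blast
next
  case (var i)
  then show ?case using weyl_deg_mulop homog_var homog_sums.homog by blast
next
  case (partial i)
  then show ?case using weyl_deg_partial homog_sums.homog by blast
qed (blast intro: homog_sums.plus homog_sums_compose)+

lemma weyl_graded:
  assumes "P \<in> weyl n"
  obtains K F where "finite K" "\<And>k. F k \<in> weyl_deg n k" "\<And>p. p \<in> polys n \<Longrightarrow> P p = (\<Sum>k\<in>K. F k p)"
    "\<And>k p. k \<notin> K \<Longrightarrow> p \<in> polys n \<Longrightarrow> F k p = 0"
proof -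
  have "\<exists>K F. finite K \<and> (\<forall>k. F k \<in> weyl_deg n k) \<and> (\<forall>p\<in>polys n. P p = (\<Sum>k\<in>K. F k p)) \<and>
      (\<forall>k p. k \<notin> K \<longrightarrow> p \<in> polys n \<longrightarrow> F k p = 0)"
    using weyl_homog_sums[OF assms]
  proof (induction rule: homog_sums.induct)
    case (homog P k)
    then show ?case
      by (intro exI[of _ "{k}"] exI[of _ "\<lambda>j. if j = k then P else (\<lambda>p\<in>polys n. 0)"])
        (auto simp: weyl_deg_zero)
  next
    case (plus P Q)
    from plus.IH(1) obtain K F where *: "finite K" "\<forall>k. F k \<in> weyl_deg n k" "\<forall>p\<in>polys n. P p = (\<Sum>k\<in>K. F k p)"
      "\<forall>k p. k \<notin> K \<longrightarrow> p \<in> polys n \<longrightarrow> F k p = 0" by blast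
    from plus.IH(2) obtain L J where **:
      "finite L" "\<forall>k. J k \<in> weyl_deg n k" "\<forall>p\<in>polys n. Q p = (\<Sum>k\<in>L. J k p)"
      "\<forall>k p. k \<notin> L \<longrightarrow> p \<in> polys n \<longrightarrow> J k p = 0" by blast
    note * = * **
    have "(\<Sum>k\<in>K. F k p) = (\<Sum>k\<in>K \<union> L. F k p)" "(\<Sum>k\<in>L. J k p) = (\<Sum>k\<in>K \<union> L. J k p)" if "p \<in> polys n" for p
      by (intro sum.mono_neutral_left; use * that in auto)+
    moreover have "(\<lambda>p\<in>polys n. F k p + J k p) \<in> weyl_deg n k" for k using * weyl_deg_plus by blast
    ultimately show ?case
      using * by (intro exI[of _ "K \<union> L"] exI[of _ "\<lambda>k. \<lambda>p\<in>polys n. F k p + J k p"] conjI allI)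
        (simp_all only: restrict_apply' sum.distrib, simp_all add: sum.distrib)
  qed
  then show ?thesis using that by blast
qed

section \<open>The invariant operators\<close>

context finite_linear_group
begin

abbreviation "\<D> \<equiv> carrier (inv_ops n G)"
abbreviation "\<D>deg \<equiv> inv_ops_deg n G"

lemma D_iff: "P \<in> \<D> \<longleftrightarrow> P \<in> weyl n \<and> (\<forall>g\<in>G. \<forall>p\<in>polys n. act n g (P p) = P (act n g p))"
proof -
  have "conj_act n g P = P \<longleftrightarrow> (\<forall>p\<in>polys n. act n g (P p) = P (act n g p))" if "P \<in> weyl n" "g \<in> G" for g
  proof -
    have P: "P \<in> extensional (polys n)" "\<And>p. p \<in> polys n \<Longrightarrow> P p \<in> polys n"
      using weyl_End[OF that(1)] by (auto simp: End_iff)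
    have "conj_act n g P = P \<longleftrightarrow> (\<forall>p\<in>polys n. act n g (P (act n (ginv g) p)) = P p)"
      unfolding conj_act_def
      using P(1) by (metis (no_types, lifting) extensional_restrict restrict_apply' restrict_ext)
    also have "\<dots> \<longleftrightarrow> (\<forall>p\<in>polys n. act n g (P p) = P (act n g p))"
      using act_ginv[OF that(2)] by (metis act_polys)
    finally show ?thesis .
  qed
  then show ?thesis by (auto simp: inv_ops_def)
qed

lemma D_weyl: "P \<in> \<D> \<Longrightarrow> P \<in> weyl n" by (simp add: D_iff)

lemma D_End: "P \<in> \<D> \<Longrightarrow> P \<in> carrier (End_ring n)" using D_weyl weyl_End by blast

lemma D_polys [simp]: "P \<in> \<D> \<Longrightarrow> p \<in> polys n \<Longrightarrow> P p \<in> polys n" using D_End End_polys by blast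

lemmas D_add = End_add[OF D_End]

lemma Ddeg_iff: "P \<in> \<D>deg k \<longleftrightarrow> P \<in> \<D> \<and> P \<in> weyl_deg n k"
  by (auto simp: inv_ops_deg_def weyl_deg_def D_weyl)

lemma Ddeg_D: "P \<in> \<D>deg k \<Longrightarrow> P \<in> \<D>" by (simp add: Ddeg_iff)

lemma D_compose: "P \<in> \<D> \<Longrightarrow> Q \<in> \<D> \<Longrightarrow> compose (polys n) P Q \<in> \<D>"
  by (auto simp: D_iff weyl_compose) (simp add: compose_def weyl_End)

lemma D_plus: "P \<in> \<D> \<Longrightarrow> Q \<in> \<D> \<Longrightarrow> (\<lambda>p\<in>polys n. P p + Q p) \<in> \<D>"
  by (auto simp: D_iff weyl_plus act_add)

lemma Ddeg_compose: "P \<in> \<D>deg k \<Longrightarrow> Q \<in> \<D>deg l \<Longrightarrow> compose (polys n) P Q \<in> \<D>deg (k + l)"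
  by (simp add: Ddeg_iff D_compose weyl_deg_compose)

lemma Ddeg_plus: "P \<in> \<D>deg k \<Longrightarrow> Q \<in> \<D>deg k \<Longrightarrow> (\<lambda>p\<in>polys n. P p + Q p) \<in> \<D>deg k"
  by (simp add: Ddeg_iff D_plus weyl_deg_plus)

lemma Ddeg_mulop:
  assumes "f \<in> homog n d" "\<And>g. g \<in> G \<Longrightarrow> act n g f = f"
  shows "mulop n f \<in> \<D>deg (int d)"
proof -
  have "f \<in> polys n" using assms homog_polys by blast
  then show ?thesis
    using assms(2) weyl_mulop weyl_deg_mulop[OF assms(1)] by (simp add: Ddeg_iff D_iff) (simp add: act_mult mulop_def)
qed

lemma Ddeg_const: "mulop n (const c) \<in> \<D>deg 0"
  using Ddeg_mulop[OF homog_const] by simp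

lemma Ddeg_euler: "(\<lambda>p\<in>polys n. euler n p) \<in> \<D>deg 0"
proof -
  have "(\<lambda>p\<in>polys n. euler n p) = (\<lambda>p\<in>polys n. \<Sum>i<n. compose (polys n) (mulop n (var i)) (\<lambda>p\<in>polys n. partial i p) p)"
    by (rule restrict_ext) (simp add: euler_def compose_def mulop_def)
  also have "\<dots> \<in> weyl n"
    by (intro weyl_sum weyl_compose weyl_partial weyl_var) auto
  finally have w: "(\<lambda>p\<in>polys n. euler n p) \<in> weyl n" .
  have "act n g (euler n p) = euler n (act n g p)" if "p \<in> polys n" for g p
    using that
  proof (induction p rule: polys_monomial_induct)
    case (single m c)
    from homog_single[OF this, of c] have h: "single m c \<in> homog n (tdeg n m)" .
    show ?case
      by (simp only: euler_homog[OF h] euler_homog[OF act_homog[OF h]] const_of_nat[symmetric] act_const_mult)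
  qed (simp add: euler_add act_add)
  then show ?thesis using w by (simp add: Ddeg_iff D_iff weyl_deg_def)
qed

lemma D_1: "(\<lambda>p\<in>polys n. p) \<in> \<D>"
  using Ddeg_D[OF Ddeg_const[of 1]] by (simp add: mulop_def)

lemma D_0: "(\<lambda>p\<in>polys n. 0) \<in> \<D>"
  using Ddeg_D[OF Ddeg_const[of 0]] by (simp add: mulop_def)

text \<open>The homogeneous components of an invariant operator are invariant, because they are
  determined by the operator and substitutions preserve degrees.\<close>

lemma D_graded:
  assumes "P \<in> \<D>"
  obtains K F where "finite K" "\<And>k. F k \<in> \<D>deg k" "\<And>p. p \<in> polys n \<Longrightarrow> P p = (\<Sum>k\<in>K. F k p)"
    "\<And>k p. k \<notin> K \<Longrightarrow> p \<in> polys n \<Longrightarrow> F k p = 0"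
proof -
  obtain K F where F: "finite K" "\<And>k. F k \<in> weyl_deg n k" "\<And>p. p \<in> polys n \<Longrightarrow> P p = (\<Sum>k\<in>K. F k p)"
    "\<And>k p. k \<notin> K \<Longrightarrow> p \<in> polys n \<Longrightarrow> F k p = 0"
    using weyl_graded[OF D_weyl[OF assms]] by metis
  have FE: "F k \<in> carrier (End_ring n)" for k using F(2) weyl_End by (auto simp: weyl_deg_def)
  \<comment> \<open>summands of different degrees have disjoint supports, so each can be read off from the sum\<close>
  have coeff: "lookup (\<Sum>k\<in>K. v k) m = (if int (tdeg n m) - int d \<in> K then lookup (v (int (tdeg n m) - int d)) m else 0)"
    if v: "\<And>k. euler n (v k) = of_int (int d + k) * v k" for v m d
  proof -
    have "lookup (v k) m = 0" if "k \<noteq> int (tdeg n m) - int d" for k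
    proof -
      have "of_nat (tdeg n m) * lookup (v k) m = of_int (int d + k) * lookup (v k) m"
        using arg_cong[OF v[of k], of "\<lambda>p. lookup p m"] by (simp only: lookup_euler lookup_of_int_mult)
      then have "of_int (int (tdeg n m) - (int d + k)) * lookup (v k) m = 0" by (simp add: algebra_simps)
      then show ?thesis using that by (metis diff_add_cancel diff_diff_eq eq_iff_diff_eq_0 mult_eq_0_iff of_int_eq_0_iff add.commute)
    qed
    then have "lookup (\<Sum>k\<in>K. v k) m = (\<Sum>k\<in>K. if k = int (tdeg n m) - int d then lookup (v k) m else 0)"
      unfolding lookup_sum by (intro sum.cong) auto
    then show ?thesis using F(1) by simp
  qed
  have "act n g (F k p) = F k (act n g p)" if "g \<in> G" "p \<in> polys n" for g k p
    using that(2)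
  proof (induction p rule: polys_monomial_induct)
    case (single m c)
    define p where "p = single m c"
    define d where "d = tdeg n m"
    have p: "p \<in> homog n d" unfolding p_def d_def using single homog_single by blast
    then have pp: "p \<in> polys n" using homog_polys by blast
    have gp: "act n g p \<in> homog n d" using p act_homog by blast
    define w where "w k = act n g (F k p) - F k (act n g p)" for k
    have e1: "euler n (F k (act n g p)) = of_int (int d + k) * F k (act n g p)" for k
      using weyl_deg_homog(3)[OF F(2) gp] .
    have e2: "euler n (act n g (F k p)) = of_int (int d + k) * act n g (F k p)" for k
    proof (cases "0 \<le> int d + k")
      case True
      from euler_homog[OF act_homog[OF weyl_deg_homog(1)[OF F(2) p True]], of g] True show ?thesis by simp
    next
      case False
      then show ?thesis using weyl_deg_homog(2)[OF F(2) p, of k] by (simp add: euler_def)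
    qed
    have sums: "(\<Sum>k\<in>K. act n g (F k p)) = (\<Sum>k\<in>K. F k (act n g p))"
    proof -
      have "act n g (P p) = P (act n g p)" using assms \<open>g \<in> G\<close> pp by (simp add: D_iff)
      then show ?thesis by (simp only: F(3)[OF pp] F(3)[OF act_polys[OF pp]] act_sum)
    qed
    show ?case
      unfolding p_def[symmetric]
    proof (cases "k \<in> K")
      case True
      show "act n g (F k p) = F k (act n g p)"
      proof (rule poly_mapping_eqI)
        fix m
        show "lookup (act n g (F k p)) m = lookup (F k (act n g p)) m"
        proof (cases "k = int (tdeg n m) - int d")
          case True
          then show ?thesis
            using arg_cong[OF sums, of "\<lambda>p. lookup p m"] \<open>k \<in> K\<close> by (simp add: coeff[OF e1] coeff[OF e2])
        next
          case False
          have "lookup v m = 0" if "euler n v = of_int (int d + k) * v" for v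
          proof -
            have "of_int (int (tdeg n m)) * lookup v m = of_int (int d + k) * lookup v m"
              using arg_cong[OF that, of "\<lambda>p. lookup p m"] by (simp only: lookup_euler lookup_of_int_mult of_int_of_nat_eq)
            then show ?thesis using False by (metis add_diff_cancel_left' mult_right_cancel of_int_eq_iff)
          qed
          then show ?thesis using e1 e2 by simp
        qed
      qed
    next
      case False
      then show "act n g (F k p) = F k (act n g p)" using F(4) pp by simp
    qed
  qed (simp add: End_add[OF FE] act_add)
  then have "F k \<in> \<D>deg k" for k using F(2) by (simp add: Ddeg_iff D_iff weyl_deg_def)
  then show ?thesis using that F by blast
qed

subsection \<open>Adjoint operators\<close>

text \<open>The adjoint of the variable \<open>x\<^sub>i\<close> is \<open>\<Sum>j. H\<^sub>i\<^sub>j \<partial>\<^sub>j\<close>. As \<open>H\<close> is invertible, the derivatives are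
  combinations of these operators, and so their adjoints are linear forms in the variables.\<close>

lemma weyl_adjoint:
  assumes "P \<in> weyl n"
  shows "\<exists>Q\<in>weyl n. \<forall>p\<in>polys n. \<forall>q\<in>polys n. ip (P p) q = ip p (Q q)"
  using assms
proof (induction rule: weyl_induct)
  case (const c)
  show ?case by (rule bexI[of _ "mulop n (const (cnj c))"]) (simp_all add: mulop_def ip_const_left ip_const_right weyl_const[unfolded mulop_def])
next
  case (var i)
  let ?Q = "\<lambda>p\<in>polys n. \<Sum>j<n. compose (polys n) (mulop n (const (H $$ (i, j)))) (\<lambda>p\<in>polys n. partial j p) p"
  have "?Q \<in> weyl n" by (intro weyl_sum weyl_compose weyl_partial weyl_const) auto
  then show ?case
    using var by (intro bexI[of _ ?Q]) (auto simp: compose_def mulop_def ip_var_left ip_sum_right ip_const_right)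
next
  case (partial i)
  obtain K where K: "K \<in> carrier_mat n n" "K * H = 1\<^sub>m n" by (rule H_invertible)
  let ?Q = "\<lambda>p\<in>polys n. \<Sum>k<n. compose (polys n) (mulop n (const (cnj (K $$ (i, k))))) (mulop n (var k)) p"
  have "?Q \<in> weyl n" by (intro weyl_sum weyl_compose weyl_var weyl_const) auto
  moreover have "ip (partial i p) q = ip p (?Q q)" if pq: "p \<in> polys n" "q \<in> polys n" for p q
  proof -
    have "(\<Sum>k<n. K $$ (i, k) * H $$ (k, j)) = (if i = j then 1 else 0)" if "j < n" for j
    proof -
      have "(K * H) $$ (i, j) = (\<Sum>k<n. K $$ (i, k) * H $$ (k, j))"
        using K(1) partial that carrier_matD[OF H_carrier] by (simp add: scalar_prod_def atLeast0LessThan)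
      then show ?thesis using K(2) partial that by simp
    qed
    then have "ip q (partial i p) = (\<Sum>j<n. (\<Sum>k<n. K $$ (i, k) * H $$ (k, j)) * ip q (partial j p))"
      using partial by (simp add: if_distrib[of "\<lambda>x. x * _"] cong: if_cong)
    also have "\<dots> = (\<Sum>k<n. K $$ (i, k) * ip (var k * q) p)"
      using pq by (simp add: ip_var_left sum_distrib_left sum_distrib_right mult.assoc) (rule sum.swap)
    finally have "ip (partial i p) q = (\<Sum>k<n. cnj (K $$ (i, k)) * ip p (var k * q))"
      using pq ip_sym[of q "partial i p"] ip_sym[of "var _ * q" p] by (simp add: cnj_sum)
    then show ?thesis using pq by (simp add: compose_def mulop_def ip_sum_right ip_const_right)
  qed
  ultimately show ?case by (intro bexI[of _ ?Q]) auto
next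
  case (add P Q)
  then obtain P' Q' where *: "P' \<in> weyl n" "Q' \<in> weyl n" "\<forall>p\<in>polys n. \<forall>q\<in>polys n. ip (P p) q = ip p (P' q)"
    "\<forall>p\<in>polys n. \<forall>q\<in>polys n. ip (Q p) q = ip p (Q' q)" by blast
  then show ?case by (intro bexI[of _ "\<lambda>p\<in>polys n. P' p + Q' p"]) (auto simp: weyl_plus ip_add_left ip_add_right)
next
  case (compose P Q)
  then obtain P' Q' where *: "P' \<in> weyl n" "Q' \<in> weyl n" "\<forall>p\<in>polys n. \<forall>q\<in>polys n. ip (P p) q = ip p (P' q)"
    "\<forall>p\<in>polys n. \<forall>q\<in>polys n. ip (Q p) q = ip p (Q' q)" by blast
  then show ?case
    using compose.hyps by (intro bexI[of _ "compose (polys n) Q' P'"])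
      (auto simp: weyl_compose weyl_End, simp add: compose_def weyl_End)
qed

text \<open>Invariance of the form makes the adjoint of an invariant operator invariant. Since the Euler
  operator is self-adjoint, taking adjoints reverses the sign in \<open>[euler, P] = k P\<close>.\<close>

lemma D_adjoint:
  assumes "P \<in> \<D>"
  obtains Q where "Q \<in> \<D>" "\<And>p q. p \<in> polys n \<Longrightarrow> q \<in> polys n \<Longrightarrow> ip (P p) q = ip p (Q q)"
    "\<And>p q. p \<in> polys n \<Longrightarrow> q \<in> polys n \<Longrightarrow> ip (Q p) q = ip p (P q)"
    "\<And>k. P \<in> \<D>deg k \<Longrightarrow> Q \<in> \<D>deg (- k)"
proof -
  obtain Q where Q: "Q \<in> weyl n" "\<And>p q. p \<in> polys n \<Longrightarrow> q \<in> polys n \<Longrightarrow> ip (P p) q = ip p (Q q)"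
    using weyl_adjoint[OF D_weyl[OF assms]] by blast
  have Qp: "Q p \<in> polys n" if "p \<in> polys n" for p using that Q(1) weyl_End by auto
  have Q': "ip (Q p) q = ip p (P q)" if "p \<in> polys n" "q \<in> polys n" for p q
    using Q(2)[OF that(2,1)] ip_sym[of "P q" p] ip_sym[of q "Q p"] that assms Qp by simp
  have "act n g (Q q) = Q (act n g q)" if "g \<in> G" "q \<in> polys n" for g q
  proof (rule ip_separates)
    fix r assume r: "r \<in> polys n"
    let ?r = "act n (ginv g) r"
    have "ip r (act n g (Q q)) = ip ?r (Q q)"
      using ip_act[OF that(1), of ?r "Q q"] that r Qp by (simp add: act_ginv)
    also have "\<dots> = ip (act n g (P ?r)) (act n g q)"
      using Q(2)[of ?r q] that r assms by (simp add: ip_act)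
    also have "act n g (P ?r) = P r" using assms that r by (simp add: D_iff act_ginv)
    finally show "ip r (act n g (Q q)) = ip r (Q (act n g q))" using Q(2) r that by simp
  qed (use that Qp in auto)
  then have QD: "Q \<in> \<D>" using Q(1) by (simp add: D_iff)
  moreover have "Q \<in> \<D>deg (- k)" if "P \<in> \<D>deg k" for k
  proof -
    have "euler n (Q q) - Q (euler n q) = of_int (- k) * Q q" if q: "q \<in> polys n" for q
    proof (rule ip_separates)
      fix r assume r: "r \<in> polys n"
      have e: "euler n (P r) = P (euler n r) + of_int k * P r"
        using \<open>P \<in> \<D>deg k\<close> r by (simp add: inv_ops_deg_def diff_eq_eq add.commute)
      have "ip r (euler n (Q q) - Q (euler n q)) = ip (P (euler n r)) q - ip (euler n (P r)) q"
        using q r assms Q Qp by (simp add: ip_diff_right ip_euler_right) (simp flip: Q(2), simp add: ip_euler_right)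
      also have "\<dots> = - (of_int k * ip (P r) q)"
        unfolding e by (simp add: ip_add_left const_of_int[symmetric] ip_const_left)
      also have "\<dots> = ip r (of_int (- k) * Q q)"
        using q r Q by (simp only: const_of_int[symmetric] ip_const_right of_int_minus) simp
      finally show "ip r (euler n (Q q) - Q (euler n q)) = ip r (of_int (- k) * Q q)" .
    qed (use q Qp in auto)
    then show ?thesis using QD by (simp add: inv_ops_deg_def)
  qed
  ultimately show ?thesis using that Q(2) Q' by blast
qed

end

section \<open>Stable subspaces\<close>

interpretation mp: vector_space "\<lambda>c p. const c * p :: mpoly"
  by unfold_locales (simp_all add: distrib_left distrib_right const_add const_mult mult.assoc)

lemma finite_bounded_monomials: "finite {m. keys m \<subseteq> {..<n} \<and> tdeg n m \<le> d}"
proof -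
  let ?M = "{m. keys m \<subseteq> {..<n} \<and> tdeg n m \<le> d}"
  have "inj_on (\<lambda>m. restrict (lookup m) {..<n}) ?M"
  proof (rule inj_onI, rule poly_mapping_eqI)
    fix a b i assume *: "a \<in> ?M" "b \<in> ?M" "restrict (lookup a) {..<n} = restrict (lookup b) {..<n}"
    show "lookup a i = lookup b i"
    proof (cases "i < n")
      case True
      then show ?thesis using fun_cong[OF *(3), of i] by simp
    next
      case False
      then have "i \<notin> keys a" "i \<notin> keys b" using * by auto
      then show ?thesis by (simp add: in_keys_iff)
    qed
  qed
  moreover have "(\<lambda>m. restrict (lookup m) {..<n}) ` ?M \<subseteq> {..<n} \<rightarrow>\<^sub>E {..d}"
  proof (intro image_subsetI PiE_I)
    fix m i assume "m \<in> ?M" "i \<in> {..<n}"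
    then have "lookup m i \<le> tdeg n m" unfolding tdeg_def by (intro member_le_sum) auto
    then show "restrict (lookup m) {..<n} i \<in> {..d}" using \<open>m \<in> ?M\<close> \<open>i \<in> {..<n}\<close> by simp
  qed auto
  ultimately show ?thesis
    by (meson finite_PiE finite_atMost finite_imageD finite_lessThan finite_subset)
qed

definition bounded_monomials :: "nat \<Rightarrow> nat \<Rightarrow> mpoly set"
  where "bounded_monomials n d = (\<lambda>m. single m 1) ` {m. keys m \<subseteq> {..<n} \<and> tdeg n m \<le> d}"

lemma finite_monomials: "finite (bounded_monomials n d)"
  unfolding bounded_monomials_def using finite_bounded_monomials by blast

lemma bounded_degree_span:
  assumes "p \<in> polys n" "\<And>m. m \<in> keys p \<Longrightarrow> tdeg n m \<le> d"
  shows "p \<in> mp.span (bounded_monomials n d)"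
proof -
  have "(\<Sum>m\<in>keys p. const (lookup p m) * single m 1) \<in> mp.span (bounded_monomials n d)"
    using assms by (intro mp.span_sum mp.span_scale mp.span_base) (auto simp: bounded_monomials_def polys_def)
  then show ?thesis by (simp add: sum_singles flip: single_conv_const)
qed

lemma finite_basis:
  assumes "mp.subspace N" "N \<subseteq> mp.span T" "finite T"
  obtains B where "finite B" "mp.independent B" "mp.span B = N" "card B = mp.dim N" "B \<subseteq> N"
proof -
  obtain B where B: "B \<subseteq> N" "mp.independent B" "N \<subseteq> mp.span B" "card B = mp.dim N"
    by (rule mp.basis_exists)
  have "mp.span B = N" using B(1,3) assms(1) by (rule mp.span_subspace)
  moreover have "finite B" using mp.independent_span_bound[OF assms(3) B(2)] B(1) assms(2) by blast
  ultimately show ?thesis using that B by blast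
qed

lemma dim_strict_mono:
  assumes "mp.subspace M" "mp.subspace N" "N \<subseteq> mp.span T" "finite T" "M \<subset> N"
  shows "mp.dim M < mp.dim N"
proof -
  obtain B where B: "finite B" "mp.independent B" "mp.span B = M" "card B = mp.dim M" "B \<subseteq> M"
    using finite_basis[of M T] assms by blast
  obtain C where C: "finite C" "mp.span C = N" "card C = mp.dim N"
    using finite_basis[OF assms(2,3,4)] by metis
  obtain u where u: "u \<in> N" "u \<notin> M" using assms(5) by blast
  then have "mp.independent (insert u B)" using B mp.independent_insertI by blast
  then have "card (insert u B) \<le> card C"
    using mp.independent_span_bound[OF C(1)] C(2) B(5) u(1) assms(5) by blast
  moreover have "u \<notin> B" using B(5) u(2) by blast
  ultimately show ?thesis using B(1,4) C(3) by simp
qed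

context finite_linear_group
begin

lemma orthogonal_span:
  assumes "\<And>t. t \<in> T \<Longrightarrow> ip t q = 0" "t \<in> mp.span T"
  shows "ip t q = 0"
  using assms(2)
proof (induction rule: mp.span_induct)
  case base
  show ?case by (auto simp: mp.subspace_def ip_add_left ip_const_left)
qed (use assms in auto)

lemma span_polys: "T \<subseteq> polys n \<Longrightarrow> mp.span T \<subseteq> polys n"
  by (rule mp.span_minimal) (auto simp: mp.subspace_def)

lemma projection_span:
  assumes "finite T" "T \<subseteq> polys n" "p \<in> polys n"
  shows "\<exists>u\<in>mp.span T. \<forall>t\<in>T. ip t (p - u) = 0"
  using assms
proof (induction T arbitrary: p)
  case (insert t T)
  have sp: "mp.span T \<subseteq> polys n" using insert.prems span_polys by auto
  have sub: "mp.span T \<subseteq> mp.span (insert t T)" by (rule mp.span_mono) auto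
  obtain u where u: "u \<in> mp.span T" "\<And>s. s \<in> T \<Longrightarrow> ip s (p - u) = 0" using insert by blast
  obtain v where v: "v \<in> mp.span T" "\<And>s. s \<in> T \<Longrightarrow> ip s (t - v) = 0" using insert by blast
  \<comment> \<open>Gram-Schmidt: \<open>t - v\<close> is the part of \<open>t\<close> orthogonal to the span of \<open>T\<close>\<close>
  define c where "c = ip (t - v) (p - u) / ip (t - v) (t - v)"
  define w where "w = u + const c * (t - v)"
  have tv: "t - v \<in> polys n" using insert.prems v(1) sp by auto
  have "w \<in> mp.span (insert t T)"
    unfolding w_def using u(1) v(1) sub
    by (intro mp.span_add mp.span_scale mp.span_diff) (auto intro: mp.span_base)
  moreover have s: "ip s (p - w) = 0" if "s \<in> T" for s
    using u(2)[OF that] v(2)[OF that] by (simp add: w_def ip_diff_right ip_add_right ip_const_right)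
  moreover have "ip t (p - w) = 0"
  proof -
    have "ip v (p - w) = 0" using orthogonal_span[OF s v(1)] by blast
    moreover have "ip (t - v) (p - w) = 0"
    proof (cases "ip (t - v) (t - v) = 0")
      case True
      then have "t - v = 0" using ip_definite[OF tv] by blast
      then show ?thesis by (simp only: ip_0)
    next
      case False
      have "p - w = (p - u) - const c * (t - v)" by (simp add: w_def)
      then have "ip (t - v) (p - w) = ip (t - v) (p - u) - c * ip (t - v) (t - v)"
        by (simp only: ip_diff_right[of _ "p - u"] ip_const_right)
      then show ?thesis using False by (simp add: c_def)
    qed
    ultimately show ?thesis by (simp add: ip_diff_left)
  qed
  ultimately show ?case by blast
qed (auto intro: mp.span_zero)

lemma projection:
  assumes "mp.subspace N" "N \<subseteq> mp.span T" "finite T" "N \<subseteq> polys n" "p \<in> polys n"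
  obtains u where "u \<in> N" "\<And>v. v \<in> N \<Longrightarrow> ip v (p - u) = 0"
proof -
  obtain B where B: "finite B" "mp.span B = N" "B \<subseteq> N" using finite_basis[OF assms(1,2,3)] by metis
  obtain u where "u \<in> mp.span B" "\<forall>t\<in>B. ip t (p - u) = 0"
    using projection_span[OF B(1), of p] B(3) assms(4,5) by blast
  then show ?thesis using that[of u] orthogonal_span[of B "p - u"] B(2) by blast
qed

text \<open>Both kinds of submodules are sets of this form: \<open>S\<close> consists of all invariant operators for
  submodules over \<open>\<D>\<close>, and of those of degree \<open>0\<close> for submodules over the quotient ring.\<close>

definition stable :: "(mpoly \<Rightarrow> mpoly) set \<Rightarrow> mpoly set \<Rightarrow> bool"
  where "stable S N \<longleftrightarrow> N \<subseteq> polys n \<and> 0 \<in> N \<and> (\<forall>x\<in>N. \<forall>y\<in>N. x + y \<in> N) \<and> (\<forall>P\<in>S. \<forall>x\<in>N. P x \<in> N)"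

lemma stable_polys: "stable S N \<Longrightarrow> x \<in> N \<Longrightarrow> x \<in> polys n"
  and stable_0: "stable S N \<Longrightarrow> 0 \<in> N"
  and stable_add: "stable S N \<Longrightarrow> x \<in> N \<Longrightarrow> y \<in> N \<Longrightarrow> x + y \<in> N"
  and stable_op: "stable S N \<Longrightarrow> P \<in> S \<Longrightarrow> x \<in> N \<Longrightarrow> P x \<in> N"
  by (auto simp: stable_def)

lemma stable_D_D0: "stable \<D> N \<Longrightarrow> stable (\<D>deg 0) N"
  using Ddeg_D by (auto simp: stable_def)

lemma stable_const:
  assumes "stable (\<D>deg 0) N" "x \<in> N"
  shows "const c * x \<in> N"
  using stable_op[OF assms(1) Ddeg_const assms(2), of c] stable_polys[OF assms] by (simp add: mulop_def)

lemma stable_minus: "stable (\<D>deg 0) N \<Longrightarrow> x \<in> N \<Longrightarrow> - x \<in> N"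
  using stable_const[of N x "-1"] by (simp add: const_minus)

lemma stable_diff: "stable (\<D>deg 0) N \<Longrightarrow> x \<in> N \<Longrightarrow> y \<in> N \<Longrightarrow> x - y \<in> N"
  using stable_add[of "\<D>deg 0" N x "- y"] stable_minus by simp

lemma stable_subspace: "stable (\<D>deg 0) N \<Longrightarrow> mp.subspace N"
  by (auto simp: mp.subspace_def stable_const stable_add stable_0)

lemma stable_sum: "stable S N \<Longrightarrow> (\<And>a. a \<in> A \<Longrightarrow> f a \<in> N) \<Longrightarrow> sum f A \<in> N"
  by (induction A rule: infinite_finite_induct) (auto simp: stable_0 stable_add)

text \<open>A stable subspace is graded: the Euler operator acts on it, and the projections onto its
  eigenspaces are polynomials in it (Lagrange interpolation).\<close>

lemma stable_hpart:
  assumes N: "stable (\<D>deg 0) N" and x: "x \<in> N"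
  shows "hpart n d x \<in> N"
proof -
  obtain M where M: "x = (\<Sum>d<M. hpart n d x)" "\<And>d. d \<ge> M \<Longrightarrow> hpart n d x = 0" using hpart_sum by blast
  have deg: "tdeg n m < M" if "m \<in> keys x" for m
    using M(2)[of "tdeg n m"] lookup_hpart[of n "tdeg n m" x m] that by (cases "tdeg n m < M") (auto simp: in_keys_iff)
  have "\<exists>y\<in>N. \<forall>m. lookup y m = (\<Prod>e\<in>A. of_nat (tdeg n m) - of_nat e) * lookup x m" if "finite A" for A :: "nat set"
    using that
  proof (induction A)
    case (insert e A)
    then obtain y where y: "y \<in> N" "\<forall>m. lookup y m = (\<Prod>e\<in>A. of_nat (tdeg n m) - of_nat e) * lookup x m" by blast
    have "euler n y \<in> N" using stable_op[OF N Ddeg_euler y(1)] stable_polys[OF N y(1)] by simp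
    then have "euler n y - const (of_nat e) * y \<in> N" using stable_diff[OF N] stable_const[OF N y(1)] by blast
    moreover have "lookup (euler n y - const (of_nat e) * y) m =
        (\<Prod>e\<in>insert e A. of_nat (tdeg n m) - of_nat e) * lookup x m" for m
      by (simp only: lookup_minus lookup_euler lookup_const_mult y(2)[rule_format] prod.insert[OF insert.hyps] left_diff_distrib mult.assoc)
    ultimately show ?case by blast
  qed (use x in auto)
  from this[of "{..<M} - {d}"] obtain y
    where y: "y \<in> N" "\<forall>m. lookup y m = (\<Prod>e\<in>{..<M} - {d}. of_nat (tdeg n m) - of_nat e) * lookup x m" by auto
  define c :: complex where "c = (\<Prod>e\<in>{..<M} - {d}. of_nat d - of_nat e)"
  have c: "c \<noteq> 0" by (auto simp: c_def)
  have "hpart n d x = const (1 / c) * y"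
  proof (rule poly_mapping_eqI)
    fix m
    show "lookup (hpart n d x) m = lookup (const (1 / c) * y) m"
    proof (cases "tdeg n m = d \<or> m \<notin> keys x")
      case True
      then show ?thesis using c y(2) by (auto simp: lookup_hpart c_def in_keys_iff)
    next
      case False
      then have "tdeg n m \<in> {..<M} - {d}" using deg by auto
      then have "(\<Prod>e\<in>{..<M} - {d}. of_nat (tdeg n m) - of_nat e :: complex) = 0"
        by (intro prod_zero) auto
      then show ?thesis using False y(2) by (simp add: lookup_hpart)
    qed
  qed
  then show ?thesis using stable_const[OF N y(1)] by simp
qed

lemma stable_homog_part: "stable (\<D>deg 0) N \<Longrightarrow> stable (\<D>deg 0) (N \<inter> homog n d)"
  unfolding stable_def using weyl_deg_homog(1)[of _ n 0 _ d] by (auto simp: homog_add Ddeg_iff)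

lemma stable_homog_subset:
  assumes "stable (\<D>deg 0) M" "stable (\<D>deg 0) N" "\<And>d. N \<inter> homog n d \<subseteq> M"
  shows "N \<subseteq> M"
proof
  fix x assume x: "x \<in> N"
  obtain K where K: "x = (\<Sum>d<K. hpart n d x)" using hpart_sum by blast
  have "hpart n d x \<in> M" for d
    using stable_hpart[OF assms(2) x] hpart_homog[OF stable_polys[OF assms(2) x]] assms(3) by blast
  then show "x \<in> M" by (subst K) (rule stable_sum[OF assms(1)])
qed

lemma homog_span: "homog n d \<subseteq> mp.span (bounded_monomials n d)"
  using bounded_degree_span[of _ n d] by (auto simp: homog_alt)

lemma ring_inv_ops: "ring (inv_ops n G)"
proof -
  interpret ring "End_ring n" by (rule ring_End)
  have minus: "\<ominus>\<^bsub>End_ring n\<^esub> P = compose (polys n) (mulop n (const (- 1))) P" if "P \<in> \<D>" for P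
  proof (rule minus_equality)
    show "compose (polys n) (mulop n (const (- 1))) P \<oplus>\<^bsub>End_ring n\<^esub> P = \<zero>\<^bsub>End_ring n\<^esub>"
      using that by (auto simp: compose_def mulop_def const_minus intro!: restrict_ext)
  qed (use that D_End in \<open>auto intro!: End_compose mulop_End\<close>)
  have "subring \<D> (End_ring n)"
  proof (rule subringI)
    show "\<D> \<subseteq> carrier (End_ring n)" using D_End by blast
    show "\<one>\<^bsub>End_ring n\<^esub> \<in> \<D>" unfolding End_ops by (rule D_1)
    show "\<And>P. P \<in> \<D> \<Longrightarrow> \<ominus>\<^bsub>End_ring n\<^esub> P \<in> \<D>" unfolding minus using D_compose Ddeg_D[OF Ddeg_const] by blast
    show "\<And>P Q. P \<in> \<D> \<Longrightarrow> Q \<in> \<D> \<Longrightarrow> P \<otimes>\<^bsub>End_ring n\<^esub> Q \<in> \<D>" unfolding End_ops by (rule D_compose)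
    show "\<And>P Q. P \<in> \<D> \<Longrightarrow> Q \<in> \<D> \<Longrightarrow> P \<oplus>\<^bsub>End_ring n\<^esub> Q \<in> \<D>" unfolding End_ops by (rule D_plus)
  qed
  from subring_is_ring[OF this] show ?thesis by (simp add: inv_ops_def)
qed

lemma inv_ops_ops [simp]:
  "P \<otimes>\<^bsub>inv_ops n G\<^esub> Q = compose (polys n) P Q"
  "P \<oplus>\<^bsub>inv_ops n G\<^esub> Q = (\<lambda>p\<in>polys n. P p + Q p)"
  "\<one>\<^bsub>inv_ops n G\<^esub> = (\<lambda>p\<in>polys n. p)"
  "\<zero>\<^bsub>inv_ops n G\<^esub> = (\<lambda>p\<in>polys n. 0)"
  by (simp_all add: inv_ops_def)

lemma inv_ops_minus:
  assumes "P \<in> \<D>" "p \<in> polys n"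
  shows "(\<ominus>\<^bsub>inv_ops n G\<^esub> P) p = - P p"
proof -
  interpret ring "inv_ops n G" by (rule ring_inv_ops)
  have "(\<ominus>\<^bsub>inv_ops n G\<^esub> P \<oplus>\<^bsub>inv_ops n G\<^esub> P) p = 0"
    unfolding l_neg[OF assms(1)] using assms(2) by simp
  then show ?thesis using assms(2) by (simp add: eq_neg_iff_add_eq_0)
qed

lemma inv_ops_minus_compose:
  assumes "P \<in> \<D>"
  shows "\<ominus>\<^bsub>inv_ops n G\<^esub> P = compose (polys n) (mulop n (const (- 1))) P"
proof (rule End_eqI)
  interpret ring "inv_ops n G" by (rule ring_inv_ops)
  show "\<ominus>\<^bsub>inv_ops n G\<^esub> P \<in> carrier (End_ring n)" using assms D_End by blast
  show "compose (polys n) (mulop n (const (- 1))) P \<in> carrier (End_ring n)"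
    using assms D_End by (intro End_compose mulop_End) auto
qed (use assms in \<open>simp add: inv_ops_minus compose_def mulop_def const_minus\<close>)

lemma inv_ops_neg_induct [consumes 1, case_names zero deg add]:
  assumes "P \<in> inv_ops_neg n G" and z: "X (\<lambda>p\<in>polys n. 0)"
    and d: "\<And>k P. k < 0 \<Longrightarrow> P \<in> \<D>deg k \<Longrightarrow> X P"
    and a: "\<And>P Q. P \<in> inv_ops_neg n G \<Longrightarrow> Q \<in> inv_ops_neg n G \<Longrightarrow> X P \<Longrightarrow> X Q \<Longrightarrow> X (\<lambda>p\<in>polys n. P p + Q p)"
  shows "X P"
  using assms(1) unfolding inv_ops_neg_def
proof (induction rule: generate.induct)
  case (inv h)
  then obtain k where k: "k < 0" "h \<in> \<D>deg k" by auto
  have "compose (polys n) (mulop n (const (- 1))) h \<in> \<D>deg k"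
    using Ddeg_compose[OF Ddeg_const k(2)] by simp
  then show ?case using d[OF k(1)] inv_ops_minus_compose[OF Ddeg_D[OF k(2)]] by (simp add: a_inv_def)
next
  case (eng P Q)
  have e: "P \<otimes>\<^bsub>add_monoid (inv_ops n G)\<^esub> Q = (\<lambda>p\<in>polys n. P p + Q p)" by simp
  show ?case unfolding e using eng a[of P Q] by (simp only: inv_ops_neg_def)
next
  case one
  have e: "\<one>\<^bsub>add_monoid (inv_ops n G)\<^esub> = (\<lambda>p\<in>polys n. 0)" by simp
  show ?case unfolding e by (rule z)
qed (use d in auto)

lemma ann_iff:
  assumes "N \<subseteq> polys n"
  shows "x \<in> ann n G N \<longleftrightarrow> x \<in> N \<and> (\<forall>k<0. \<forall>P\<in>\<D>deg k. P x = 0)"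
proof -
  have "P x = 0" if "\<forall>k<0. \<forall>P\<in>\<D>deg k. P x = 0" "x \<in> N" "P \<in> inv_ops_neg n G" for P
    using that(3) by (induction rule: inv_ops_neg_induct) (use that(1,2) assms in auto)
  moreover have "P \<in> inv_ops_neg n G" if "k < 0" "P \<in> \<D>deg k" for k P
    unfolding inv_ops_neg_def using that by (intro generate.incl) auto
  ultimately show ?thesis by (auto simp: ann_def)
qed

abbreviation "Bann \<equiv> ann n G (polys n)"

lemma ann_inter: "N \<subseteq> polys n \<Longrightarrow> ann n G N = N \<inter> Bann"
  by (auto simp: ann_def)

lemma Bann_polys: "x \<in> Bann \<Longrightarrow> x \<in> polys n" by (simp add: ann_def)

lemma Bann_neg: "x \<in> Bann \<Longrightarrow> k < 0 \<Longrightarrow> P \<in> \<D>deg k \<Longrightarrow> P x = 0"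
  using ann_iff[of "polys n" x] by auto

lemma stable_Bann: "stable (\<D>deg 0) Bann"
proof -
  have "P x \<in> Bann" if "P \<in> \<D>deg 0" "x \<in> Bann" for P x
  proof -
    have "Q (P x) = 0" if "k < 0" "Q \<in> \<D>deg k" for k Q
    proof -
      have "compose (polys n) Q P \<in> \<D>deg k" using Ddeg_compose[OF that(2) \<open>P \<in> \<D>deg 0\<close>] by simp
      from Bann_neg[OF \<open>x \<in> Bann\<close> that(1) this] show ?thesis
        using Bann_polys[OF \<open>x \<in> Bann\<close>] by (simp add: compose_def)
    qed
    then show ?thesis using that Ddeg_D Bann_polys by (auto simp: ann_iff)
  qed
  moreover have "0 \<in> Bann" by (auto simp: ann_iff intro: End_0 Ddeg_D D_End)
  moreover have "x + y \<in> Bann" if "x \<in> Bann" "y \<in> Bann" for x y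
  proof -
    have "P (x + y) = 0" if "k < 0" "P \<in> \<D>deg k" for k P
      using Bann_neg[OF \<open>x \<in> Bann\<close> that] Bann_neg[OF \<open>y \<in> Bann\<close> that]
        D_add[OF Ddeg_D[OF that(2)] Bann_polys[OF \<open>x \<in> Bann\<close>] Bann_polys[OF \<open>y \<in> Bann\<close>]] by simp
    then show ?thesis using Bann_polys[OF that(1)] Bann_polys[OF that(2)] by (auto simp: ann_iff)
  qed
  ultimately show ?thesis by (auto simp: stable_def Bann_polys)
qed

lemma stable_inter: "stable S M \<Longrightarrow> stable S N \<Longrightarrow> stable S (M \<inter> N)"
  by (auto simp: stable_def)

lemma stable_ann: "stable (\<D>deg 0) N \<Longrightarrow> stable (\<D>deg 0) (ann n G N)"
  using stable_inter[of _ N, OF _ stable_Bann] ann_inter[of N] unfolding stable_def[of _ N] by metis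

text \<open>Only the component of degree \<open>0\<close> contributes: components of negative degree kill the first
  argument, and components of positive degree have adjoints that kill the second one.\<close>

lemma D_degree_zero_part:
  assumes "P \<in> \<D>"
  obtains P0 where "P0 \<in> \<D>deg 0" "\<And>w u. w \<in> Bann \<Longrightarrow> u \<in> Bann \<Longrightarrow> ip (P w) u = ip (P0 w) u"
proof -
  obtain K F where F: "finite K" "\<And>k. F k \<in> \<D>deg k" "\<And>p. p \<in> polys n \<Longrightarrow> P p = (\<Sum>k\<in>K. F k p)"
    "\<And>k p. k \<notin> K \<Longrightarrow> p \<in> polys n \<Longrightarrow> F k p = 0"
    by (rule D_graded[OF assms]) blast
  have "ip (P w) u = ip (F 0 w) u" if w: "w \<in> Bann" and u: "u \<in> Bann" for w u
  proof -
    have "ip (F k w) u = 0" if "k \<noteq> 0" for k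
    proof (cases "k < 0")
      case True
      then show ?thesis using Bann_neg[OF w _ F(2)] by simp
    next
      case False
      obtain Q where Q: "Q \<in> \<D>deg (- k)" "\<And>p q. p \<in> polys n \<Longrightarrow> q \<in> polys n \<Longrightarrow> ip (F k p) q = ip p (Q q)"
        using D_adjoint[OF Ddeg_D[OF F(2)]] F(2)[of k] by metis
      then show ?thesis using Bann_neg[OF u, of "- k" Q] that False Bann_polys w u by simp
    qed
    then have "ip (P w) u = (\<Sum>k\<in>K. if k = 0 then ip (F 0 w) u else 0)"
      using F(3) Bann_polys[OF w] by (simp add: ip_sum_left) (intro sum.cong, auto)
    then show ?thesis using F(1,4) Bann_polys[OF w] by auto
  qed
  then show ?thesis using that F(2) by blast
qed

text \<open>Induction on the degree: let \<open>q \<in> N\<close> be homogeneous and orthogonal to \<open>M\<close>. An operator \<open>Q\<close> of negative degree maps \<open>q\<close> into \<open>M\<close> by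
  induction, so the norm of \<open>Q q\<close> is the inner product of \<open>q\<close> with an element of \<open>M\<close> and
  vanishes. Hence \<open>q\<close> is annihilated by all such \<open>Q\<close>, lies in \<open>M\<close>, and is orthogonal to itself.\<close>

lemma ann_generates:
  assumes N: "stable \<D> N" and M: "stable \<D> M" and sub: "M \<subseteq> N" "ann n G N \<subseteq> M"
  shows "N = M"
proof -
  note N0 = stable_D_D0[OF N] and M0 = stable_D_D0[OF M]
  have "N \<inter> homog n d \<subseteq> M" for d
  proof (induction d rule: less_induct)
    case (less d)
    show ?case
    proof
      fix p assume p: "p \<in> N \<inter> homog n d"
      have Md: "stable (\<D>deg 0) (M \<inter> homog n d)" using stable_homog_part[OF M0] .
      obtain u where u: "u \<in> M \<inter> homog n d" "\<And>v. v \<in> M \<inter> homog n d \<Longrightarrow> ip v (p - u) = 0"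
      proof (rule projection[OF stable_subspace[OF Md] _ finite_monomials])
        show "M \<inter> homog n d \<subseteq> mp.span (bounded_monomials n d)" using homog_span by blast
        show "M \<inter> homog n d \<subseteq> polys n" using stable_polys[OF M] by blast
        show "p \<in> polys n" using stable_polys[OF N] p by blast
      qed blast
      define q where "q = p - u"
      have q: "q \<in> N" "q \<in> homog n d" "q \<in> polys n"
        unfolding q_def using p u(1) sub(1) stable_diff[OF N0] homog_diff[of p n d u]
          stable_polys[OF N] by auto
      have "Q q = 0" if k: "k < 0" "Q \<in> \<D>deg k" for k Q
      proof (cases "0 \<le> int d + k")
        case False
        then show ?thesis using weyl_deg_homog(2)[of Q n k q d] k q by (simp add: Ddeg_iff)
      next
        case True
        note QD = Ddeg_D[OF k(2)]
        have "Q q \<in> homog n (nat (int d + k))"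
          using weyl_deg_homog(1)[of Q n k q d] k q True by (simp add: Ddeg_iff)
        moreover have "Q q \<in> N" using stable_op[OF N QD q(1)] .
        moreover have "nat (int d + k) < d" using k(1) True by linarith
        ultimately have Qq: "Q q \<in> M" using less.IH by blast
        obtain R where R: "R \<in> \<D>" "\<And>p q. p \<in> polys n \<Longrightarrow> q \<in> polys n \<Longrightarrow> ip (R p) q = ip p (Q q)"
            "R \<in> \<D>deg (- k)"
          using D_adjoint[OF QD] k(2) by metis
        have RQ: "R (Q q) \<in> M" using stable_op[OF M R(1) Qq] .
        have "compose (polys n) R Q \<in> \<D>deg 0" using Ddeg_compose[OF R(3) k(2)] by simp
        then have "R (Q q) \<in> homog n d"
          using weyl_deg_homog(1)[of "compose (polys n) R Q" n 0 q d] q by (simp add: Ddeg_iff compose_def)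
        with RQ have "ip (R (Q q)) q = 0" using u(2) by (simp add: q_def)
        then have "ip (Q q) (Q q) = 0" using R(2) q QD by simp
        then show ?thesis using ip_definite q QD by simp
      qed
      then have "q \<in> M" using sub(2) ann_iff[of N q] q stable_polys[OF N] by blast
      then show "p \<in> M" using stable_add[OF M, of q u] u(1) by (simp add: q_def)
    qed
  qed
  then have "N \<subseteq> M" by (rule stable_homog_subset[OF M0 N0])
  with sub(1) show ?thesis by blast
qed

subsection \<open>Finite dimension of the annihilated vectors\<close>

text \<open>The coefficient of \<open>t^(card G - k)\<close> in \<open>\<Prod>h\<in>G. (t - h x\<^sub>i)\<close>. It is invariant since \<open>G\<close> permutes the
  factors.\<close>

definition orbit_coeff :: "nat \<Rightarrow> nat \<Rightarrow> mpoly"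
  where "orbit_coeff i k = (\<Sum>X\<in>{X. X \<subseteq> G \<and> card X = k}. \<Prod>h\<in>X. - act n h (var i))"

lemma orbit_coeff_homog:
  assumes "i < n"
  shows "orbit_coeff i k \<in> homog n k"
proof -
  have "(\<Prod>h\<in>X. - act n h (var i)) \<in> homog n k" if "X \<subseteq> G" "card X = k" for X
    using homog_prod[of X "\<lambda>h. - act n h (var i)" n "\<lambda>_. 1"] that finite_subset[OF _ finite_G]
      homog_minus[OF act_homog[OF homog_var[OF assms]]] by simp
  then show ?thesis unfolding orbit_coeff_def by (intro homog_sum) blast
qed

lemma orbit_coeff_invariant:
  assumes "i < n" "g \<in> G"
  shows "act n g (orbit_coeff i k) = orbit_coeff i k"
proof -
  let ?S = "{X. X \<subseteq> G \<and> card X = k}"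
  have inj: "inj_on (\<lambda>h. g * h) X" if "X \<subseteq> G" "g \<in> G" for X g
    by (rule inj_on_subset[OF bij_betw_imp_inj_on[OF bij_G_mult_left[OF that(2)]] that(1)])
  have inv_img: "(\<lambda>h. ginv g * h) ` (\<lambda>h. g * h) ` X = X" "(\<lambda>h. g * h) ` (\<lambda>h. ginv g * h) ` X = X" if "X \<subseteq> G" for X
  proof -
    have "ginv g * (g * h) = h" "g * (ginv g * h) = h" if "h \<in> G" for h
      using that assms(2) by (simp_all add: assoc_mult_mat[of _ n n _ n _ n, symmetric] ginv G_inv left_mult_one_mat[of _ n n])
    then show "(\<lambda>h. ginv g * h) ` (\<lambda>h. g * h) ` X = X" "(\<lambda>h. g * h) ` (\<lambda>h. ginv g * h) ` X = X"
      unfolding image_image using that by (auto intro!: trans[OF image_cong[OF refl] image_ident])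
  qed
  have "act n g (orbit_coeff i k) = (\<Sum>X\<in>?S. \<Prod>h\<in>X. - act n (g * h) (var i))"
    unfolding orbit_coeff_def act_sum
  proof (rule sum.cong[OF refl])
    fix X assume X: "X \<in> ?S"
    have "act n g (\<Prod>h\<in>X. - act n h (var i)) = (\<Prod>h\<in>X. act n g (- act n h (var i)))"
      by (rule act_prod) (use assms in auto)
    also have "\<dots> = (\<Prod>h\<in>X. - act n (g * h) (var i))"
      by (rule prod.cong[OF refl]) (use assms X in \<open>auto simp: act_minus act_times\<close>)
    finally show "act n g (\<Prod>h\<in>X. - act n h (var i)) = (\<Prod>h\<in>X. - act n (g * h) (var i))" .
  qed
  also have "\<dots> = (\<Sum>X\<in>?S. \<Prod>h\<in>(\<lambda>h. g * h) ` X. - act n h (var i))"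
    by (rule sum.cong[OF refl]) (use inj assms(2) in \<open>auto simp: prod.reindex\<close>)
  also have "\<dots> = (\<Sum>X\<in>?S. \<Prod>h\<in>X. - act n h (var i))"
    by (rule sum.reindex_bij_witness[of _ "\<lambda>X. (\<lambda>h. ginv g * h) ` X" "\<lambda>X. (\<lambda>h. g * h) ` X"])
      (use inv_img inj assms(2) G_inv G_mult in \<open>auto simp: card_image\<close>)
  finally show ?thesis by (simp add: orbit_coeff_def)
qed

text \<open>Substitute \<open>t = x\<^sub>i\<close> in the product: the factor of the identity vanishes.\<close>

lemma orbit_relation:
  assumes "i < n"
  shows "var i ^ card G = - (\<Sum>k\<in>{1..card G}. orbit_coeff i k * var i ^ (card G - k))"
proof -
  have "0 = (\<Prod>h\<in>G. - act n h (var i) + var i)"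
    by (rule sym, rule prod_zero[OF finite_G], rule bexI[OF _ G_one]) (simp add: act_one assms)
  also have "\<dots> = (\<Sum>X\<in>Pow G. (\<Prod>h\<in>X. - act n h (var i)) * var i ^ card (G - X))"
    by (subst prod_add[OF finite_G]) simp
  also have "\<dots> = (\<Sum>k\<in>{0..card G}. \<Sum>X\<in>{X \<in> Pow G. card X = k}. (\<Prod>h\<in>X. - act n h (var i)) * var i ^ card (G - X))"
    by (rule sum.group[symmetric]) (use finite_G in \<open>auto intro: card_mono\<close>)
  also have "\<dots> = (\<Sum>k\<in>{0..card G}. orbit_coeff i k * var i ^ (card G - k))"
    unfolding orbit_coeff_def sum_distrib_right
    by (rule sum.cong[OF refl], rule sum.cong) (auto simp: card_Diff_subset finite_subset[OF _ finite_G])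
  also have "\<dots> = orbit_coeff i 0 * var i ^ card G + (\<Sum>k\<in>{1..card G}. orbit_coeff i k * var i ^ (card G - k))"
    by (simp add: sum.atLeast_Suc_atMost)
  also have "orbit_coeff i 0 = 1"
  proof -
    have "{X. X \<subseteq> G \<and> card X = 0} = {{}}" using finite_subset[OF _ finite_G] by auto
    then show ?thesis by (simp add: orbit_coeff_def)
  qed
  finally show ?thesis by (simp add: eq_neg_iff_add_eq_0)
qed

text \<open>Multiplication by an invariant of positive degree is in \<open>\<D>\<close>, and its adjoint has negative degree.\<close>

lemma Bann_orthogonal_ideal:
  assumes "f \<in> homog n k" "k > 0" "\<And>g. g \<in> G \<Longrightarrow> act n g f = f" "r \<in> polys n" "p \<in> Bann"
  shows "ip (f * r) p = 0"
proof -
  have f: "mulop n f \<in> \<D>deg (int k)" using Ddeg_mulop assms(1,3) by blast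
  obtain Q where Q: "Q \<in> \<D>deg (- int k)" "\<And>p q. p \<in> polys n \<Longrightarrow> q \<in> polys n \<Longrightarrow> ip (mulop n f p) q = ip p (Q q)"
    using D_adjoint[OF Ddeg_D[OF f]] f by metis
  have "ip (mulop n f r) p = ip r (Q p)" using Q(2) assms(4) Bann_polys[OF assms(5)] by blast
  also have "Q p = 0" using Bann_neg[OF assms(5) _ Q(1)] assms(2) by simp
  finally show ?thesis using assms(4) by (simp add: mulop_def)
qed

text \<open>Every monomial of such a large degree is divisible by some \<open>x\<^sub>i ^ card G\<close>.\<close>

lemma Bann_degree_bound:
  assumes p: "p \<in> Bann" "p \<in> homog n d" and d: "d > n * card G"
  shows "p = 0"
proof -
  have "ip (single m 1) p = 0" if "m \<in> keys p" for m
  proof -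
    have m: "keys m \<subseteq> {..<n}" "tdeg n m = d" using p(2) that by (auto simp: homog_alt polys_def)
    have "\<exists>i<n. card G \<le> lookup m i"
    proof (rule ccontr)
      assume "\<not> ?thesis"
      then have "tdeg n m \<le> (\<Sum>i<n. card G)" unfolding tdeg_def by (intro sum_mono) (simp add: not_le less_imp_le)
      then show False using m(2) d by simp
    qed
    then obtain i where i: "i < n" "card G \<le> lookup m i" by blast
    define k where "k = m - single i (card G)"
    have "m = single i (card G) + k"
      by (rule poly_mapping_eqI) (use i(2) in \<open>auto simp: k_def lookup_add lookup_minus lookup_single when_def\<close>)
    moreover have "var i ^ j = single (single i j) 1" for j
      by (induction j) (simp_all add: var_def mult_single single_add[symmetric])
    ultimately have s: "single m 1 = var i ^ card G * single k 1" by (simp add: mult_single)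
    have "k \<in> {k. keys k \<subseteq> {..<n}}" using m(1) \<open>m = _\<close> by (simp add: keys_add_nat)
    then have k: "single k 1 \<in> polys n" by (simp add: polys_single)
    have "ip (orbit_coeff i j * (var i ^ (card G - j) * single k 1)) p = 0" if "j \<in> {1..card G}" for j
      using Bann_orthogonal_ideal[OF orbit_coeff_homog[OF i(1)] _ orbit_coeff_invariant[OF i(1)] _ p(1)] that k i(1)
      by simp
    then show ?thesis
      unfolding s orbit_relation[OF i(1)] by (simp add: ip_minus_left sum_distrib_right ip_sum_left mult.assoc)
  qed
  then have "ip (\<Sum>m\<in>keys p. const (lookup p m) * single m 1) p = 0"
    by (simp add: ip_sum_left ip_const_left)
  then have "ip p p = 0" by (simp add: sum_singles flip: single_conv_const)
  then show ?thesis using ip_definite Bann_polys[OF p(1)] by blast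
qed

lemma Bann_span: "Bann \<subseteq> mp.span (bounded_monomials n (n * card G))"
proof
  fix p assume p: "p \<in> Bann"
  show "p \<in> mp.span (bounded_monomials n (n * card G))"
  proof (rule bounded_degree_span[OF Bann_polys[OF p]])
    fix m assume m: "m \<in> keys p"
    show "tdeg n m \<le> n * card G"
    proof (rule ccontr)
      assume "\<not> ?thesis"
      then have "hpart n (tdeg n m) p = 0"
        using Bann_degree_bound[OF stable_hpart[OF stable_Bann p] hpart_homog[OF Bann_polys[OF p]]] by simp
      then show False using m lookup_hpart[of n "tdeg n m" p m] by (simp add: in_keys_iff)
    qed
  qed
qed

lemma Bann_finite_dim: "finite_dim Bann"
proof -
  obtain B where "finite B" "mp.span B = Bann"
    using finite_basis[OF stable_subspace[OF stable_Bann] Bann_span finite_monomials] by metis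
  then show ?thesis unfolding finite_dim_def by metis
qed

lemma Bann_projection:
  assumes "stable (\<D>deg 0) W" "W \<subseteq> Bann" "p \<in> polys n"
  obtains u where "u \<in> W" "\<And>v. v \<in> W \<Longrightarrow> ip v (p - u) = 0"
  using projection[OF stable_subspace[OF assms(1)] _ finite_monomials _ assms(3), of n "n * card G"]
    assms(2) Bann_span stable_polys[OF assms(1)] by (metis subset_iff)

subsection \<open>Semisimplicity\<close>

definition minimal_stable :: "mpoly set \<Rightarrow> bool"
  where "minimal_stable N \<longleftrightarrow> stable (\<D>deg 0) N \<and> N \<noteq> {0} \<and>
    (\<forall>M. stable (\<D>deg 0) M \<longrightarrow> M \<subseteq> N \<longrightarrow> M = {0} \<or> M = N)"

lemma Bann_dim_less:
  assumes "stable (\<D>deg 0) M" "stable (\<D>deg 0) N" "M \<subset> N" "N \<subseteq> Bann"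
  shows "mp.dim M < mp.dim N"
  using dim_strict_mono[OF stable_subspace[OF assms(1)] stable_subspace[OF assms(2)] _ finite_monomials assms(3)]
    assms(4) Bann_span by blast

text \<open>A nonzero stable subspace of least dimension is minimal.\<close>

lemma exists_minimal_stable:
  assumes "stable (\<D>deg 0) U" "U \<subseteq> Bann" "U \<noteq> {0}"
  obtains N where "minimal_stable N" "N \<subseteq> U"
proof -
  let ?P = "\<lambda>N. stable (\<D>deg 0) N \<and> N \<subseteq> U \<and> N \<noteq> {0}"
  obtain N where N: "?P N" "\<And>M. ?P M \<Longrightarrow> mp.dim N \<le> mp.dim M"
    using ex_has_least_nat[of ?P U mp.dim] assms by blast
  have "M = {0} \<or> M = N" if "stable (\<D>deg 0) M" "M \<subseteq> N" for M
  proof (rule ccontr)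
    assume "\<not> ?thesis"
    then have "?P M" "M \<subset> N" using that N(1) by auto
    then show False using N(2)[of M] Bann_dim_less[of M N] that N(1) assms(2) by force
  qed
  then have "minimal_stable N" using N(1) by (auto simp: minimal_stable_def)
  then show ?thesis using that N(1) by blast
qed

text \<open>The operators of degree \<open>0\<close> are closed under adjoints.\<close>

lemma stable_orthogonal:
  assumes "stable (\<D>deg 0) U" "stable (\<D>deg 0) N"
  shows "stable (\<D>deg 0) {x \<in> U. \<forall>y\<in>N. ip y x = 0}"
proof -
  have "ip y (P x) = 0" if "P \<in> \<D>deg 0" "x \<in> U" "\<forall>y\<in>N. ip y x = 0" "y \<in> N" for P x y
  proof -
    note P = that(1)
    obtain Q where Q: "Q \<in> \<D>deg 0" "\<And>p q. p \<in> polys n \<Longrightarrow> q \<in> polys n \<Longrightarrow> ip (Q p) q = ip p (P q)"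
      using D_adjoint[OF Ddeg_D[OF P]] P by (metis neg_0_equal_iff_equal)
    then show ?thesis
      using that stable_op[OF assms(2) Q(1) that(4)] stable_polys[OF assms(1)] stable_polys[OF assms(2)] by metis
  qed
  then show ?thesis using assms by (auto simp: stable_def ip_add_right)
qed

text \<open>The last conjunct says that the members of \<open>S\<close> span \<open>U\<close> additively.\<close>

definition orthogonal_decomposition :: "mpoly set \<Rightarrow> mpoly set set \<Rightarrow> bool"
  where "orthogonal_decomposition U S \<longleftrightarrow> (\<forall>N\<in>S. minimal_stable N \<and> N \<subseteq> U) \<and>
    (\<forall>M\<in>S. \<forall>N\<in>S. M \<noteq> N \<longrightarrow> (\<forall>x\<in>M. \<forall>y\<in>N. ip x y = 0)) \<and>
    (\<forall>T. 0 \<in> T \<longrightarrow> (\<forall>x\<in>T. \<forall>y\<in>T. x + y \<in> T) \<longrightarrow> \<Union>S \<subseteq> T \<longrightarrow> U \<subseteq> T)"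

text \<open>Split off a minimal stable subspace; its orthogonal complement is stable and of smaller
  dimension.\<close>

lemma semisimple_decomposition:
  assumes "stable (\<D>deg 0) U" "U \<subseteq> Bann"
  shows "\<exists>S. orthogonal_decomposition U S"
  using assms
proof (induction "mp.dim U" arbitrary: U rule: less_induct)
  case less
  show ?case
  proof (cases "U = {0}")
    case True
    then show ?thesis by (intro exI[of _ "{}"]) (auto simp: orthogonal_decomposition_def)
  next
    case False
    then obtain N where N: "minimal_stable N" "N \<subseteq> U" using exists_minimal_stable less.prems by blast
    have N0: "stable (\<D>deg 0) N" using N(1) by (simp add: minimal_stable_def)
    define U' where "U' = {x \<in> U. \<forall>y\<in>N. ip y x = 0}"
    have U': "stable (\<D>deg 0) U'" "U' \<subseteq> U" "U' \<subseteq> Bann"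
      unfolding U'_def using stable_orthogonal[OF less.prems(1) N0] less.prems(2) by auto
    have "U' \<noteq> U"
    proof
      assume "U' = U"
      then have "x = 0" if "x \<in> N" for x
        using that N(2) ip_definite[of x] stable_polys[OF N0] by (auto simp: U'_def)
      then show False using N(1) stable_0[OF N0] by (auto simp: minimal_stable_def)
    qed
    then have "mp.dim U' < mp.dim U" using Bann_dim_less U' less.prems by blast
    from less.hyps[OF this U'(1,3)] obtain S where "orthogonal_decomposition U' S" by blast
    note od = this[unfolded orthogonal_decomposition_def]
    note S = conjunct1[OF od] conjunct1[OF conjunct2[OF od]] conjunct2[OF conjunct2[OF od]]
    have orth: "ip x y = 0" "ip y x = 0" if "x \<in> N" "y \<in> M" "M \<in> S" for x y M
    proof -
      have y: "y \<in> U'" using that S(1) by blast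
      then show xy: "ip x y = 0" using that(1) by (simp add: U'_def)
      then show "ip y x = 0"
        using ip_sym[of x y] stable_polys[OF N0 that(1)] stable_polys[OF U'(1) y] by simp
    qed
    have "U \<subseteq> T" if T: "0 \<in> T" "\<forall>x\<in>T. \<forall>y\<in>T. x + y \<in> T" "\<Union>(insert N S) \<subseteq> T" for T
    proof
      fix p assume p: "p \<in> U"
      obtain u where u: "u \<in> N" "\<And>v. v \<in> N \<Longrightarrow> ip v (p - u) = 0"
        using Bann_projection[OF N0 _ stable_polys[OF less.prems(1) p]] N(2) less.prems(2) by blast
      have "p - u \<in> U'" using u p N(2) stable_diff[OF less.prems(1)] by (auto simp: U'_def)
      moreover have "U' \<subseteq> T" by (rule S(3)[rule_format]) (use T in auto)
      ultimately have "p - u \<in> T" by blast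
      then have "(p - u) + u \<in> T" using T u(1) by blast
      then show "p \<in> T" by simp
    qed
    moreover have "\<forall>M\<in>insert N S. \<forall>L\<in>insert N S. M \<noteq> L \<longrightarrow> (\<forall>x\<in>M. \<forall>y\<in>L. ip x y = 0)"
    proof (intro ballI impI)
      fix M L x y assume "M \<in> insert N S" "L \<in> insert N S" "M \<noteq> L" "x \<in> M" "y \<in> L"
      then show "ip x y = 0" using S(2)[rule_format, of M L x y] orth(1)[of x y L] orth(2)[of y x M] by auto
    qed
    moreover have "\<forall>L\<in>insert N S. minimal_stable L \<and> L \<subseteq> U" using S(1) N U'(2) by blast
    ultimately have "orthogonal_decomposition U (insert N S)" unfolding orthogonal_decomposition_def by blast
    then show ?thesis ..
  qed
qed

end

section \<open>The correspondence of submodules and homomorphisms\<close>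

lemma mpoly_group:
  fixes M :: "('r, mpoly, 'l) module_scheme"
  assumes [simp]: "add M = (+)" "zero M = 0"
    and c: "0 \<in> carrier M" "\<And>x y. x \<in> carrier M \<Longrightarrow> y \<in> carrier M \<Longrightarrow> x + y \<in> carrier M"
      "\<And>x. x \<in> carrier M \<Longrightarrow> - x \<in> carrier M"
  shows mpoly_abelian_group: "abelian_group M"
    and mpoly_group_inv: "x \<in> carrier M \<Longrightarrow> inv\<^bsub>add_monoid M\<^esub> x = - x"
proof -
  show ab: "abelian_group M"
  proof (rule abelian_groupI)
    fix x assume "x \<in> carrier M"
    then show "\<exists>y\<in>carrier M. y \<oplus>\<^bsub>M\<^esub> x = \<zero>\<^bsub>M\<^esub>" using c(3) by (intro bexI[of _ "- x"]) auto
  qed (use c in \<open>simp_all add: ac_simps\<close>)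
  show "inv\<^bsub>add_monoid M\<^esub> x = - x" if "x \<in> carrier M"
    using group.inv_equality[OF abelian_group.a_group[OF ab], of "- x" x] that c(3) by simp
qed

lemma submodule_mpoly_iff:
  fixes M :: "('r, mpoly, 'l) module_scheme"
  assumes "add M = (+)" "zero M = 0"
    and "0 \<in> carrier M" "\<And>x y. x \<in> carrier M \<Longrightarrow> y \<in> carrier M \<Longrightarrow> x + y \<in> carrier M"
      "\<And>x. x \<in> carrier M \<Longrightarrow> - x \<in> carrier M"
  shows "submodule N R M \<longleftrightarrow> N \<subseteq> carrier M \<and> 0 \<in> N \<and> (\<forall>x\<in>N. \<forall>y\<in>N. x + y \<in> N) \<and> (\<forall>x\<in>N. - x \<in> N) \<and>
    (\<forall>a\<in>carrier R. \<forall>x\<in>N. a \<odot>\<^bsub>M\<^esub> x \<in> N)"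
proof (cases "N \<subseteq> carrier M")
  case True
  then have "\<forall>x\<in>N. inv\<^bsub>add_monoid M\<^esub> x = - x" using mpoly_group_inv[OF assms] by blast
  with True show ?thesis
    unfolding submodule_def submodule_axioms_def subgroup_def using assms(1,2) by auto
qed (simp add: submodule_def subgroup_def)

lemma is_cat_submodule_cat: "is_cat (submodule_cat R M)"
  unfolding is_cat_def submodule_cat_def
proof (simp, intro conjI ballI allI impI)
  fix N assume "submodule N R M"
  then show "(\<lambda>x\<in>N. x) \<in> module_hom R (M\<lparr>carrier := N\<rparr>) (M\<lparr>carrier := N\<rparr>)"
    using subgroup.m_closed[OF submodule.axioms(1), of N R M] submodule.smult_closed[of N R M]
    by (auto simp: module_hom_def)
next
  fix X Y Z f g
  assume "f \<in> module_hom R (M\<lparr>carrier := X\<rparr>) (M\<lparr>carrier := Y\<rparr>)" "g \<in> module_hom R (M\<lparr>carrier := Y\<rparr>) (M\<lparr>carrier := Z\<rparr>)"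
    "submodule X R M"
  then show "compose X g f \<in> module_hom R (M\<lparr>carrier := X\<rparr>) (M\<lparr>carrier := Z\<rparr>)"
    using subgroup.m_closed[OF submodule.axioms(1), of X R M] submodule.smult_closed[of X R M]
    by (auto simp: module_hom_def compose_def PiE_iff)
next
  fix X Y f
  assume "f \<in> module_hom R (M\<lparr>carrier := X\<rparr>) (M\<lparr>carrier := Y\<rparr>)"
  then have f: "f \<in> X \<rightarrow>\<^sub>E Y" by (simp add: module_hom_def)
  show "compose X f (\<lambda>x\<in>X. x) = f" "compose X (\<lambda>x\<in>Y. x) f = f"
    by (rule extensionalityI[of _ X]; use f in \<open>auto simp: compose_def PiE_def\<close>)+
next
  fix W X Y Z f g h
  assume "f \<in> module_hom R (M\<lparr>carrier := W\<rparr>) (M\<lparr>carrier := X\<rparr>)"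
  then have "f \<in> W \<rightarrow> X" by (auto simp: module_hom_def)
  then show "compose W h (compose W g f) = compose W (compose X h g) f"
    by (auto simp: compose_def intro!: restrict_ext)
qed

text \<open>A functor that is bijective on objects and on all sets of morphisms is an isomorphism of
  categories. Functoriality of the inverse is automatic.\<close>

lemma inverse_functors_inv_into:
  assumes C: "is_cat C" and D: "is_cat D" and F: "is_functor C D Fo Fa"
    and GF: "\<And>X. X \<in> Obj C \<Longrightarrow> Go (Fo X) = X"
    and G: "\<And>X. X \<in> Obj D \<Longrightarrow> Go X \<in> Obj C" and FG: "\<And>X. X \<in> Obj D \<Longrightarrow> Fo (Go X) = X"
    and bij: "\<And>X Y. X \<in> Obj C \<Longrightarrow> Y \<in> Obj C \<Longrightarrow> bij_betw (Fa X Y) (Hom C X Y) (Hom D (Fo X) (Fo Y))"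
  shows "inverse_functors C D Fo Fa Go (\<lambda>X Y. inv_into (Hom C (Go X) (Go Y)) (Fa (Go X) (Go Y)))"
    (is "inverse_functors C D Fo Fa Go ?Ga")
proof -
  have Ga: "?Ga X Y f \<in> Hom C (Go X) (Go Y)" "Fa (Go X) (Go Y) (?Ga X Y f) = f"
    if "X \<in> Obj D" "Y \<in> Obj D" "f \<in> Hom D X Y" for X Y f
    using bij[OF G[OF that(1)] G[OF that(2)]] that FG
    by (auto simp: bij_betw_def inv_into_into f_inv_into_f)
  have Ga_eq: "?Ga X Y (Fa (Go X) (Go Y) f) = f"
    if "X \<in> Obj D" "Y \<in> Obj D" "f \<in> Hom C (Go X) (Go Y)" for X Y f
    using bij[OF G[OF that(1)] G[OF that(2)]] that by (simp add: bij_betw_def)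
  have "is_functor D C Go ?Ga"
    unfolding is_functor_def
  proof (intro conjI ballI)
    fix X assume X: "X \<in> Obj D"
    have "Idt C (Go X) \<in> Hom C (Go X) (Go X)" using C G[OF X] by (simp add: is_cat_def)
    moreover have "Fa (Go X) (Go X) (Idt C (Go X)) = Idt D X"
      using F G[OF X] FG[OF X] by (simp add: is_functor_def)
    ultimately show "?Ga X X (Idt D X) = Idt C (Go X)" using Ga_eq[OF X X] by metis
  next
    fix X Y Z f g assume *: "X \<in> Obj D" "Y \<in> Obj D" "Z \<in> Obj D" "f \<in> Hom D X Y" "g \<in> Hom D Y Z"
    let ?h = "Cmp C (Go X) (Go Y) (Go Z) (?Ga Y Z g) (?Ga X Y f)"
    have "?h \<in> Hom C (Go X) (Go Z)" using C G Ga * unfolding is_cat_def by blast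
    moreover have "Fa (Go X) (Go Z) ?h = Cmp D (Fo (Go X)) (Fo (Go Y)) (Fo (Go Z))
        (Fa (Go Y) (Go Z) (?Ga Y Z g)) (Fa (Go X) (Go Y) (?Ga X Y f))"
      using F G Ga(1) * unfolding is_functor_def by blast
    ultimately show "?Ga X Z (Cmp D X Y Z g f) = ?h"
      using Ga_eq[of X Z ?h] Ga(2) FG * by simp
  qed (use Ga G in auto)
  moreover have "?Ga (Fo X) (Fo Y) (Fa X Y f) = f" if "X \<in> Obj C" "Y \<in> Obj C" "f \<in> Hom C X Y" for X Y f
    using bij[OF that(1,2)] that GF by (simp add: bij_betw_def)
  ultimately show ?thesis
    unfolding inverse_functors_def using C D F GF FG Ga(2) by blast
qed

context finite_linear_group
begin

subsection \<open>Generated submodules\<close>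

lemma B_module_simps [simp]:
  "carrier (B_module n) = polys n" "add (B_module n) = (+)" "zero (B_module n) = 0" "P \<odot>\<^bsub>B_module n\<^esub> p = P p"
  by (simp_all add: B_module_def)

lemma B_inv: "p \<in> polys n \<Longrightarrow> inv\<^bsub>add_monoid (B_module n)\<^esub> p = - p"
  by (rule mpoly_group_inv) auto

lemma D_span_gen: "P \<in> \<D> \<Longrightarrow> w \<in> W \<Longrightarrow> P w \<in> D_span n G W"
  unfolding D_span_def by (rule generate.incl) blast

lemma D_span_0: "0 \<in> D_span n G W"
  unfolding D_span_def using generate.one[of "add_monoid (B_module n)"] by simp

lemma D_span_add: "x \<in> D_span n G W \<Longrightarrow> y \<in> D_span n G W \<Longrightarrow> x + y \<in> D_span n G W"
  unfolding D_span_def using generate.eng[of x "add_monoid (B_module n)" _ y] by simp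

lemma D_span_induct [consumes 2, case_names zero gen add]:
  assumes "x \<in> D_span n G W" "W \<subseteq> polys n"
    and z: "X 0" and g: "\<And>P w. P \<in> \<D> \<Longrightarrow> w \<in> W \<Longrightarrow> X (P w)"
    and a: "\<And>x y. x \<in> D_span n G W \<Longrightarrow> y \<in> D_span n G W \<Longrightarrow> X x \<Longrightarrow> X y \<Longrightarrow> X (x + y)"
  shows "X x"
  using assms(1)[unfolded D_span_def]
proof (induction rule: generate.induct)
  case (inv h)
  then obtain P w where *: "h = P w" "P \<in> \<D>" "w \<in> W" by blast
  have w: "w \<in> polys n" using *(3) assms(2) by blast
  have "compose (polys n) (mulop n (const (- 1))) P \<in> \<D>" using D_compose Ddeg_D[OF Ddeg_const] *(2) by blast
  moreover have "compose (polys n) (mulop n (const (- 1))) P w = inv\<^bsub>add_monoid (B_module n)\<^esub> h"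
    unfolding *(1) B_inv[OF D_polys[OF *(2) w]] using *(2) w by (simp add: compose_def mulop_def const_minus)
  ultimately show ?case using g *(3) by metis
next
  case (eng x y)
  then show ?case using a[of x y] by (simp add: D_span_def)
qed (use z g in auto)

lemma stable_D_span:
  assumes "W \<subseteq> polys n"
  shows "stable \<D> (D_span n G W)"
proof -
  have "x \<in> polys n" if "x \<in> D_span n G W" for x
    using that assms by (induction rule: D_span_induct) (use assms in auto)
  moreover have "Q x \<in> D_span n G W" if Q: "Q \<in> \<D>" and "x \<in> D_span n G W" for Q x
    using that(2) assms
  proof (induction rule: D_span_induct)
    case zero
    then show ?case using End_0[OF D_End[OF Q]] D_span_0 by simp
  next
    case (gen P w)
    then show ?case using D_span_gen[OF D_compose[OF Q gen(1)] gen(2)] assms by (auto simp: compose_def)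
  next
    case (add x y)
    then show ?case using D_add[OF Q, of x y] D_span_add \<open>\<And>x. x \<in> D_span n G W \<Longrightarrow> x \<in> polys n\<close> by simp
  qed
  ultimately show ?thesis by (auto simp: stable_def D_span_0 D_span_add)
qed

lemma D_span_minimal:
  assumes "stable \<D> N" "W \<subseteq> N"
  shows "D_span n G W \<subseteq> N"
proof
  have "W \<subseteq> polys n" using assms stable_polys by blast
  show "x \<in> N" if "x \<in> D_span n G W" for x
    using that \<open>W \<subseteq> polys n\<close>
    by (induction rule: D_span_induct) (use assms stable_0 stable_op stable_add in blast)+
qed

lemma D_span_superset:
  assumes "W \<subseteq> polys n"
  shows "W \<subseteq> D_span n G W"
  using D_span_gen[OF D_1] assms by fastforce

lemma D_span_ann:
  assumes "stable \<D> N"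
  shows "D_span n G (ann n G N) = N"
proof (rule sym, rule ann_generates[OF assms])
  have N: "N \<subseteq> polys n" using assms by (simp add: stable_def)
  have sub: "ann n G N \<subseteq> N" by (auto simp: ann_def)
  show "stable \<D> (D_span n G (ann n G N))" using stable_D_span N sub by blast
  show "D_span n G (ann n G N) \<subseteq> N" using D_span_minimal assms sub by blast
  show "ann n G N \<subseteq> D_span n G (ann n G N)" using D_span_superset N sub by blast
qed

text \<open>Take \<open>q\<close> in the annihilated part of \<open>\<D> W\<close>, orthogonal to \<open>W\<close>. By \<open>D_degree_zero_part\<close> it is
  orthogonal to all \<open>P w\<close>, hence to \<open>\<D> W\<close>, which contains it.\<close>

lemma ann_D_span:
  assumes "stable (\<D>deg 0) W" "W \<subseteq> Bann"
  shows "ann n G (D_span n G W) = W"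
proof -
  have W: "W \<subseteq> polys n" using assms by (simp add: stable_def)
  note st = stable_D_span[OF W]
  have DW: "D_span n G W \<subseteq> polys n" using st by (simp add: stable_def)
  have "p \<in> W" if p: "p \<in> ann n G (D_span n G W)" for p
  proof -
    have pp: "p \<in> D_span n G W" "p \<in> Bann" "p \<in> polys n" using p ann_inter[OF DW] DW by auto
    obtain u where u: "u \<in> W" "\<And>v. v \<in> W \<Longrightarrow> ip v (p - u) = 0"
      using Bann_projection[OF assms pp(3)] by blast
    define q where "q = p - u"
    have q: "q \<in> D_span n G W" "q \<in> Bann" "q \<in> polys n"
      unfolding q_def
      using stable_diff[OF stable_D_D0[OF st] pp(1)] stable_diff[OF stable_Bann pp(2)] D_span_superset[OF W] u(1) assms(2) W pp(3)
      by auto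
    have "ip x q = 0" if "x \<in> D_span n G W" for x
      using that W
    proof (induction rule: D_span_induct)
      case (gen P w)
      obtain P0 where "P0 \<in> \<D>deg 0" "ip (P w) q = ip (P0 w) q"
        using D_degree_zero_part[OF gen(1)] gen(2) q(2) assms(2) by (metis subsetD)
      then show ?case using u(2) stable_op[OF assms(1) _ gen(2)] by (simp add: q_def)
    qed (auto simp: ip_add_left)
    then have "q = 0" using q ip_definite by blast
    then show ?thesis using u(1) by (simp add: q_def)
  qed
  then show ?thesis using ann_inter[OF DW] assms(2) D_span_superset[OF W] by blast
qed

lemma ann_mono: "M \<subseteq> N \<Longrightarrow> ann n G M \<subseteq> ann n G N" by (auto simp: ann_def)

subsection \<open>Extension of homomorphisms\<close>

definition homs :: "(mpoly \<Rightarrow> mpoly) set \<Rightarrow> mpoly set \<Rightarrow> mpoly set \<Rightarrow> (mpoly \<Rightarrow> mpoly) set"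
  where "homs S N N' = {f \<in> N \<rightarrow>\<^sub>E N'. (\<forall>x\<in>N. \<forall>y\<in>N. f (x + y) = f x + f y) \<and> (\<forall>P\<in>S. \<forall>x\<in>N. f (P x) = P (f x))}"

lemma homs_mem: "f \<in> homs S N N' \<Longrightarrow> x \<in> N \<Longrightarrow> f x \<in> N'"
  and homs_add: "f \<in> homs S N N' \<Longrightarrow> x \<in> N \<Longrightarrow> y \<in> N \<Longrightarrow> f (x + y) = f x + f y"
  and homs_op: "f \<in> homs S N N' \<Longrightarrow> P \<in> S \<Longrightarrow> x \<in> N \<Longrightarrow> f (P x) = P (f x)"
  and homs_ext: "f \<in> homs S N N' \<Longrightarrow> f \<in> extensional N"
  by (auto simp: homs_def PiE_def)

lemma homs_0: "f \<in> homs S N N' \<Longrightarrow> 0 \<in> N \<Longrightarrow> f 0 = 0"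
  using homs_add[of f S N N' 0 0] by simp

lemma restrict_homs_ann:
  assumes "stable \<D> N" "stable \<D> N'" "f \<in> homs \<D> N N'"
  shows "restrict f (ann n G N) \<in> homs (\<D>deg 0) (ann n G N) (ann n G N')"
proof -
  have sub: "ann n G N \<subseteq> N" by (auto simp: ann_def)
  have "f x \<in> ann n G N'" if "x \<in> ann n G N" for x
  proof -
    have x: "x \<in> N" "\<forall>k<0. \<forall>P\<in>\<D>deg k. P x = 0" using that ann_iff[of N] assms(1) by (auto simp: stable_def)
    have "P (f x) = 0" if "k < 0" "P \<in> \<D>deg k" for k P
      using homs_op[OF assms(3) Ddeg_D[OF that(2)] x(1)] x(2)[rule_format, OF that] homs_0[OF assms(3) stable_0[OF assms(1)]] by simp
    then show ?thesis using ann_iff[of N'] assms(2) homs_mem[OF assms(3) x(1)] by (auto simp: stable_def)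
  qed
  moreover note stable_add[OF stable_ann[OF stable_D_D0[OF assms(1)]]] stable_op[OF stable_ann[OF stable_D_D0[OF assms(1)]]]
  ultimately show ?thesis
    unfolding homs_def
    using homs_add[OF assms(3)] homs_op[OF assms(3) Ddeg_D] sub
    by (auto simp: subset_iff)
qed

text \<open>The graph of the only possible extension of \<open>h\<close> to \<open>\<D> W\<close>, which sends \<open>\<Sum> P\<^sub>i w\<^sub>i\<close> to
  \<open>\<Sum> P\<^sub>i (h w\<^sub>i)\<close>. That it is single-valued has to be proved.\<close>

inductive_set hom_graph :: "mpoly set \<Rightarrow> (mpoly \<Rightarrow> mpoly) \<Rightarrow> (mpoly \<times> mpoly) set" for W h
  where zero: "(0, 0) \<in> hom_graph W h"
  | gen: "P \<in> \<D> \<Longrightarrow> w \<in> W \<Longrightarrow> (P w, P (h w)) \<in> hom_graph W h"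
  | add: "(y, z) \<in> hom_graph W h \<Longrightarrow> (y', z') \<in> hom_graph W h \<Longrightarrow> (y + y', z + z') \<in> hom_graph W h"

context
  fixes W W' h
  assumes W: "stable (\<D>deg 0) W" "W \<subseteq> Bann" and W': "stable (\<D>deg 0) W'" "W' \<subseteq> Bann"
    and h: "h \<in> homs (\<D>deg 0) W W'"
begin

lemma W_polys: "W \<subseteq> polys n" "W' \<subseteq> polys n"
  using W W' by (auto simp: stable_def)

lemma hom_graph_D_span: "(y, z) \<in> hom_graph W h \<Longrightarrow> y \<in> D_span n G W \<and> z \<in> D_span n G W'"
proof (induction rule: hom_graph.induct)
  case (gen P w)
  then show ?case using D_span_gen homs_mem[OF h] by blast
qed (auto simp: D_span_0 D_span_add)

lemma hom_graph_total:
  assumes "y \<in> D_span n G W"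
  shows "\<exists>z. (y, z) \<in> hom_graph W h"
  using assms W_polys(1) by (induction rule: D_span_induct) (blast intro: hom_graph.intros)+

lemma D_span_polys: "y \<in> D_span n G W \<Longrightarrow> y \<in> polys n" "z \<in> D_span n G W' \<Longrightarrow> z \<in> polys n"
  using stable_polys stable_D_span W_polys by blast+

lemma hom_graph_op:
  assumes "(y, z) \<in> hom_graph W h" "Q \<in> \<D>"
  shows "(Q y, Q z) \<in> hom_graph W h"
  using assms(1)
proof (induction rule: hom_graph.induct)
  case zero
  then show ?case using End_0[OF D_End[OF assms(2)]] hom_graph.zero by metis
next
  case (gen P w)
  then have "w \<in> polys n" "h w \<in> polys n" using W_polys homs_mem[OF h] by auto
  then show ?case using hom_graph.gen[OF D_compose[OF assms(2) gen(1)] gen(2), of h] by (simp add: compose_def)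
next
  case (add y z y' z')
  have "Q (y + y') = Q y + Q y'" "Q (z + z') = Q z + Q z'"
    using D_add[OF assms(2)] hom_graph_D_span add.hyps D_span_polys by blast+
  then show ?case using add.IH hom_graph.add by metis
qed

text \<open>The element \<open>a\<close> is the orthogonal projection of \<open>Q y\<close> to \<open>W\<close>, and \<open>h a\<close> that of \<open>Q z\<close> to
  \<open>W'\<close>. So the products of \<open>z\<close> with the generators of \<open>\<D> W'\<close> depend on \<open>y\<close> only.\<close>

lemma hom_graph_projection:
  assumes "(y, z) \<in> hom_graph W h" "Q \<in> \<D>"
  shows "\<exists>a\<in>W. (\<forall>v\<in>W. ip (Q y - a) v = 0) \<and> (\<forall>u\<in>W'. ip (Q z - h a) u = 0)"
  using assms(1)
proof (induction rule: hom_graph.induct)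
  case zero
  show ?case
    by (rule bexI[of _ 0]) (simp_all add: End_0[OF D_End[OF assms(2)]] homs_0[OF h] stable_0[OF W(1)])
next
  case (gen P w)
  obtain P0 where P0: "P0 \<in> \<D>deg 0"
    "\<And>w u. w \<in> Bann \<Longrightarrow> u \<in> Bann \<Longrightarrow> ip (compose (polys n) Q P w) u = ip (P0 w) u"
    by (rule D_degree_zero_part[OF D_compose[OF assms(2) gen(1)]]) blast
  have w: "w \<in> polys n" "h w \<in> polys n" "w \<in> Bann" "h w \<in> Bann"
    using gen(2) W_polys homs_mem[OF h] W(2) W'(2) by auto
  show ?case
  proof (rule bexI[of _ "P0 w"], intro conjI ballI)
    show "P0 w \<in> W" using stable_op[OF W(1) P0(1) gen(2)] .
    fix v assume "v \<in> W"
    then show "ip (Q (P w) - P0 w) v = 0" using P0(2)[of w v] w W(2) by (auto simp: ip_diff_left compose_def)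
  next
    fix u assume "u \<in> W'"
    then show "ip (Q (P (h w)) - h (P0 w)) u = 0"
      using P0(2)[of "h w" u] w W'(2) homs_op[OF h P0(1) gen(2)] by (auto simp: ip_diff_left compose_def)
  qed
next
  case (add y z y' z')
  then obtain a b where ab: "a \<in> W" "\<forall>v\<in>W. ip (Q y - a) v = 0" "\<forall>u\<in>W'. ip (Q z - h a) u = 0"
    "b \<in> W" "\<forall>v\<in>W. ip (Q y' - b) v = 0" "\<forall>u\<in>W'. ip (Q z' - h b) u = 0" by blast
  have Q: "Q (y + y') = Q y + Q y'" "Q (z + z') = Q z + Q z'"
    using D_add[OF assms(2)] hom_graph_D_span add.hyps D_span_polys by blast+
  show ?case
    by (rule bexI[of _ "a + b"])
      (use ab stable_add[OF W(1)] in \<open>auto simp: Q homs_add[OF h] ip_add_left ip_diff_left\<close>)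
qed

lemma hom_graph_zero:
  assumes "(0, z) \<in> hom_graph W h"
  shows "z = 0"
proof -
  have z: "z \<in> D_span n G W'" "z \<in> polys n" using hom_graph_D_span[OF assms] D_span_polys by auto
  have orth: "ip (Q z) u = 0" if "Q \<in> \<D>" "u \<in> W'" for Q u
  proof -
    note Q = that(1)
    obtain a where a: "a \<in> W" "\<forall>v\<in>W. ip (Q 0 - a) v = 0" "\<forall>u\<in>W'. ip (Q z - h a) u = 0"
      using hom_graph_projection[OF assms Q] by blast
    have "ip a a = 0" using a(1,2) End_0[OF D_End[OF that(1)]] by (auto simp: ip_minus_left)
    then have "a = 0" using ip_definite a(1) W_polys by blast
    then show ?thesis using a(3) that(2) homs_0[OF h stable_0[OF W(1)]] by simp
  qed
  have "ip z x = 0" if "x \<in> D_span n G W'" for x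
    using that W_polys(2)
  proof (induction rule: D_span_induct)
    case (gen P u)
    obtain Q where Q: "Q \<in> \<D>" "\<And>p q. p \<in> polys n \<Longrightarrow> q \<in> polys n \<Longrightarrow> ip (Q p) q = ip p (P q)"
      using D_adjoint[OF gen(1)] by metis
    have "ip z (P u) = ip (Q z) u" using Q(2) z(2) gen(2) W_polys by auto
    then show ?case using orth[OF Q(1) gen(2)] by simp
  qed (auto simp: ip_add_right)
  then show ?thesis using z ip_definite by blast
qed

lemma hom_graph_single_valued:
  assumes "(y, z) \<in> hom_graph W h" "(y, z') \<in> hom_graph W h"
  shows "z = z'"
proof -
  have "y \<in> polys n" "z' \<in> polys n" using hom_graph_D_span[OF assms(2)] D_span_polys by auto
  then have "(- y, - z') \<in> hom_graph W h"
    using hom_graph_op[OF assms(2) Ddeg_D[OF Ddeg_const], of "- 1"] by (simp add: mulop_def const_minus)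
  from hom_graph.add[OF assms(1) this] have "(0, z - z') \<in> hom_graph W h" by simp
  then have "z - z' = 0" by (rule hom_graph_zero)
  then show ?thesis by simp
qed

lemma hom_extension: "\<exists>f\<in>homs \<D> (D_span n G W) (D_span n G W'). restrict f W = h"
proof -
  define f where "f = (\<lambda>y\<in>D_span n G W. THE z. (y, z) \<in> hom_graph W h)"
  have f: "f y = z" if "(y, z) \<in> hom_graph W h" for y z
    using that hom_graph_D_span[OF that] hom_graph_single_valued by (auto simp: f_def intro!: the_equality)
  have fg: "(y, f y) \<in> hom_graph W h" if "y \<in> D_span n G W" for y
    using hom_graph_total[OF that] f by auto
  have "f \<in> homs \<D> (D_span n G W) (D_span n G W')"
    unfolding homs_def
  proof (intro CollectI conjI ballI)
    have "f \<in> extensional (D_span n G W)" by (simp add: f_def)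
    then show "f \<in> D_span n G W \<rightarrow>\<^sub>E D_span n G W'"
      using fg hom_graph_D_span by (auto simp: PiE_def)
    fix x assume x: "x \<in> D_span n G W"
    show "f (x + y) = f x + f y" if "y \<in> D_span n G W" for y
      using f[OF hom_graph.add[OF fg[OF x] fg[OF that]]] .
    show "f (P x) = P (f x)" if "P \<in> \<D>" for P
      using f[OF hom_graph_op[OF fg[OF x] that]] .
  qed
  moreover have "restrict f W = h"
  proof (rule extensionalityI[of _ W])
    show "h \<in> extensional W" using homs_ext[OF h] .
    fix x assume x: "x \<in> W"
    have "(x, h x) \<in> hom_graph W h"
      using hom_graph.gen[OF D_1 x, of h] subsetD[OF W_polys(1) x] subsetD[OF W_polys(2) homs_mem[OF h x]] by simp
    then show "restrict f W x = h x" using f x by simp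
  qed simp
  ultimately show ?thesis by blast
qed

end

lemma hom_determined:
  assumes "W \<subseteq> polys n" "f \<in> homs \<D> (D_span n G W) N" "f' \<in> homs \<D> (D_span n G W) N" "restrict f W = restrict f' W"
  shows "f = f'"
proof (rule extensionalityI[OF homs_ext[OF assms(2)] homs_ext[OF assms(3)]])
  have e: "f w = f' w" if "w \<in> W" for w using fun_cong[OF assms(4), of w] that by simp
  fix x assume "x \<in> D_span n G W"
  then show "f x = f' x" using assms(1)
  proof (induction rule: D_span_induct)
    case zero
    then show ?case using homs_0 assms(2,3) D_span_0 by metis
  next
    case (gen P w)
    have "w \<in> D_span n G W" using gen D_span_superset[OF assms(1)] by blast
    then show ?case using homs_op[OF assms(2) gen(1)] homs_op[OF assms(3) gen(1)] e[OF gen(2)] by simp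
  next
    case (add x y)
    then show ?case using homs_add[OF assms(2)] homs_add[OF assms(3)] by simp
  qed
qed

lemma restrict_bij_betw:
  assumes N: "stable \<D> N" and N': "stable \<D> N'"
  shows "bij_betw (\<lambda>f. restrict f (ann n G N)) (homs \<D> N N') (homs (\<D>deg 0) (ann n G N) (ann n G N'))"
proof -
  have sub: "ann n G M \<subseteq> Bann" if "stable \<D> M" for M using that by (intro ann_mono) (simp add: stable_def)
  have pol: "ann n G N \<subseteq> polys n" using sub[OF N] Bann_polys by blast
  note st = stable_ann[OF stable_D_D0[OF N]] stable_ann[OF stable_D_D0[OF N']]
  show ?thesis
    unfolding bij_betw_def
  proof (intro conjI subset_antisym subsetI)
    show "inj_on (\<lambda>f. restrict f (ann n G N)) (homs \<D> N N')"
      using hom_determined[OF pol, unfolded D_span_ann[OF N]] by (auto intro!: inj_onI)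
    fix h
    show "h \<in> homs (\<D>deg 0) (ann n G N) (ann n G N')" if "h \<in> (\<lambda>f. restrict f (ann n G N)) ` homs \<D> N N'"
      using that restrict_homs_ann[OF N N'] by blast
    show "h \<in> (\<lambda>f. restrict f (ann n G N)) ` homs \<D> N N'" if "h \<in> homs (\<D>deg 0) (ann n G N) (ann n G N')"
      using hom_extension[OF st(1) sub[OF N] st(2) sub[OF N'] that] unfolding D_span_ann[OF N] D_span_ann[OF N'] by blast
  qed
qed

end

section \<open>The rings and modules\<close>

lemma left_module_restrict:
  fixes M :: "('r, mpoly, 'l) module_scheme"
  assumes M: "left_module R M" and ops: "add M = (+)" "zero M = 0"
    and N: "N \<subseteq> carrier M" "0 \<in> N" "\<And>x y. x \<in> N \<Longrightarrow> y \<in> N \<Longrightarrow> x + y \<in> N" "\<And>x. x \<in> N \<Longrightarrow> - x \<in> N"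
      "\<And>a x. a \<in> carrier R \<Longrightarrow> x \<in> N \<Longrightarrow> a \<odot>\<^bsub>M\<^esub> x \<in> N"
  shows "left_module R (M\<lparr>carrier := N\<rparr>)"
proof -
  have "abelian_group (M\<lparr>carrier := N\<rparr>)" by (rule mpoly_abelian_group) (use ops N in auto)
  moreover have "left_module_axioms R (M\<lparr>carrier := N\<rparr>)"
    using left_module.axioms(3)[OF M] N(1,5) ops by (auto simp: left_module_axioms_def subset_iff)
  ultimately show ?thesis using left_module.axioms(1)[OF M] by (simp add: left_module_def)
qed

text \<open>The submodules of the restricted module \<open>M\<lparr>carrier := N\<rparr>\<close> are those of \<open>M\<close> inside \<open>N\<close>.\<close>

lemma simple_submodule_mpoly_iff:
  fixes M :: "('r, mpoly, 'l) module_scheme"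
  assumes M: "left_module R M" and ops: "add M = (+)" "zero M = 0"
    and c: "0 \<in> carrier M" "\<And>x y. x \<in> carrier M \<Longrightarrow> y \<in> carrier M \<Longrightarrow> x + y \<in> carrier M"
      "\<And>x. x \<in> carrier M \<Longrightarrow> - x \<in> carrier M"
  shows "simple_submodule N R M \<longleftrightarrow> submodule N R M \<and> N \<noteq> {0} \<and>
    (\<forall>K. submodule K R M \<longrightarrow> K \<subseteq> N \<longrightarrow> K = {0} \<or> K = N)"
proof (cases "submodule N R M")
  case True
  have iff: "submodule K R M \<longleftrightarrow> K \<subseteq> carrier M \<and> 0 \<in> K \<and> (\<forall>x\<in>K. \<forall>y\<in>K. x + y \<in> K) \<and>
      (\<forall>x\<in>K. - x \<in> K) \<and> (\<forall>a\<in>carrier R. \<forall>x\<in>K. a \<odot>\<^bsub>M\<^esub> x \<in> K)" for K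
    by (rule submodule_mpoly_iff) (use ops c in auto)
  have N: "N \<subseteq> carrier M" "0 \<in> N" "\<And>x y. x \<in> N \<Longrightarrow> y \<in> N \<Longrightarrow> x + y \<in> N" "\<And>x. x \<in> N \<Longrightarrow> - x \<in> N"
      "\<And>a x. a \<in> carrier R \<Longrightarrow> x \<in> N \<Longrightarrow> a \<odot>\<^bsub>M\<^esub> x \<in> N"
    using True unfolding iff by auto
  have iffN: "submodule K R (M\<lparr>carrier := N\<rparr>) \<longleftrightarrow> K \<subseteq> N \<and> 0 \<in> K \<and> (\<forall>x\<in>K. \<forall>y\<in>K. x + y \<in> K) \<and>
      (\<forall>x\<in>K. - x \<in> K) \<and> (\<forall>a\<in>carrier R. \<forall>x\<in>K. a \<odot>\<^bsub>M\<^esub> x \<in> K)" for K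
    by (subst submodule_mpoly_iff) (use N ops in auto)
  have "submodule K R (M\<lparr>carrier := N\<rparr>) \<longleftrightarrow> submodule K R M \<and> K \<subseteq> N" for K
    unfolding iff iffN using subset_trans[OF _ N(1), of K] by argo
  then show ?thesis
    using True left_module_restrict[OF M ops N] by (auto simp: simple_submodule_def simple_module_def ops)
qed (simp add: simple_submodule_def)

context finite_linear_group
begin

subsection \<open>The module of polynomials\<close>

lemma B_left_module: "left_module (inv_ops n G) (B_module n)"
proof -
  have "abelian_group (B_module n)" by (rule mpoly_abelian_group) auto
  moreover have "left_module_axioms (inv_ops n G) (B_module n)"
    by (simp add: left_module_axioms_def D_add compose_def)
  ultimately show ?thesis using ring_inv_ops by (simp add: left_module_def)
qed

lemma B_submodule_iff: "submodule N (inv_ops n G) (B_module n) \<longleftrightarrow> stable \<D> N"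
  by (subst submodule_mpoly_iff) (auto simp: stable_def stable_minus[OF stable_D_D0, unfolded stable_def])

lemma B_simple_iff: "simple_submodule N (inv_ops n G) (B_module n) \<longleftrightarrow> stable \<D> N \<and> N \<noteq> {0} \<and>
    (\<forall>K. stable \<D> K \<longrightarrow> K \<subseteq> N \<longrightarrow> K = {0} \<or> K = N)"
  by (subst simple_submodule_mpoly_iff[OF B_left_module]) (auto simp: B_submodule_iff)

lemma B_hom: "module_hom (inv_ops n G) (B_module n\<lparr>carrier := N\<rparr>) (B_module n\<lparr>carrier := N'\<rparr>) = homs \<D> N N'"
  by (simp add: module_hom_def homs_def B_module_def)

subsection \<open>The quotient ring\<close>

text \<open>\<open>I\<close> is a two-sided ideal of \<open>D0\<close>: the right multiplications by operators of degree \<open>0\<close> preserve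
  the operators of negative degree, hence the left ideal \<open>L\<close> that these generate.\<close>

abbreviation "L \<equiv> inv_ops_left_ideal n G"
abbreviation "D0 \<equiv> (inv_ops n G)\<lparr>carrier := \<D>deg 0\<rparr>"
abbreviation "I \<equiv> \<D>deg 0 \<inter> L"

lemma neg_D: "Q \<in> inv_ops_neg n G \<Longrightarrow> Q \<in> \<D>"
  by (induction rule: inv_ops_neg_induct) (use D_0 Ddeg_D D_plus in blast)+

lemma neg_compose:
  assumes "Q \<in> inv_ops_neg n G" "R \<in> \<D>deg 0"
  shows "compose (polys n) Q R \<in> inv_ops_neg n G"
  using assms(1)
proof (induction rule: inv_ops_neg_induct)
  case zero
  have "compose (polys n) (\<lambda>p\<in>polys n. 0) R = \<one>\<^bsub>add_monoid (inv_ops n G)\<^esub>"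
    using Ddeg_D[OF assms(2)] by (auto simp: compose_def intro!: restrict_ext)
  then show ?case unfolding inv_ops_neg_def by (simp only: generate.one)
next
  case (deg k P)
  then have "compose (polys n) P R \<in> \<D>deg k" using Ddeg_compose[OF deg(2) assms(2)] by simp
  then show ?case unfolding inv_ops_neg_def using deg(1) by (intro generate.incl) auto
next
  case (add P Q)
  have "compose (polys n) (\<lambda>p\<in>polys n. P p + Q p) R =
      compose (polys n) P R \<otimes>\<^bsub>add_monoid (inv_ops n G)\<^esub> compose (polys n) Q R"
    using Ddeg_D[OF assms(2)] by (auto simp: compose_def intro!: restrict_ext)
  then show ?case using add(3,4) unfolding inv_ops_neg_def by (simp only: generate.eng)
qed

lemma L_gen: "P \<in> \<D> \<Longrightarrow> Q \<in> inv_ops_neg n G \<Longrightarrow> compose (polys n) P Q \<in> L"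
  unfolding inv_ops_left_ideal_def inv_ops_ops by (rule generate.incl) blast

lemma L_add: "P \<in> L \<Longrightarrow> Q \<in> L \<Longrightarrow> (\<lambda>p\<in>polys n. P p + Q p) \<in> L"
  unfolding inv_ops_left_ideal_def using generate.eng[of P "add_monoid (inv_ops n G)" _ Q] by simp

lemma L_zero: "(\<lambda>p\<in>polys n. 0) \<in> L"
  unfolding inv_ops_left_ideal_def using generate.one[of "add_monoid (inv_ops n G)"] by simp

lemma compose_assoc_D: "P \<in> \<D> \<Longrightarrow> Q \<in> \<D> \<Longrightarrow> R \<in> \<D> \<Longrightarrow>
    compose (polys n) (compose (polys n) P Q) R = compose (polys n) P (compose (polys n) Q R)"
  using monoid.m_assoc[OF ring.is_monoid[OF ring_inv_ops], of P Q R] by simp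

lemma L_induct [consumes 1, case_names zero gen add]:
  assumes "R \<in> L" and z: "X (\<lambda>p\<in>polys n. 0)"
    and g: "\<And>P Q. P \<in> \<D> \<Longrightarrow> Q \<in> inv_ops_neg n G \<Longrightarrow> X (compose (polys n) P Q)"
    and a: "\<And>P Q. P \<in> L \<Longrightarrow> Q \<in> L \<Longrightarrow> X P \<Longrightarrow> X Q \<Longrightarrow> X (\<lambda>p\<in>polys n. P p + Q p)"
  shows "X R"
  using assms(1) unfolding inv_ops_left_ideal_def inv_ops_ops(1)
proof (induction rule: generate.induct)
  case one
  have e: "\<one>\<^bsub>add_monoid (inv_ops n G)\<^esub> = (\<lambda>p\<in>polys n. 0)" by simp
  show ?case unfolding e by (rule z)
next
  case (inv h)
  then obtain P Q where *: "h = compose (polys n) P Q" "P \<in> \<D>" "Q \<in> inv_ops_neg n G" by blast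
  let ?P = "compose (polys n) (mulop n (const (- 1))) P"
  have m: "mulop n (const (- 1)) \<in> \<D>" using Ddeg_D[OF Ddeg_const] .
  have "inv\<^bsub>add_monoid (inv_ops n G)\<^esub> h = compose (polys n) ?P Q"
    using inv_ops_minus_compose[OF D_compose[OF *(2) neg_D[OF *(3)]]] compose_assoc_D[OF m *(2) neg_D[OF *(3)]]
    by (simp only: a_inv_def *(1))
  then show ?case using g[OF D_compose[OF m *(2)] *(3)] by (simp only:)
next
  case (eng P Q)
  have e: "P \<otimes>\<^bsub>add_monoid (inv_ops n G)\<^esub> Q = (\<lambda>p\<in>polys n. P p + Q p)" by simp
  show ?case unfolding e using eng a[of P Q] by (simp only: inv_ops_left_ideal_def inv_ops_ops(1))
qed (use g in blast)

lemma L_D: "R \<in> L \<Longrightarrow> R \<in> \<D>"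
  by (induction rule: L_induct) (use D_0 D_compose neg_D D_plus in blast)+

lemma L_left:
  assumes "P \<in> \<D>" "R \<in> L"
  shows "compose (polys n) P R \<in> L"
  using assms(2)
proof (induction rule: L_induct)
  case zero
  have "compose (polys n) P (\<lambda>p\<in>polys n. 0) = (\<lambda>p\<in>polys n. 0)"
    using End_0[OF D_End[OF assms(1)]] by (auto simp: compose_def intro!: restrict_ext)
  then show ?case by (simp only: L_zero)
next
  case (gen Q R)
  then show ?case using L_gen[OF D_compose[OF assms(1) gen(1)] gen(2)] compose_assoc_D[OF assms(1) gen(1) neg_D[OF gen(2)]]
    by (simp only:)
next
  case (add Q R)
  have "compose (polys n) P (\<lambda>p\<in>polys n. Q p + R p) = (\<lambda>p\<in>polys n. compose (polys n) P Q p + compose (polys n) P R p)"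
    using add.hyps L_D by (auto simp: compose_def D_add[OF assms(1)] intro!: restrict_ext)
  then show ?case using L_add[OF add.IH] by (simp only:)
qed

lemma L_right:
  assumes "R \<in> L" "T \<in> \<D>deg 0"
  shows "compose (polys n) R T \<in> L"
  using assms(1)
proof (induction rule: L_induct)
  case zero
  have "compose (polys n) (\<lambda>p\<in>polys n. 0) T = (\<lambda>p\<in>polys n. 0)"
    using Ddeg_D[OF assms(2)] by (auto simp: compose_def intro!: restrict_ext)
  then show ?case using L_zero by metis
next
  case (gen P Q)
  then show ?case
    using L_gen[OF gen(1) neg_compose[OF gen(2) assms(2)]] compose_assoc_D[OF gen(1) neg_D[OF gen(2)] Ddeg_D[OF assms(2)]]
    by (simp only:)
next
  case (add Q R)
  have "compose (polys n) (\<lambda>p\<in>polys n. Q p + R p) T = (\<lambda>p\<in>polys n. compose (polys n) Q T p + compose (polys n) R T p)"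
    using Ddeg_D[OF assms(2)] by (auto simp: compose_def intro!: restrict_ext)
  then show ?case using L_add[OF add.IH] by (simp only:)
qed

text \<open>This makes the action of the quotient ring on \<open>Bann\<close> independent of representatives.\<close>

lemma L_kills:
  assumes "R \<in> L" "x \<in> Bann"
  shows "R x = 0"
  using assms(1)
proof (induction rule: L_induct)
  case (gen P Q)
  have "Q x = 0" using gen(2) assms(2) by (simp add: ann_def)
  then show ?case using Bann_polys[OF assms(2)] End_0[OF D_End[OF gen(1)]] by (simp add: compose_def)
qed (use Bann_polys[OF assms(2)] in auto)

lemma D0_ring: "ring D0"
proof -
  interpret ring "inv_ops n G" by (rule ring_inv_ops)
  have "subring (\<D>deg 0) (inv_ops n G)"
  proof (rule subringI)
    show "\<D>deg 0 \<subseteq> \<D>" using Ddeg_D by blast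
    show "\<one>\<^bsub>inv_ops n G\<^esub> \<in> \<D>deg 0" using Ddeg_const[of 1] by (simp add: mulop_def)
    show "\<And>P. P \<in> \<D>deg 0 \<Longrightarrow> \<ominus>\<^bsub>inv_ops n G\<^esub> P \<in> \<D>deg 0"
      using inv_ops_minus_compose[OF Ddeg_D] Ddeg_compose[OF Ddeg_const] by fastforce
    show "\<And>P Q. P \<in> \<D>deg 0 \<Longrightarrow> Q \<in> \<D>deg 0 \<Longrightarrow> P \<otimes>\<^bsub>inv_ops n G\<^esub> Q \<in> \<D>deg 0"
      using Ddeg_compose[of _ 0 _ 0] by simp
    show "\<And>P Q. P \<in> \<D>deg 0 \<Longrightarrow> Q \<in> \<D>deg 0 \<Longrightarrow> P \<oplus>\<^bsub>inv_ops n G\<^esub> Q \<in> \<D>deg 0"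
      unfolding inv_ops_ops by (rule Ddeg_plus)
  qed
  then show ?thesis by (rule subring_is_ring)
qed

lemma I_ideal: "ideal I D0"
proof (rule idealI[OF D0_ring])
  interpret ring D0 by (rule D0_ring)
  show "subgroup I (add_monoid D0)"
  proof (rule add.subgroupI)
    show "I \<subseteq> carrier D0" by auto
    have "(\<lambda>p\<in>polys n. 0) \<in> \<D>deg 0" using Ddeg_const[of 0] by (simp add: mulop_def)
    then show "I \<noteq> {}" using L_zero by blast
    fix P assume P: "P \<in> I"
    let ?P = "compose (polys n) (mulop n (const (- 1))) P"
    have "?P \<in> \<D>deg 0" using P Ddeg_compose[OF Ddeg_const, of P 0] by simp
    moreover have "?P \<in> L" using P L_left[OF Ddeg_D[OF Ddeg_const]] by blast
    moreover have "\<ominus>\<^bsub>D0\<^esub> P = ?P"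
    proof (rule minus_equality)
      show "?P \<oplus>\<^bsub>D0\<^esub> P = \<zero>\<^bsub>D0\<^esub>"
        using P Ddeg_D by (auto simp: compose_def mulop_def const_minus intro!: restrict_ext)
    qed (use P \<open>?P \<in> \<D>deg 0\<close> in auto)
    ultimately show "\<ominus>\<^bsub>D0\<^esub> P \<in> I" by simp
    fix Q assume "Q \<in> I"
    then have "(\<lambda>p\<in>polys n. P p + Q p) \<in> I" using P L_add Ddeg_plus by blast
    moreover have "P \<oplus>\<^bsub>D0\<^esub> Q = (\<lambda>p\<in>polys n. P p + Q p)" by simp
    ultimately show "P \<oplus>\<^bsub>D0\<^esub> Q \<in> I" by metis
  qed
  fix P T assume *: "P \<in> I" "T \<in> carrier D0"
  then show "T \<otimes>\<^bsub>D0\<^esub> P \<in> I"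
    using Ddeg_compose[of T 0 P 0] L_left[of T P] Ddeg_D by simp
  show "P \<otimes>\<^bsub>D0\<^esub> T \<in> I"
    using * Ddeg_compose[of P 0 T 0] L_right[of P T] by simp
qed

lemma R_ring_alt: "R_ring n G = D0 Quot I"
  by (simp add: R_ring_def)

lemma R_ring_ring: "ring (R_ring n G)"
  unfolding R_ring_alt by (rule ideal.quotient_is_ring[OF I_ideal])

lemma R_carrier: "carrier (R_ring n G) = {I +>\<^bsub>D0\<^esub> P | P. P \<in> \<D>deg 0}"
  by (auto simp: R_ring_alt FactRing_def A_RCOSETS_defs a_r_coset_def r_coset_def)

lemma R_ops:
  assumes "P \<in> \<D>deg 0" "Q \<in> \<D>deg 0"
  shows "(I +>\<^bsub>D0\<^esub> P) \<oplus>\<^bsub>R_ring n G\<^esub> (I +>\<^bsub>D0\<^esub> Q) = I +>\<^bsub>D0\<^esub> (\<lambda>p\<in>polys n. P p + Q p)"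
    and "(I +>\<^bsub>D0\<^esub> P) \<otimes>\<^bsub>R_ring n G\<^esub> (I +>\<^bsub>D0\<^esub> Q) = I +>\<^bsub>D0\<^esub> compose (polys n) P Q"
proof -
  interpret ideal I D0 by (rule I_ideal)
  show "(I +>\<^bsub>D0\<^esub> P) \<oplus>\<^bsub>R_ring n G\<^esub> (I +>\<^bsub>D0\<^esub> Q) = I +>\<^bsub>D0\<^esub> (\<lambda>p\<in>polys n. P p + Q p)"
    using a_rcos_sum[of P Q] assms by (simp add: R_ring_alt FactRing_def)
  show "(I +>\<^bsub>D0\<^esub> P) \<otimes>\<^bsub>R_ring n G\<^esub> (I +>\<^bsub>D0\<^esub> Q) = I +>\<^bsub>D0\<^esub> compose (polys n) P Q"
    using rcoset_mult_add[of P Q] assms by (simp add: R_ring_alt FactRing_def)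
qed

lemma Bann_module_simps [simp]:
  "carrier (Bann_module n G) = Bann" "add (Bann_module n G) = (+)" "zero (Bann_module n G) = 0"
  by (simp_all add: Bann_module_def)

lemma R_smult:
  assumes "P \<in> \<D>deg 0" "x \<in> Bann"
  shows "(I +>\<^bsub>D0\<^esub> P) \<odot>\<^bsub>Bann_module n G\<^esub> x = P x"
proof -
  have "(\<lambda>Q. Q x) ` (I +>\<^bsub>D0\<^esub> P) = {P x}"
  proof (intro subset_antisym subsetI)
    fix y assume "y \<in> (\<lambda>Q. Q x) ` (I +>\<^bsub>D0\<^esub> P)"
    then obtain R where "R \<in> I" "y = (\<lambda>p\<in>polys n. R p + P p) x"
      by (auto simp: a_r_coset_def r_coset_def)
    then show "y \<in> {P x}" using L_kills[OF _ assms(2)] Bann_polys[OF assms(2)] by simp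
  next
    fix y assume y: "y \<in> {P x}"
    interpret ideal I D0 by (rule I_ideal)
    have "P \<in> I +>\<^bsub>D0\<^esub> P" using a_rcos_self[of P] assms(1) by simp
    then show "y \<in> (\<lambda>Q. Q x) ` (I +>\<^bsub>D0\<^esub> P)" using y by blast
  qed
  then show ?thesis by (simp add: Bann_module_def)
qed

lemma Bann_left_module: "left_module (R_ring n G) (Bann_module n G)"
proof -
  note st = stable_Bann
  have "abelian_group (Bann_module n G)"
    by (rule mpoly_abelian_group) (use stable_0[OF st] stable_add[OF st] stable_minus[OF st] in auto)
  moreover have "left_module_axioms (R_ring n G) (Bann_module n G)"
  proof
    fix C E x y assume "C \<in> carrier (R_ring n G)" "E \<in> carrier (R_ring n G)"
    then obtain P Q where PQ: "C = I +>\<^bsub>D0\<^esub> P" "E = I +>\<^bsub>D0\<^esub> Q" "P \<in> \<D>deg 0" "Q \<in> \<D>deg 0"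
      by (auto simp: R_carrier)
    assume x: "x \<in> carrier (Bann_module n G)" and y: "y \<in> carrier (Bann_module n G)"
    show "(C \<oplus>\<^bsub>R_ring n G\<^esub> E) \<odot>\<^bsub>Bann_module n G\<^esub> x =
        (C \<odot>\<^bsub>Bann_module n G\<^esub> x) \<oplus>\<^bsub>Bann_module n G\<^esub> (E \<odot>\<^bsub>Bann_module n G\<^esub> x)"
      using x PQ R_smult[OF Ddeg_plus[OF PQ(3,4)]] Bann_polys by (simp add: R_ops R_smult)
    show "(C \<otimes>\<^bsub>R_ring n G\<^esub> E) \<odot>\<^bsub>Bann_module n G\<^esub> x = C \<odot>\<^bsub>Bann_module n G\<^esub> (E \<odot>\<^bsub>Bann_module n G\<^esub> x)"
      using x PQ R_smult[of "compose (polys n) P Q" x] Ddeg_compose[OF PQ(3,4)] Bann_polys stable_op[OF st]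
      by (simp add: R_ops R_smult) (simp add: compose_def)
    show "C \<odot>\<^bsub>Bann_module n G\<^esub> (x \<oplus>\<^bsub>Bann_module n G\<^esub> y) =
        (C \<odot>\<^bsub>Bann_module n G\<^esub> x) \<oplus>\<^bsub>Bann_module n G\<^esub> (C \<odot>\<^bsub>Bann_module n G\<^esub> y)"
      using x y PQ D_add[OF Ddeg_D] Bann_polys stable_add[OF st] by (simp add: R_smult)
  next
    fix C x assume "C \<in> carrier (R_ring n G)" "x \<in> carrier (Bann_module n G)"
    then show "C \<odot>\<^bsub>Bann_module n G\<^esub> x \<in> carrier (Bann_module n G)"
      using stable_op[OF st] by (auto simp: R_carrier R_smult)
  next
    fix x assume x: "x \<in> carrier (Bann_module n G)"
    have "(\<lambda>p\<in>polys n. p) \<in> \<D>deg 0" using Ddeg_const[of 1] by (simp add: mulop_def)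
    from R_smult[OF this, of x] show "\<one>\<^bsub>R_ring n G\<^esub> \<odot>\<^bsub>Bann_module n G\<^esub> x = x"
      using x Bann_polys by (simp add: R_ring_alt FactRing_def)
  qed
  ultimately show ?thesis using R_ring_ring by (simp add: left_module_def)
qed

lemma Bann_submodule_iff: "submodule W (R_ring n G) (Bann_module n G) \<longleftrightarrow> stable (\<D>deg 0) W \<and> W \<subseteq> Bann"
proof -
  note st = stable_Bann
  have "submodule W (R_ring n G) (Bann_module n G) \<longleftrightarrow> W \<subseteq> Bann \<and> 0 \<in> W \<and> (\<forall>x\<in>W. \<forall>y\<in>W. x + y \<in> W) \<and>
      (\<forall>x\<in>W. - x \<in> W) \<and> (\<forall>C\<in>carrier (R_ring n G). \<forall>x\<in>W. C \<odot>\<^bsub>Bann_module n G\<^esub> x \<in> W)"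
    by (subst submodule_mpoly_iff) (use stable_0[OF st] stable_add[OF st] stable_minus[OF st] in auto)
  also have "\<dots> \<longleftrightarrow> W \<subseteq> Bann \<and> 0 \<in> W \<and> (\<forall>x\<in>W. \<forall>y\<in>W. x + y \<in> W) \<and>
      (\<forall>x\<in>W. - x \<in> W) \<and> (\<forall>P\<in>\<D>deg 0. \<forall>x\<in>W. P x \<in> W)"
    using R_smult by (auto simp: R_carrier subset_iff)
  also have "\<dots> \<longleftrightarrow> stable (\<D>deg 0) W \<and> W \<subseteq> Bann"
    using stable_minus[of W] Bann_polys by (auto simp: stable_def)
  finally show ?thesis .
qed

lemma Bann_simple_iff: "simple_submodule W (R_ring n G) (Bann_module n G) \<longleftrightarrow> minimal_stable W \<and> W \<subseteq> Bann"
proof -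
  note st = stable_Bann
  have "simple_submodule W (R_ring n G) (Bann_module n G) \<longleftrightarrow> (stable (\<D>deg 0) W \<and> W \<subseteq> Bann) \<and> W \<noteq> {0} \<and>
      (\<forall>K. stable (\<D>deg 0) K \<and> K \<subseteq> Bann \<longrightarrow> K \<subseteq> W \<longrightarrow> K = {0} \<or> K = W)"
    by (subst simple_submodule_mpoly_iff[OF Bann_left_module])
      (use stable_0[OF st] stable_add[OF st] stable_minus[OF st] in \<open>simp_all add: Bann_submodule_iff\<close>)
  also have "\<dots> \<longleftrightarrow> minimal_stable W \<and> W \<subseteq> Bann"
    unfolding minimal_stable_def by (meson subset_trans)
  finally show ?thesis .
qed

lemma Bann_hom:
  assumes "W \<subseteq> Bann" "W' \<subseteq> Bann"
  shows "module_hom (R_ring n G) (Bann_module n G\<lparr>carrier := W\<rparr>) (Bann_module n G\<lparr>carrier := W'\<rparr>) = homs (\<D>deg 0) W W'"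
proof -
  have "(\<forall>C\<in>carrier (R_ring n G). \<forall>x\<in>W. f (C \<odot>\<^bsub>Bann_module n G\<^esub> x) = C \<odot>\<^bsub>Bann_module n G\<^esub> f x) \<longleftrightarrow>
      (\<forall>P\<in>\<D>deg 0. \<forall>x\<in>W. f (P x) = P (f x))" if "f \<in> W \<rightarrow>\<^sub>E W'" for f
  proof -
    have "x \<in> Bann \<and> f x \<in> Bann" if "x \<in> W" for x using that \<open>f \<in> _\<close> assms by (auto simp: PiE_iff)
    then show ?thesis by (auto simp: R_carrier R_smult)
  qed
  then show ?thesis by (auto simp: module_hom_def homs_def)
qed

section \<open>Semisimplicity, the isomorphism of categories and simple submodules\<close>

lemma Bann_semisimple: "semisimple_module (R_ring n G) (Bann_module n G)"
proof -
  note st = stable_Bann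
  let ?A = "add_monoid (Bann_module n G)"
  obtain S where "orthogonal_decomposition Bann S" using semisimple_decomposition[OF st] by blast
  note od = this[unfolded orthogonal_decomposition_def]
  note S = conjunct1[OF od] conjunct1[OF conjunct2[OF od]] conjunct2[OF conjunct2[OF od]]
  have ab: "abelian_group (Bann_module n G)" using Bann_left_module left_module.axioms(2) by blast
  have inv: "inv\<^bsub>?A\<^esub> x = - x" if "x \<in> Bann" for x
    by (rule mpoly_group_inv) (use that stable_0[OF st] stable_add[OF st] stable_minus[OF st] in auto)
  have gen: "generate ?A X \<subseteq> Bann" if "X \<subseteq> Bann" for X
    using group.generate_incl[OF abelian_group.a_group[OF ab]] that by simp
  have "Bann \<subseteq> generate ?A (\<Union>S)"
  proof (rule S(3)[rule_format])
    show "0 \<in> generate ?A (\<Union>S)" using generate.one[of ?A] by simp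
    show "x + y \<in> generate ?A (\<Union>S)" if "x \<in> generate ?A (\<Union>S)" "y \<in> generate ?A (\<Union>S)" for x y
      using generate.eng[OF that] by simp
    show "\<Union>S \<subseteq> generate ?A (\<Union>S)" by (rule subsetI, rule generate.incl)
  qed
  moreover have "\<Union>S \<subseteq> Bann" using S(1) by blast
  ultimately have "generate ?A (\<Union>S) = Bann" using gen by blast
  moreover have "N \<inter> generate ?A (\<Union>(S - {N})) = {0}" if N: "N \<in> S" for N
  proof -
    have orth: "ip x y = 0" if "x \<in> N" "y \<in> generate ?A (\<Union>(S - {N}))" for x y
      using that(2)
    proof (induction rule: generate.induct)
      case (incl y)
      then show ?case using S(2) N that(1) by blast
    next
      case (inv y)
      then obtain M where M: "M \<in> S" "M \<noteq> N" "y \<in> M" by blast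
      then have "ip x y = 0" "y \<in> Bann" using S(1,2) N that(1) by blast+
      then show ?case using \<open>\<And>x. x \<in> Bann \<Longrightarrow> inv\<^bsub>?A\<^esub> x = - x\<close> by (simp only: ip_minus_right minus_zero)
    qed (auto simp: ip_add_right)
    have "N \<subseteq> polys n" using S(1) N Bann_polys by blast
    then have "x = 0" if "x \<in> N" "x \<in> generate ?A (\<Union>(S - {N}))" for x
      by (rule ip_definite[OF subsetD[OF _ that(1)] orth[OF that]])
    moreover have "0 \<in> N" using bspec[OF S(1) N] by (auto simp: minimal_stable_def stable_0)
    moreover have "0 \<in> generate ?A (\<Union>(S - {N}))" using generate.one[of ?A] by simp
    ultimately show ?thesis by blast
  qed
  ultimately show ?thesis
    unfolding semisimple_module_def using Bann_left_module S(1) by (intro conjI exI[of _ S]) (simp_all add: Bann_simple_iff)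
qed

text \<open>The homogeneous parts of a stable subspace are stable, and one of them is nonzero.\<close>

lemma minimal_stable_homog:
  assumes "minimal_stable W"
  shows "\<exists>d. W \<subseteq> homog n d"
proof -
  have W: "stable (\<D>deg 0) W" "W \<noteq> {0}" using assms by (auto simp: minimal_stable_def)
  have z: "stable (\<D>deg 0) {0}" using End_0[OF D_End[OF Ddeg_D]] by (auto simp: stable_def)
  obtain d where "W \<inter> homog n d \<noteq> {0}"
    using stable_homog_subset[OF z W(1)] W(2) stable_0[OF W(1)] by blast
  then have "W \<inter> homog n d = W"
    using assms stable_homog_part[OF W(1), of d] unfolding minimal_stable_def by blast
  then show ?thesis by blast
qed

lemma ann_inverse_functors:
  "\<exists>Ga. inverse_functors (submodule_cat (inv_ops n G) (B_module n)) (submodule_cat (R_ring n G) (Bann_module n G))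
    (ann n G) (\<lambda>N N' f. restrict f (ann n G N)) (D_span n G) Ga"
  (is "\<exists>Ga. inverse_functors ?C ?D _ _ _ Ga")
proof -
  have C: "Obj ?C = {N. stable \<D> N}" "Hom ?C = (\<lambda>N N'. homs \<D> N N')"
    "Idt ?C = (\<lambda>N. \<lambda>x\<in>N. x)" "Cmp ?C = (\<lambda>N N' N'' g f. compose N g f)"
    by (simp_all add: submodule_cat_def B_submodule_iff B_hom)
  have D: "Obj ?D = {W. stable (\<D>deg 0) W \<and> W \<subseteq> Bann}"
    "\<And>W W'. W \<subseteq> Bann \<Longrightarrow> W' \<subseteq> Bann \<Longrightarrow> Hom ?D W W' = homs (\<D>deg 0) W W'"
    "Idt ?D = (\<lambda>N. \<lambda>x\<in>N. x)" "Cmp ?D = (\<lambda>N N' N'' g f. compose N g f)"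
    by (simp_all add: submodule_cat_def Bann_submodule_iff Bann_hom)
  have annB: "ann n G N \<subseteq> Bann" if "stable \<D> N" for N
    using that by (intro ann_mono) (simp add: stable_def)
  have annN: "ann n G N \<subseteq> N" for N by (auto simp: ann_def)
  have F: "is_functor ?C ?D (ann n G) (\<lambda>N N' f. restrict f (ann n G N))"
    unfolding is_functor_def C D
  proof (intro conjI ballI)
    fix N assume "N \<in> {N. stable \<D> N}"
    then show "ann n G N \<in> {W. stable (\<D>deg 0) W \<and> W \<subseteq> Bann}"
      using stable_ann stable_D_D0 annB by blast
    show "restrict (\<lambda>x\<in>N. x) (ann n G N) = (\<lambda>x\<in>ann n G N. x)"
      by (simp add: Int_absorb1[OF annN])
  next
    fix N N' f assume *: "N \<in> {N. stable \<D> N}" "N' \<in> {N. stable \<D> N}" "f \<in> homs \<D> N N'"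
    then show "restrict f (ann n G N) \<in> Hom ?D (ann n G N) (ann n G N')"
      using D(2)[OF annB annB] restrict_homs_ann by simp
  next
    fix N N' N'' f g assume *: "N \<in> {N. stable \<D> N}" "N' \<in> {N. stable \<D> N}" "f \<in> homs \<D> N N'"
    then have "f x \<in> ann n G N'" if "x \<in> ann n G N" for x
      using homs_mem[OF restrict_homs_ann, of N N' f x] that by simp
    then show "restrict (compose N g f) (ann n G N) = compose (ann n G N) (restrict g (ann n G N')) (restrict f (ann n G N))"
      by (auto simp: compose_def Int_absorb1[OF annN] intro!: restrict_ext)
  qed
  have bij: "bij_betw (\<lambda>f. restrict f (ann n G N)) (Hom ?C N N') (Hom ?D (ann n G N) (ann n G N'))"
    if "N \<in> Obj ?C" "N' \<in> Obj ?C" for N N'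
    using restrict_bij_betw that D(2)[OF annB annB] by (simp add: C)
  have pol: "W \<subseteq> polys n" if "W \<subseteq> Bann" for W using that Bann_polys by blast
  show ?thesis
    by (rule exI, rule inverse_functors_inv_into[OF is_cat_submodule_cat is_cat_submodule_cat F _ _ _ bij])
      (auto simp: C D(1) D_span_ann ann_D_span intro!: stable_D_span pol)
qed

lemma simple_correspondence:
  assumes N: "stable \<D> N"
  shows "simple_submodule N (inv_ops n G) (B_module n) \<longleftrightarrow>
    simple_submodule (ann n G N) (R_ring n G) (Bann_module n G)"
proof -
  have N_polys: "N \<subseteq> polys n" using N by (simp add: stable_def)
  have z: "stable \<D> {0}" using End_0[OF D_End] by (auto simp: stable_def)
  have ann0: "ann n G {0} = {0}"
    using ann_inter[of "{0}"] stable_0[OF stable_Bann] by auto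
  have D0: "D_span n G {0} = {0}" using D_span_ann[OF z] ann0 by simp
  have NB: "ann n G N \<subseteq> Bann" using N_polys by (rule ann_mono)
  note st = stable_ann[OF stable_D_D0[OF N]]
  show ?thesis
    unfolding B_simple_iff Bann_simple_iff
  proof
    assume *: "stable \<D> N \<and> N \<noteq> {0} \<and> (\<forall>K. stable \<D> K \<longrightarrow> K \<subseteq> N \<longrightarrow> K = {0} \<or> K = N)"
    have "ann n G N \<noteq> {0}" using * D_span_ann[OF N] D0 by metis
    moreover have "K = {0} \<or> K = ann n G N" if K: "stable (\<D>deg 0) K" "K \<subseteq> ann n G N" for K
    proof -
      have KB: "K \<subseteq> Bann" using K(2) NB by blast
      have "D_span n G K \<subseteq> N" using K(2) by (intro D_span_minimal[OF N]) (auto simp: ann_def)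
      moreover have "stable \<D> (D_span n G K)" using K(1) by (intro stable_D_span) (simp add: stable_def)
      ultimately have "D_span n G K = {0} \<or> D_span n G K = N" using * by blast
      then show ?thesis using ann_D_span[OF K(1) KB] ann0 by auto
    qed
    ultimately show "minimal_stable (ann n G N) \<and> ann n G N \<subseteq> Bann"
      using st NB by (auto simp: minimal_stable_def)
  next
    assume *: "minimal_stable (ann n G N) \<and> ann n G N \<subseteq> Bann"
    have "N \<noteq> {0}" using * ann0 by (auto simp: minimal_stable_def)
    moreover have "K = {0} \<or> K = N" if K: "stable \<D> K" "K \<subseteq> N" for K
    proof -
      have "ann n G K = {0} \<or> ann n G K = ann n G N"
        using * stable_ann[OF stable_D_D0[OF K(1)]] ann_mono[OF K(2)] by (auto simp: minimal_stable_def)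
      then show ?thesis using D_span_ann[OF K(1)] D_span_ann[OF N] D0 by metis
    qed
    ultimately show "stable \<D> N \<and> N \<noteq> {0} \<and> (\<forall>K. stable \<D> K \<longrightarrow> K \<subseteq> N \<longrightarrow> K = {0} \<or> K = N)"
      using N by blast
  qed
qed

end

theorem corollary3p3:
  fixes n :: nat and G :: "complex mat set"
  assumes "subgroup G (GL n)" and "finite G"
  shows
    "(finite_dim (ann n G (polys n)) \<and> semisimple_module (R_ring n G) (Bann_module n G)) \<and>
     (\<exists>Ga. inverse_functors
        (submodule_cat (inv_ops n G) (B_module n))
        (submodule_cat (R_ring n G) (Bann_module n G))
        (ann n G) (\<lambda>N N' f. restrict f (ann n G N))
        (D_span n G) Ga) \<and>
     (\<forall>N. submodule N (inv_ops n G) (B_module n) \<longrightarrow>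
        (simple_submodule N (inv_ops n G) (B_module n) \<longleftrightarrow>
         simple_submodule (ann n G N) (R_ring n G) (Bann_module n G))) \<and>
     (\<forall>W. simple_submodule W (R_ring n G) (Bann_module n G) \<longrightarrow> (\<exists>d. W \<subseteq> homog n d))"
proof -
  interpret finite_linear_group n G using assms by (rule finite_linear_group.intro)
  show ?thesis
    using Bann_finite_dim Bann_semisimple ann_inverse_functors simple_correspondence minimal_stable_homog
    by (simp add: B_submodule_iff Bann_simple_iff)
qed

end
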